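(* Let $T>0$, $\mu>0$. Let $\Phi:L^2(\mathbb T^3)\to L_2(\mathfrak U;L^2(\mathbb T^3))$ map $W^{k,2}(\mathbb T^3)$ into $L_2(\mathfrak U;W^{k,2}(\mathbb T^3))$ for $k=1,2$ and satisfy, for some constant $C>0$: $\|\Phi(u)-\Phi(v)\|_{L_2(\mathfrak U;L^2_x)}\le C\|u-v\|_{L^2_x}$, $\|D\Phi(u)\|_{L_2(\mathfrak U;\mathcal L(L^2;L^2))}\le C$ and $\|D^2\Phi(u)\|_{L_2(\mathfrak U;\mathcal L(L^2\times L^2;L^2))}\le C$ for all $u,v\in L^2(\mathbb T^3)$; $\|\Phi(u)\|_{L_2(\mathfrak U;W^{1,2}_x)}\le C(1+\|u\|_{W^{1,2}_x})$ for all $u\in W^{1,2}(\mathbb T^3)$; and $\|\Phi(u)\|_{L_2(\mathfrak U;W^{2,2}_x)}\le C(1+\|u\|_{W^{1,4}_x}^2+\|u\|_{W^{2,2}_x})$ for all $u\in W^{2,2}(\mathbb T^3)$. Let $u_0\in L^2(\Omega;W^{2,2}_{\mathrm{div}}(\mathbb T^3))$ be $\mathfrak F_0$-measurable. For $M\in\mathbb N$, $\tau=T/M$, let $(u_m)_{m=1}^M$ be the solution of the semi-implicit Euler scheme started from $u_0$ and let $\mathfrak s^{\tt d}_R$ be the discrete stopping time defined in the context. Then there is a constant $c>0$, independent of $\tau$ and $R$, such that the following holds: if $R=R(\tau)$ is chosen such that $\tau e^{cR^2}\to0$ as $\tau\to0$, then for any $\ell\in\mathbb N$ $$\lim_{\tau\to0}\mathbb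 P\big(\mathfrak s^{\tt d}_R\le\ell\tau\big)=0.$$
   Context: **Spaces and noise.** $\mathbb T^3$ is the three-dimensional flat torus; function spaces consist of $\mathbb R^3$-valued periodic functions where appropriate, the subscript $x$ indicates norms over $\mathbb T^3$, and the subscript $\mathrm{div}$ denotes the subspace of (weakly) divergence-free vector fields. $(\Omega,\mathfrak F,(\mathfrak F_t)_{t\ge0},\mathbb P)$ is a stochastic basis with complete right-continuous filtration; $W=\sum_{j\ge1}\beta_je_j$ is a cylindrical Wiener process, with $(e_j)$ a complete orthonormal system in a separable Hilbert space $\mathfrak U$ and $(\beta_j)$ independent standard real $(\mathfrak F_t)$-Wiener processes. $L_2(\mathfrak U;H)$ denotes Hilbert--Schmidt operators; $\|D\Phi(u)\|_{L_2(\mathfrak U;\mathcal L(L^2;L^2))}^2=\sum_k\|D(\Phi(\cdot)e_k)(u)\|^2_{\mathcal L(L^2;L^2)}$ and analogously for $D^2\Phi$. $(a\otimes b):\nabla\varphi=\sum_{i,j}a_ib_j\partial_j\varphi_i$. **Time discretisation.** With $t_m=m\tau$ and $\Delta_mW=W(t_m)-W(t_{m-1})$, for $1\le m\le M$, $u_m$ is the $\mathfrak F_{t_m}$-measurable $W^{1,2}_{\mathrm{div}}(\mathbb T^3)$-valued random variable (existing uniquely) such that $\mathbb P$-a.s. for all $\varphi\in W^{1,2}_{\mathrm{div}}(\mathbb T^3)$ $$\int u_m\cdot\varphi\,dx-\tau\int(u_m\otimes u_{m-1}):\nabla\varphi\,dx=-\mu\tau\int\nabla u_m:\nabla\varphi\,dx+\int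 u_{m-1}\cdot\varphi\,dx+\int\Phi(u_{m-1})\,\Delta_mW\cdot\varphi\,dx.$$ **Discrete stopping time.** For $R>0$, $\mathfrak s_R^{\tt d}=\min\{t_m:0\le m\le M,\ \max_{0\le n\le m}\|u_n\|_{W^{2,2}_x}\ge R\}$, with $\mathfrak s_R^{\tt d}=t_M$ if the set is empty.
   Formalization: The formal statement additionally assumes R(τ)→∞ as τ→0; without it the claim fails, e.g. for Φ=0, u_0 a nonzero constant field and R equal to its W^{2,2} norm, where the stopping time is 0 although τe^{cR²}→0. *)

theory Defs
  imports "HOL-Probability.Probability"
begin

section \<open>The Hilbert space of square integrable vector fields on the torus\<close>

text \<open>The flat torus is \<open>\<real>\<^sup>3 / \<int>\<^sup>3\<close>. Up to null sets a periodic field is the same as a field on the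
  fundamental cell, so measurable fields are only looked at on the cell; periodicity is imposed on
  the test functions below.\<close>

definition torus :: "(real^3) measure" where
  "torus = restrict_space lborel {x. \<forall>i. 0 \<le> x $ i \<and> x $ i < 1}"

definition sq_integrable :: "(real^3 \<Rightarrow> real^3) \<Rightarrow> bool" where
  "sq_integrable f \<longleftrightarrow> f \<in> borel_measurable torus \<and> integrable torus (\<lambda>x. (norm (f x))\<^sup>2)"

definition ae_eq :: "(real^3 \<Rightarrow> real^3) \<Rightarrow> (real^3 \<Rightarrow> real^3) \<Rightarrow> bool" where
  "ae_eq f g \<longleftrightarrow> sq_integrable f \<and> sq_integrable g \<and> (AE x in torus. f x = g x)"

lemma sq_integrable_0: "sq_integrable (\<lambda>_. 0)"
  by (simp add: sq_integrable_def)

lemma sq_integrable_add: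
  assumes "sq_integrable f" "sq_integrable g"
  shows "sq_integrable (\<lambda>x. f x + g x)"
proof -
  have [measurable]: "f \<in> borel_measurable torus" "g \<in> borel_measurable torus"
    using assms by (auto simp: sq_integrable_def)
  have "integrable torus (\<lambda>x. (norm (f x + g x))\<^sup>2)"
  proof (rule Bochner_Integration.integrable_bound)
    show "integrable torus (\<lambda>x. 2 * (norm (f x))\<^sup>2 + 2 * (norm (g x))\<^sup>2)"
      using assms by (auto simp: sq_integrable_def)
    have "(norm (a + b))\<^sup>2 \<le> 2 * (norm a)\<^sup>2 + 2 * (norm b)\<^sup>2" for a b :: "real^3"
    proof -
      have "(norm (a + b))\<^sup>2 \<le> (norm a + norm b)\<^sup>2"
        by (intro power_mono norm_triangle_ineq) auto
      also have "\<dots> \<le> 2 * (norm a)\<^sup>2 + 2 * (norm b)\<^sup>2"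
        using zero_le_power2[of "norm a - norm b"] by (simp add: power2_eq_square algebra_simps)
      finally show ?thesis .
    qed
    then show "AE x in torus. norm ((norm (f x + g x))\<^sup>2)
        \<le> norm (2 * (norm (f x))\<^sup>2 + 2 * (norm (g x))\<^sup>2)"
      by (intro AE_I2) simp
  qed measurable
  then show ?thesis by (simp add: sq_integrable_def)
qed

lemma sq_integrable_scaleR:
  assumes "sq_integrable f"
  shows "sq_integrable (\<lambda>x. r *\<^sub>R f x)"
  using assms by (auto simp: sq_integrable_def power_mult_distrib)

lemma sq_integrable_minus:
  assumes "sq_integrable f"
  shows "sq_integrable (\<lambda>x. - f x)"
  using sq_integrable_scaleR[OF assms, of "-1"] by simp

lemma sq_integrable_diff:
  assumes "sq_integrable f" "sq_integrable g"
  shows "sq_integrable (\<lambda>x. f x - g x)"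
  using sq_integrable_add[OF assms(1) sq_integrable_minus[OF assms(2)]] by simp

lemma integrable_inner_sq:
  assumes "sq_integrable f" "sq_integrable g"
  shows "integrable torus (\<lambda>x. f x \<bullet> g x)"
proof (rule Bochner_Integration.integrable_bound)
  have [measurable]: "f \<in> borel_measurable torus" "g \<in> borel_measurable torus"
    using assms by (auto simp: sq_integrable_def)
  show "(\<lambda>x. f x \<bullet> g x) \<in> borel_measurable torus"
    by measurable
  show "integrable torus (\<lambda>x. (norm (f x))\<^sup>2 + (norm (g x))\<^sup>2)"
    using assms by (auto simp: sq_integrable_def)
  have "\<bar>a \<bullet> b\<bar> \<le> (norm a)\<^sup>2 + (norm b)\<^sup>2" for a b :: "real^3"
  proof -
    have "\<bar>a \<bullet> b\<bar> \<le> norm a * norm b"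
      by (rule Cauchy_Schwarz_ineq2)
    also have "\<dots> \<le> (norm a)\<^sup>2 + (norm b)\<^sup>2"
    proof -
      have "0 \<le> norm a * norm b" by simp
      moreover have "2 * (norm a * norm b) \<le> (norm a)\<^sup>2 + (norm b)\<^sup>2"
        using sum_squares_bound[of "norm a" "norm b"] by simp
      ultimately show ?thesis by linarith
    qed
    finally show ?thesis .
  qed
  then show "AE x in torus. norm (f x \<bullet> g x) \<le> norm ((norm (f x))\<^sup>2 + (norm (g x))\<^sup>2)"
    by (intro AE_I2) simp
qed

quotient_type L2_torus = "real^3 \<Rightarrow> real^3" / partial: ae_eq
proof (rule part_equivpI)
  show "\<exists>f. ae_eq f f"
    using sq_integrable_0 by (auto simp: ae_eq_def)
  show "symp ae_eq"
    by (auto simp: symp_def ae_eq_def elim: AE_mp)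
  show "transp ae_eq"
    by (auto simp: transp_def ae_eq_def elim: AE_mp)
qed

instantiation L2_torus :: real_inner
begin

lift_definition zero_L2_torus :: L2_torus is "\<lambda>_. 0"
  using sq_integrable_0 by (simp add: ae_eq_def)

lift_definition plus_L2_torus :: "L2_torus \<Rightarrow> L2_torus \<Rightarrow> L2_torus" is "\<lambda>f g x. f x + g x"
  by (auto simp: ae_eq_def sq_integrable_add elim: AE_mp)

lift_definition uminus_L2_torus :: "L2_torus \<Rightarrow> L2_torus" is "\<lambda>f x. - f x"
  by (auto simp: ae_eq_def sq_integrable_minus)

lift_definition minus_L2_torus :: "L2_torus \<Rightarrow> L2_torus \<Rightarrow> L2_torus" is "\<lambda>f g x. f x - g x"
  by (auto simp: ae_eq_def sq_integrable_diff elim: AE_mp)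

lift_definition scaleR_L2_torus :: "real \<Rightarrow> L2_torus \<Rightarrow> L2_torus" is "\<lambda>r f x. r *\<^sub>R f x"
  by (auto simp: ae_eq_def sq_integrable_scaleR elim: AE_mp)

lift_definition inner_L2_torus :: "L2_torus \<Rightarrow> L2_torus \<Rightarrow> real"
  is "\<lambda>f g. \<integral>x. f x \<bullet> g x \<partial>torus"
proof -
  fix f f' g g' assume *: "ae_eq f f'" "ae_eq g g'"
  then have [measurable]: "f \<in> borel_measurable torus" "g \<in> borel_measurable torus"
    "f' \<in> borel_measurable torus" "g' \<in> borel_measurable torus"
    by (auto simp: ae_eq_def sq_integrable_def)
  show "(\<integral>x. f x \<bullet> g x \<partial>torus) = (\<integral>x. f' x \<bullet> g' x \<partial>torus)"
    by (rule integral_cong_AE) (use * in \<open>auto simp: ae_eq_def elim: AE_mp\<close>)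
qed

definition norm_L2_torus :: "L2_torus \<Rightarrow> real" where
  "norm_L2_torus u = sqrt (u \<bullet> u)"

definition sgn_L2_torus :: "L2_torus \<Rightarrow> L2_torus" where
  "sgn_L2_torus u = inverse (norm u) *\<^sub>R u"

definition dist_L2_torus :: "L2_torus \<Rightarrow> L2_torus \<Rightarrow> real" where
  "dist_L2_torus u v = norm (u - v)"

definition uniformity_L2_torus :: "(L2_torus \<times> L2_torus) filter" where
  "uniformity_L2_torus = (INF e\<in>{0<..}. principal {(u, v). dist u v < e})"

definition open_L2_torus :: "L2_torus set \<Rightarrow> bool" where
  "open_L2_torus U \<longleftrightarrow> (\<forall>u\<in>U. \<forall>\<^sub>F (u', v) in uniformity. u' = u \<longrightarrow> v \<in> U)"

instance
proof
  fix u v w :: L2_torus and r s :: real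
  show "u + v + w = u + (v + w)"
    by transfer (auto simp: ae_eq_def sq_integrable_add add.assoc)
  show "u + v = v + u"
    by transfer (auto simp: ae_eq_def sq_integrable_add add.commute)
  show "0 + u = u"
    by transfer (auto simp: ae_eq_def)
  show "- u + u = 0"
    by transfer (auto simp: ae_eq_def sq_integrable_0)
  show "u - v = u + - v"
    by transfer (auto simp: ae_eq_def sq_integrable_diff)
  show "r *\<^sub>R (u + v) = r *\<^sub>R u + r *\<^sub>R v"
    by transfer (auto simp: ae_eq_def sq_integrable_add sq_integrable_scaleR scaleR_right_distrib)
  show "(r + s) *\<^sub>R u = r *\<^sub>R u + s *\<^sub>R u"
    by transfer (auto simp: ae_eq_def sq_integrable_add sq_integrable_scaleR scaleR_left_distrib)
  show "r *\<^sub>R s *\<^sub>R u = (r * s) *\<^sub>R u"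
    by transfer (auto simp: ae_eq_def sq_integrable_scaleR)
  show "1 *\<^sub>R u = u"
    by transfer (auto simp: ae_eq_def)
  show "u \<bullet> v = v \<bullet> u"
    by transfer (simp add: inner_commute)
  show "(u + v) \<bullet> w = u \<bullet> w + v \<bullet> w"
    by transfer (simp add: ae_eq_def inner_add_left integrable_inner_sq)
  show "(r *\<^sub>R u) \<bullet> v = r * (u \<bullet> v)"
    by transfer simp
  show "0 \<le> u \<bullet> u"
    by transfer simp
  show "u \<bullet> u = 0 \<longleftrightarrow> u = 0"
  proof transfer
    fix f assume f: "ae_eq f f"
    then have "integrable torus (\<lambda>x. f x \<bullet> f x)"
      by (simp add: ae_eq_def integrable_inner_sq)
    then have "(\<integral>x. f x \<bullet> f x \<partial>torus) = 0 \<longleftrightarrow> (AE x in torus. f x \<bullet> f x = 0)"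
      by (rule integral_nonneg_eq_0_iff_AE) simp
    then show "(\<integral>x. f x \<bullet> f x \<partial>torus) = 0 \<longleftrightarrow> ae_eq f (\<lambda>_. 0)"
      using f by (simp add: ae_eq_def sq_integrable_0)
  qed
qed (simp_all add: norm_L2_torus_def sgn_L2_torus_def dist_L2_torus_def
    uniformity_L2_torus_def open_L2_torus_def)

end


section \<open>Weak derivatives and Sobolev spaces\<close>

definition partial :: "3 \<Rightarrow> (real^3 \<Rightarrow> real) \<Rightarrow> real^3 \<Rightarrow> real" where
  "partial i \<phi> x = frechet_derivative \<phi> (at x) (axis i 1)"

definition periodic_smooth :: "(real^3 \<Rightarrow> real) \<Rightarrow> bool" where
  "periodic_smooth \<phi> \<longleftrightarrow> (\<forall>x i. \<phi> (x + axis i 1) = \<phi> x) \<and>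
     (\<forall>is x. foldr partial is \<phi> differentiable (at x))"

type_synonym multi_index = "nat^3"

definition deg :: "multi_index \<Rightarrow> nat" where
  "deg \<alpha> = (\<Sum>i\<in>UNIV. \<alpha> $ i)"

definition mpartial :: "multi_index \<Rightarrow> (real^3 \<Rightarrow> real) \<Rightarrow> real^3 \<Rightarrow> real" where
  "mpartial \<alpha> \<phi> = (partial 1 ^^ (\<alpha> $ 1)) ((partial 2 ^^ (\<alpha> $ 2)) ((partial 3 ^^ (\<alpha> $ 3)) \<phi>))"

definition is_weak_deriv ::
  "multi_index \<Rightarrow> (real^3 \<Rightarrow> real^3) \<Rightarrow> (real^3 \<Rightarrow> real^3) \<Rightarrow> bool" where
  "is_weak_deriv \<alpha> f g \<longleftrightarrow> integrable torus f \<and> integrable torus g \<and>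
     (\<forall>\<phi>. periodic_smooth \<phi> \<longrightarrow>
        (\<integral>x. mpartial \<alpha> \<phi> x *\<^sub>R f x \<partial>torus) = (-1) ^ deg \<alpha> *\<^sub>R (\<integral>x. \<phi> x *\<^sub>R g x \<partial>torus))"

text \<open>The choices of representatives made by \<open>rep_L2_torus\<close> and by \<open>SOME\<close> are only
  determined almost everywhere; everything below is invariant under changes on null sets.\<close>

definition weak_deriv :: "multi_index \<Rightarrow> L2_torus \<Rightarrow> real^3 \<Rightarrow> real^3" where
  "weak_deriv \<alpha> u = (SOME g. is_weak_deriv \<alpha> (rep_L2_torus u) g)"

abbreviation weak_partial :: "3 \<Rightarrow> L2_torus \<Rightarrow> real^3 \<Rightarrow> real^3" where
  "weak_partial j \<equiv> weak_deriv (axis j 1)"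

definition ennroot :: "real \<Rightarrow> ennreal \<Rightarrow> ennreal" where
  "ennroot p x = (if x = \<infinity> then \<infinity> else ennreal (enn2real x powr (1 / p)))"

text \<open>The norm of \<open>W\<^sup>k\<^sup>,\<^sup>p\<close> for \<open>p \<ge> 2\<close>, with value \<open>\<infinity>\<close> outside this space.\<close>

definition sobolev_norm :: "nat \<Rightarrow> real \<Rightarrow> L2_torus \<Rightarrow> ennreal" where
  "sobolev_norm k p u =
     (if \<forall>\<alpha>. deg \<alpha> \<le> k \<longrightarrow> (\<exists>g. is_weak_deriv \<alpha> (rep_L2_torus u) g)
      then ennroot p (\<Sum>\<alpha> | deg \<alpha> \<le> k. \<integral>\<^sup>+x. ennreal (norm (weak_deriv \<alpha> u x) powr p) \<partial>torus)
      else \<infinity>)"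

definition sobolev :: "nat \<Rightarrow> real \<Rightarrow> L2_torus set" where
  "sobolev k p = {u. sobolev_norm k p u < \<infinity>}"

definition div_free :: "L2_torus \<Rightarrow> bool" where
  "div_free u \<longleftrightarrow> (\<forall>\<phi>. periodic_smooth \<phi> \<longrightarrow>
     (\<integral>x. (\<Sum>i\<in>UNIV. rep_L2_torus u x $ i * partial i \<phi> x) \<partial>torus) = 0)"

definition sobolev_div :: "nat \<Rightarrow> L2_torus set" where
  "sobolev_div k = {u \<in> sobolev k 2. div_free u}"

text \<open>The Borel \<open>\<sigma>\<close>-algebra of \<open>W\<^sub>d\<^sub>i\<^sub>v\<^sup>k\<^sup>,\<^sup>2\<close> with its own norm topology.\<close>

definition borel_sobolev_div :: "nat \<Rightarrow> L2_torus measure" where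
  "borel_sobolev_div k = sigma (sobolev_div k) {U. U \<subseteq> sobolev_div k \<and>
     (\<forall>u\<in>U. \<exists>\<epsilon>>0. \<forall>v\<in>sobolev_div k. sobolev_norm k 2 (v - u) < ennreal \<epsilon> \<longrightarrow> v \<in> U)}"


section \<open>Hilbert-Schmidt norms\<close>

definition complete_orthonormal :: "(nat \<Rightarrow> 'u::real_inner) \<Rightarrow> bool" where
  "complete_orthonormal e \<longleftrightarrow>
     (\<forall>i j. e i \<bullet> e j = (if i = j then 1 else 0)) \<and> closure (span (range e)) = UNIV"

definition ell2_norm :: "(nat \<Rightarrow> ennreal) \<Rightarrow> ennreal" where
  "ell2_norm a = ennroot 2 (\<Sum>k. (a k)\<^sup>2)"

definition HS_norm :: "(nat \<Rightarrow> 'u) \<Rightarrow> ('h \<Rightarrow> ennreal) \<Rightarrow> ('u \<Rightarrow> 'h) \<Rightarrow> ennreal" where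
  "HS_norm e N A = ell2_norm (\<lambda>k. N (A (e k)))"

abbreviation L2_norm :: "L2_torus \<Rightarrow> ennreal" where
  "L2_norm u \<equiv> ennreal (norm u)"


section \<open>Stochastic basis and cylindrical Wiener process\<close>

definition stochastic_basis :: "'w measure \<Rightarrow> (real \<Rightarrow> 'w measure) \<Rightarrow> bool" where
  "stochastic_basis P F \<longleftrightarrow> prob_space P \<and> complete_measure P \<and>
     (\<forall>t\<ge>0. space (F t) = space P \<and> sets (F t) \<subseteq> sets P) \<and>
     (\<forall>s t. 0 \<le> s \<and> s \<le> t \<longrightarrow> sets (F s) \<subseteq> sets (F t)) \<and>
     null_sets P \<subseteq> sets (F 0) \<and>
     (\<forall>t\<ge>0. sets (F t) = (\<Inter>s\<in>{t<..}. sets (F s)))"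

definition wiener_process ::
  "'w measure \<Rightarrow> (real \<Rightarrow> 'w measure) \<Rightarrow> (real \<Rightarrow> 'w \<Rightarrow> real) \<Rightarrow> bool" where
  "wiener_process P F b \<longleftrightarrow>
     (\<forall>t\<ge>0. b t \<in> borel_measurable (F t)) \<and>
     (AE \<omega> in P. b 0 \<omega> = 0) \<and>
     (AE \<omega> in P. continuous_on {0..} (\<lambda>t. b t \<omega>)) \<and>
     (\<forall>s t. 0 \<le> s \<and> s < t \<longrightarrow>
        distributed P lborel (\<lambda>\<omega>. b t \<omega> - b s \<omega>) (normal_density 0 (sqrt (t - s))) \<and>
        prob_space.indep_set P (sets (F s))
          {(\<lambda>\<omega>. b t \<omega> - b s \<omega>) -` A \<inter> space P | A. A \<in> sets borel})"

text \<open>The cylindrical process \<open>W = \<Sum>\<^sub>j \<beta>\<^sub>j e\<^sub>j\<close> is a formal series and is represented by the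
  sequence of its coordinates. The coordinates are independent as processes, i.e. as random
  variables with values in \<open>\<real>\<^bsup>[0,\<infinity>)\<^esup>\<close>.\<close>

definition cylindrical_wiener ::
  "'w measure \<Rightarrow> (real \<Rightarrow> 'w measure) \<Rightarrow> (nat \<Rightarrow> real \<Rightarrow> 'w \<Rightarrow> real) \<Rightarrow> bool" where
  "cylindrical_wiener P F \<beta> \<longleftrightarrow> (\<forall>j. wiener_process P F (\<beta> j)) \<and>
     prob_space.indep_vars P (\<lambda>_. PiM {0..} (\<lambda>_. borel)) (\<lambda>j \<omega>. \<lambda>t\<in>{0..}. \<beta> j t \<omega>) UNIV"

text \<open>\<open>\<xi> = \<Psi> (W t - W s) = \<Sum>\<^sub>k (\<beta>\<^sub>k t - \<beta>\<^sub>k s) \<Psi> e\<^sub>k\<close> for a random operator \<open>\<Psi>\<close>; the series is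
  understood in \<open>L\<^sup>2(\<Omega>; L\<^sup>2)\<close>, as usual for stochastic integrals.\<close>

definition is_noise_increment ::
  "'w measure \<Rightarrow> (nat \<Rightarrow> 'u::real_normed_vector) \<Rightarrow> (nat \<Rightarrow> real \<Rightarrow> 'w \<Rightarrow> real) \<Rightarrow> real \<Rightarrow> real \<Rightarrow>
   ('w \<Rightarrow> 'u \<Rightarrow>\<^sub>L L2_torus) \<Rightarrow> ('w \<Rightarrow> L2_torus) \<Rightarrow> bool" where
  "is_noise_increment P e \<beta> s t \<Psi> \<xi> \<longleftrightarrow> \<xi> \<in> borel_measurable P \<and>
     (\<lambda>n. \<integral>\<^sup>+\<omega>. (L2_norm (\<xi> \<omega> - (\<Sum>k<n. (\<beta> k t \<omega> - \<beta> k s \<omega>) *\<^sub>R blinfun_apply (\<Psi> \<omega>) (e k))))\<^sup>2 \<partial>P)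
       \<longlonglongrightarrow> 0"


section \<open>Semi-implicit Euler scheme and discrete stopping time\<close>

text \<open>\<open>\<integral> (u \<otimes> v) : \<nabla>\<phi> dx\<close> and \<open>\<integral> \<nabla>u : \<nabla>\<phi> dx\<close>\<close>

definition convection :: "L2_torus \<Rightarrow> L2_torus \<Rightarrow> L2_torus \<Rightarrow> real" where
  "convection u v \<phi> = (\<integral>x. (\<Sum>i\<in>UNIV. \<Sum>j\<in>UNIV.
     rep_L2_torus u x $ i * rep_L2_torus v x $ j * weak_partial j \<phi> x $ i) \<partial>torus)"

definition dirichlet :: "L2_torus \<Rightarrow> L2_torus \<Rightarrow> real" where
  "dirichlet u \<phi> = (\<integral>x. (\<Sum>j\<in>UNIV. weak_partial j u x \<bullet> weak_partial j \<phi> x) \<partial>torus)"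

definition euler_solution ::
  "'w measure \<Rightarrow> (real \<Rightarrow> 'w measure) \<Rightarrow> (nat \<Rightarrow> 'u::real_normed_vector) \<Rightarrow>
   (nat \<Rightarrow> real \<Rightarrow> 'w \<Rightarrow> real) \<Rightarrow> real \<Rightarrow> (L2_torus \<Rightarrow> 'u \<Rightarrow>\<^sub>L L2_torus) \<Rightarrow>
   ('w \<Rightarrow> L2_torus) \<Rightarrow> real \<Rightarrow> nat \<Rightarrow> (nat \<Rightarrow> 'w \<Rightarrow> L2_torus) \<Rightarrow> bool" where
  "euler_solution P F e \<beta> \<mu> \<Phi> u\<^sub>0 \<tau> M u \<longleftrightarrow> u 0 = u\<^sub>0 \<and>
     (\<forall>m\<in>{1..M}. u m \<in> measurable (F (real m * \<tau>)) (borel_sobolev_div 1) \<and>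
        (\<exists>\<xi>. is_noise_increment P e \<beta> (real (m - 1) * \<tau>) (real m * \<tau>) (\<lambda>\<omega>. \<Phi> (u (m - 1) \<omega>)) \<xi> \<and>
          (AE \<omega> in P. \<forall>\<phi>\<in>sobolev_div 1.
             u m \<omega> \<bullet> \<phi> - \<tau> * convection (u m \<omega>) (u (m - 1) \<omega>) \<phi>
             = - \<mu> * \<tau> * dirichlet (u m \<omega>) \<phi> + u (m - 1) \<omega> \<bullet> \<phi> + \<xi> \<omega> \<bullet> \<phi>)))"

definition stopping_time_d :: "real \<Rightarrow> nat \<Rightarrow> real \<Rightarrow> (nat \<Rightarrow> 'w \<Rightarrow> L2_torus) \<Rightarrow> 'w \<Rightarrow> real" where
  "stopping_time_d \<tau> M R u \<omega> =
     (let S = {real m * \<tau> | m. m \<le> M \<and> Max ((\<lambda>n. sobolev_norm 2 2 (u n \<omega>)) ` {0..m}) \<ge> ennreal R}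
      in if S = {} then real M * \<tau> else Min S)"

end

theory Submission
  imports Defs
begin

text \<open>For \<open>l < M\<close> the stopping time can only be at most \<open>l\<tau>\<close> if \<open>\<parallel>u\<^sub>n\<parallel> \<ge> R\<close> for some \<open>n \<le> l\<close>, and \<open>R\<close> tends to infinity, so it suffices that the \<open>W\<^sup>2\<^sup>,\<^sup>2\<close> norms of \<open>u\<^sub>n\<close> are tight as
  \<open>\<tau> \<rightarrow> 0\<close> for each fixed \<open>n\<close>. This goes by induction on \<open>n\<close>. On an event where \<open>u\<^sub>n\<^sub>-\<^sub>1\<close> is bounded in
  \<open>W\<^sup>2\<^sup>,\<^sup>2\<close>, the noise increment has second moment of order \<open>\<tau>\<close> in \<open>W\<^sup>2\<^sup>,\<^sup>2\<close>. Testing the Euler equation with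
  divergence-free plane waves gives, for the sizes \<open>b\<close>, \<open>V\<close>, \<open>X\<close> of the Fourier coefficients of \<open>u\<^sub>n\<close>,
  \<open>u\<^sub>n\<^sub>-\<^sub>1\<close> and the noise, the convolution inequality \<open>b \<le> 3 (V + X) + 9 \<surd>(\<tau>/\<mu>) V * b\<close>: the viscous term
  absorbs the derivative falling on the product at the price of \<open>1/\<surd>(\<tau>\<mu>)\<close>. As \<open>\<Sum> (1 + |k|\<^sup>2)\<^sup>-\<^sup>2\<close>
  converges in three dimensions, weighted \<open>\<ell>\<^sup>2\<close> is a convolution algebra, and for small \<open>\<tau>\<close> the
  inequality bounds \<open>u\<^sub>n\<close> in \<open>W\<^sup>2\<^sup>,\<^sup>2\<close> by \<open>u\<^sub>n\<^sub>-\<^sub>1\<close> and the noise.\<close>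

section \<open>Characters on the torus\<close>

text \<open>The Sobolev spaces are defined through representatives and \<open>SOME\<close>, but
  Fourier coefficients do not see null sets; so each Sobolev norm is traded once for the quantity
  \<open>h2_norm\<close>, and the analysis takes place on sequences over \<open>int^3\<close>. Sums
  there have values in \<open>ennreal\<close> because of the main obstacle: the scheme only provides
  \<open>u n\<close> in W^{1,2}, while the bound is wanted in W^{2,2}, so finiteness of
  \<open>h2_norm (u n)\<close> cannot be presupposed when the convolution is absorbed. One step
  turns a bound K into 144 (K + 1); this loss is harmless because the number of steps stays bounded
  while \<open>\<tau>\<close> tends to 0. On the probabilistic side each single
  \<open>\<beta> j\<close> is a Wiener process for the filtration and the family is independent, but
  the second moment of the noise needs more: the product of increments of two different coordinates
  must have mean zero against every bounded variable known at the earlier time. This is derived from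
  the definition rather than read off it.\<close>

lemma borel_measurable_vec_nth_comp [measurable]:
  "f \<in> borel_measurable M \<Longrightarrow> (\<lambda>x. f x $ i) \<in> borel_measurable M"
  for f :: "'a \<Rightarrow> 'b::{real_normed_vector, second_countable_topology}^'n::finite"
proof -
  have "(\<lambda>x::'b^'n. x $ i) \<in> borel_measurable borel"
    by (intro borel_measurable_continuous_onI continuous_intros)
  then show "f \<in> borel_measurable M \<Longrightarrow> ?thesis" by measurable
qed

definition cell :: "(real^3) set" where
  "cell = {x. \<forall>i. 0 \<le> x $ i \<and> x $ i < 1}"

lemma torus_cell: "torus = restrict_space lborel cell"
  by (simp add: torus_def cell_def)

lemma cell_borel [measurable]: "cell \<in> sets borel"
  unfolding cell_def by measurable

lemma space_torus: "space torus = cell"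
  by (simp add: torus_cell space_restrict_space)

lemma emeasure_torus: "emeasure torus (space torus) = 1"
proof -
  have "emeasure lborel (box (0::real^3) 1) \<le> emeasure lborel cell"
    by (rule emeasure_mono) (auto simp: cell_def mem_box_cart less_imp_le)
  moreover have "emeasure lborel cell \<le> emeasure lborel (cbox (0::real^3) 1)"
    by (rule emeasure_mono) (auto simp: cell_def mem_box_cart less_imp_le)
  moreover have "(\<Prod>b\<in>Basis. (1::real^3) \<bullet> b) = 1"
    by (rule prod.neutral) (auto simp: Basis_vec_def inner_axis)
  moreover have "\<forall>b\<in>Basis. 0 \<le> (1::real^3) \<bullet> b"
    by (auto simp: Basis_vec_def inner_axis)
  ultimately have "emeasure lborel cell = 1"
    by (auto simp: emeasure_lborel_box_eq emeasure_lborel_cbox_eq)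
  then show ?thesis
    by (simp add: space_torus torus_cell emeasure_restrict_space)
qed

interpretation torus: prob_space torus
  by (rule prob_spaceI) (rule emeasure_torus)

lemma borel_measurable_torus:
  "f \<in> borel_measurable borel \<Longrightarrow> f \<in> borel_measurable torus"
  unfolding torus_cell by (simp add: measurable_restrict_space1)

lemma continuous_measurable_torus:
  "continuous_on UNIV f \<Longrightarrow> f \<in> borel_measurable torus"
  for f :: "real^3 \<Rightarrow> 'b::topological_space"
  by (intro borel_measurable_torus borel_measurable_continuous_onI)

lemma integrable_torus_bounded:
  fixes f :: "real^3 \<Rightarrow> 'b::{banach, second_countable_topology}"
  assumes "f \<in> borel_measurable torus" "\<And>x. x \<in> cell \<Longrightarrow> norm (f x) \<le> B"
  shows "integrable torus f"
  by (rule torus.integrable_const_bound[of _ B]) (use assms in \<open>auto simp: space_torus\<close>)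

lemma integrable_torus_continuous:
  fixes f :: "real^3 \<Rightarrow> 'b::{banach, second_countable_topology}"
  assumes "continuous_on UNIV f"
  shows "integrable torus f"
proof -
  have "compact (f ` cbox 0 1)"
    by (intro compact_continuous_image continuous_on_subset[OF assms]) auto
  then obtain B where B: "\<forall>y\<in>f ` cbox 0 1. norm y \<le> B"
    by (meson bounded_iff compact_imp_bounded)
  show ?thesis
    by (rule integrable_torus_bounded[OF continuous_measurable_torus[OF assms], of B])
      (use B in \<open>auto simp: cell_def mem_box_cart less_imp_le\<close>)
qed

section \<open>Integration by parts over a period\<close>

lemma has_field_derivative_partial:
  fixes \<psi> :: "real^3 \<Rightarrow> real"
  assumes "\<And>x. \<psi> differentiable (at x)"
  shows "((\<lambda>t. \<psi> (p + t *\<^sub>R axis i 1)) has_field_derivative partial i \<psi> (p + y *\<^sub>R axis i 1)) (at y within S)"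
proof -
  let ?q = "p + y *\<^sub>R axis i 1"
  have 1: "(\<psi> has_derivative frechet_derivative \<psi> (at ?q)) (at ?q)"
    using assms by (simp add: frechet_derivative_works)
  have 2: "((\<lambda>t. p + t *\<^sub>R axis i 1) has_derivative (\<lambda>t. t *\<^sub>R axis i 1)) (at y within S)"
    by (auto intro!: derivative_eq_intros)
  have "((\<lambda>t. \<psi> (p + t *\<^sub>R axis i 1)) has_derivative (\<lambda>t. frechet_derivative \<psi> (at ?q) (t *\<^sub>R axis i 1))) (at y within S)"
    using has_derivative_compose[OF 2, of \<psi>] 1 by simp
  moreover have "(\<lambda>t. frechet_derivative \<psi> (at ?q) (t *\<^sub>R axis i 1)) = (*) (partial i \<psi> ?q)"
    using linear_frechet_derivative[of \<psi> "at ?q"] assms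
    by (auto simp: partial_def linear_scale fun_eq_iff)
  ultimately show ?thesis
    by (simp add: has_field_derivative_def)
qed

text \<open>Fubini isolates the i-th coordinate; along each line in that direction the fundamental
  theorem of calculus leaves the difference of \<open>\<psi>\<close> at two points one period
  apart.\<close>

lemma integral_partial_periodic:
  fixes \<psi> :: "real^3 \<Rightarrow> real"
  assumes diff: "\<And>x. \<psi> differentiable (at x)" and cont: "continuous_on UNIV (partial i \<psi>)"
    and per: "\<And>x. \<psi> (x + axis i 1) = \<psi> x"
  shows "(\<integral>x. partial i \<psi> x \<partial>torus) = 0"
proof -
  interpret product_sigma_finite "\<lambda>_::real^3. lborel::real measure"
    by standard
  define b :: "real^3" where "b = axis i 1"
  define I where "I = Basis - {b}"
  have b: "b \<in> Basis" by (simp add: b_def)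
  have I: "insert b I = Basis" "b \<notin> I" "finite I" using b by (auto simp: I_def)
  define F where "F x = indicator cell x *\<^sub>R partial i \<psi> x" for x
  define S where "S f = (\<Sum>c\<in>Basis. f c *\<^sub>R c)" for f :: "real^3 \<Rightarrow> real"
  have S_meas [measurable]: "S \<in> measurable (Pi\<^sub>M Basis (\<lambda>_. lborel)) borel"
    unfolding S_def[abs_def] by (intro borel_measurable_sum borel_measurable_scaleR) simp_all
  have [measurable]: "partial i \<psi> \<in> borel_measurable borel"
    using cont by (rule borel_measurable_continuous_onI)
  have F_meas [measurable]: "F \<in> borel_measurable borel"
    unfolding F_def[abs_def] by measurable
  have "integrable lborel F"
    using integrable_torus_continuous[OF cont]
    unfolding F_def[abs_def] torus_cell by (subst (asm) integrable_restrict_space) auto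
  then have int: "integrable (Pi\<^sub>M (insert b I) (\<lambda>_. lborel)) (\<lambda>f. F (S f))"
    by (subst (asm) lborel_eq) (simp add: I(1) S_def[abs_def, symmetric] integrable_distr_eq)
  have "(\<integral>x. partial i \<psi> x \<partial>torus) = integral\<^sup>L lborel F"
    unfolding F_def[abs_def] torus_cell by (subst integral_restrict_space) auto
  also have "\<dots> = (\<integral>f. F (S f) \<partial>Pi\<^sub>M (insert b I) (\<lambda>_. lborel))"
    by (subst lborel_eq) (simp add: I(1) S_def[abs_def, symmetric] integral_distr)
  also have "\<dots> = (\<integral>f. (\<integral>y. F (S (f(b := y))) \<partial>lborel) \<partial>Pi\<^sub>M I (\<lambda>_. lborel))"
    by (rule product_integral_insert[OF I(3,2) int])
  also have "(\<lambda>f. (\<integral>y. F (S (f(b := y))) \<partial>lborel)) = (\<lambda>f. 0)"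
  proof
    fix f :: "real^3 \<Rightarrow> real"
    define p where "p = (\<Sum>c\<in>I. f c *\<^sub>R c)"
    have S: "S (f(b := y)) = p + y *\<^sub>R b" for y
    proof -
      have "S (f(b := y)) = (\<Sum>c\<in>insert b I. (f(b := y)) c *\<^sub>R c)"
        unfolding S_def I(1) ..
      also have "\<dots> = y *\<^sub>R b + (\<Sum>c\<in>I. (f(b := y)) c *\<^sub>R c)"
        using I by (subst sum.insert) auto
      also have "(\<Sum>c\<in>I. (f(b := y)) c *\<^sub>R c) = p"
        unfolding p_def using I by (intro sum.cong) auto
      finally show ?thesis by (simp only: add.commute)
    qed
    have pi: "p $ i = 0"
    proof -
      have "p \<bullet> b = (\<Sum>c\<in>I. f c *\<^sub>R (c \<bullet> b))" by (simp add: p_def inner_sum_left)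
      also have "\<dots> = 0" using b by (intro sum.neutral) (auto simp: I_def inner_Basis)
      finally show ?thesis by (simp add: b_def inner_axis)
    qed
    \<comment> \<open>The cell is a box, so along this line its indicator is a constant decided by
      the other coordinates times the indicator of [0,1).\<close>
    define Q where "Q \<longleftrightarrow> (\<forall>j. j \<noteq> i \<longrightarrow> 0 \<le> p $ j \<and> p $ j < 1)"
    have cell: "p + y *\<^sub>R b \<in> cell \<longleftrightarrow> Q \<and> 0 \<le> y \<and> y < 1" for y
      unfolding cell_def Q_def b_def using pi by (auto simp: axis_def)
    have "(\<integral>y. F (S (f(b := y))) \<partial>lborel) = (\<integral>y. (if Q then 1 else 0) * (indicator {0..<1} y *\<^sub>R partial i \<psi> (p + y *\<^sub>R b)) \<partial>lborel)"
      unfolding F_def S by (intro Bochner_Integration.integral_cong refl) (auto simp: indicator_def cell)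
    also have "\<dots> = (if Q then 1 else 0) * (\<integral>y. indicator {0..<1} y *\<^sub>R partial i \<psi> (p + y *\<^sub>R b) \<partial>lborel)"
      by simp
    also have "(\<integral>y. indicator {0..<1} y *\<^sub>R partial i \<psi> (p + y *\<^sub>R b) \<partial>lborel)
        = (\<integral>y. indicator {0..1} y *\<^sub>R partial i \<psi> (p + y *\<^sub>R b) \<partial>lborel)"
    proof (rule integral_cong_AE)
      \<comment> \<open>The cell is half-open, while the fundamental theorem is applied on the
        closed interval.\<close>
      have "AE y in lborel. y \<noteq> (1::real)" by (rule AE_lborel_singleton)
      then show "AE y in lborel. indicator {0..<1} y *\<^sub>R partial i \<psi> (p + y *\<^sub>R b) = indicator {0..1} y *\<^sub>R partial i \<psi> (p + y *\<^sub>R b)"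
        by eventually_elim (auto simp: indicator_def)
    qed measurable
    also have "\<dots> = \<psi> (p + 1 *\<^sub>R b) - \<psi> (p + 0 *\<^sub>R b)"
    proof (rule integral_FTC_atLeastAtMost)
      fix y :: real
      show "((\<lambda>t. \<psi> (p + t *\<^sub>R b)) has_vector_derivative partial i \<psi> (p + y *\<^sub>R b)) (at y within {0..1})"
        unfolding has_real_derivative_iff_has_vector_derivative[symmetric] b_def
        by (rule has_field_derivative_partial[OF diff])
      show "continuous_on {0..1} (\<lambda>y. partial i \<psi> (p + y *\<^sub>R b))"
        by (rule continuous_on_compose2[OF cont]) (auto intro!: continuous_intros)
    qed simp
    also have "\<dots> = 0" using per[of p] by (simp add: b_def)
    finally show "(\<integral>y. F (S (f(b := y))) \<partial>lborel) = 0" by (simp only: mult_zero_right)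
  qed
  finally show ?thesis by simp
qed

section \<open>Characters and their derivatives\<close>

definition phase :: "int^3 \<Rightarrow> real^3 \<Rightarrow> real" where
  "phase k x = 2 * pi * (\<Sum>i\<in>UNIV. of_int (k $ i) * x $ i)"

definition chr :: "int^3 \<Rightarrow> real^3 \<Rightarrow> complex" where
  "chr k x = cis (phase k x)"

text \<open>Test functions are real-valued. The complex coefficient \<open>z\<close> covers cosine
  and sine together and keeps the family closed under \<open>partial\<close>.\<close>

definition trig :: "int^3 \<Rightarrow> complex \<Rightarrow> real^3 \<Rightarrow> real" where
  "trig k z x = Re (z * chr k x)"

text \<open>The eigenvalue of the i-th partial derivative on \<open>chr k\<close>.\<close>

definition freq :: "3 \<Rightarrow> int^3 \<Rightarrow> complex" where
  "freq i k = 2 * pi * \<i> * of_int (k $ i)"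

lemma norm_chr [simp]: "norm (chr k x) = 1"
  by (simp add: chr_def)

lemma chr_0 [simp]: "chr 0 x = 1"
  by (simp add: chr_def phase_def)

lemma phase_add: "phase (k + l) x = phase k x + phase l x"
  by (simp add: phase_def distrib_right sum.distrib distrib_left)

lemma phase_uminus: "phase (- k) x = - phase k x"
  by (simp add: phase_def sum_negf)

lemma chr_add: "chr (k + l) x = chr k x * chr l x"
  by (simp add: chr_def phase_add cis_mult)

lemma cnj_chr: "cnj (chr k x) = chr (- k) x"
  by (simp add: chr_def cis_cnj phase_uminus)

lemma has_derivative_trig:
  "(trig k z has_derivative (\<lambda>h. Re (z * \<i> * chr k x) * phase k h)) (at x)"
proof -
  have 1: "(phase k has_derivative phase k) (at x)"
    by (intro bounded_linear_imp_has_derivative linear_conv_bounded_linear[THEN iffD1] linearI)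
      (simp_all add: phase_def distrib_left sum.distrib sum_distrib_left ac_simps)
  have "((\<lambda>x. Re z * cos (phase k x) - Im z * sin (phase k x)) has_derivative
     (\<lambda>h. Re (z * \<i> * chr k x) * phase k h)) (at x)"
    by (rule derivative_eq_intros 1 refl)+ (auto simp: fun_eq_iff chr_def algebra_simps)
  then show ?thesis
    by (simp add: trig_def[abs_def] chr_def)
qed

lemma partial_trig: "partial i (trig k z) = trig k (freq i k * z)"
proof
  fix x
  have "phase k (axis i 1) = 2 * pi * of_int (k $ i)"
    by (simp add: phase_def axis_def if_distrib[of "\<lambda>x. _ * x"] cong: if_cong)
  then show "partial i (trig k z) x = trig k (freq i k * z) x"
    unfolding partial_def frechet_derivative_at[OF has_derivative_trig, symmetric]
    by (simp add: trig_def freq_def algebra_simps)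
qed

lemma differentiable_trig: "trig k z differentiable (at x)"
  using has_derivative_trig by (auto simp: differentiable_def)

lemma chr_periodic: "chr k (x + axis i 1) = chr k x"
proof -
  have "phase k (x + axis i 1) = phase k x + 2 * pi * of_int (k $ i)"
    by (simp add: phase_def axis_def distrib_left sum.distrib if_distrib[of "\<lambda>x. _ * x"] cong: if_cong)
  then show ?thesis
    by (simp add: chr_def cis_mult[symmetric] cis_multiple_2pi)
qed

lemma periodic_smooth_trig: "periodic_smooth (trig k z)"
proof -
  have "\<exists>z'. foldr partial is (trig k z) = trig k z'" for "is"
  proof (induction "is")
    case (Cons i "is")
    then show ?case by (metis foldr.simps(2) comp_apply partial_trig)
  qed auto
  then show ?thesis
    unfolding periodic_smooth_def using differentiable_trig
    by (metis chr_periodic trig_def)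
qed

lemma chr_trig: "chr k x = Complex (trig k 1 x) (trig k (- \<i>) x)"
  by (simp add: trig_def complex_eq_iff)

lemma continuous_on_chr: "continuous_on S (chr k)"
proof -
  have "continuous_on S (\<lambda>x. cis (phase k x))"
    unfolding phase_def by (intro continuous_intros)
  then show ?thesis by (simp add: chr_def[abs_def])
qed

lemma measurable_chr [measurable]: "chr k \<in> borel_measurable torus"
  by (intro continuous_measurable_torus continuous_on_chr)

lemma partial_periodic:
  assumes "\<And>x. \<phi> (x + axis i 1) = \<phi> x"
  shows "partial j \<phi> (x + axis i 1) = partial j \<phi> x"
proof -
  have "(\<phi> has_derivative D) (at (x + axis i 1)) \<longleftrightarrow> (\<phi> has_derivative D) (at x)" for D
  proof -
    have *: "(\<phi> has_derivative D) (at (x + a)) \<Longrightarrow> ((\<lambda>y. \<phi> (y + a)) has_derivative D) (at x)" for \<phi> :: "real^3 \<Rightarrow> real" and x a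
      by (rule has_derivative_eq_rhs, rule has_derivative_compose[of "\<lambda>y. y + a" "\<lambda>h. h" x UNIV \<phi> D])
        (auto intro!: derivative_eq_intros)
    have "\<phi> (y + - axis i 1) = \<phi> y" for y using assms[of "y - axis i 1"] by simp
    then show ?thesis
      using *[of \<phi> x "axis i 1"] *[of \<phi> "x + axis i 1" "- axis i 1"] assms by (auto simp: fun_eq_iff)
  qed
  then show ?thesis
    by (simp add: partial_def frechet_derivative_def)
qed

lemma periodic_smooth_partial:
  assumes "periodic_smooth \<phi>"
  shows "periodic_smooth (partial i \<phi>)"
  unfolding periodic_smooth_def
proof (intro conjI allI)
  fix x j
  show "partial i \<phi> (x + axis j 1) = partial i \<phi> x"
    using assms by (intro partial_periodic) (auto simp: periodic_smooth_def)
  fix "is"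
  have "foldr partial (is @ [i]) \<phi> differentiable (at x)"
    using assms unfolding periodic_smooth_def by blast
  then show "foldr partial is (partial i \<phi>) differentiable (at x)" by simp
qed

lemma periodic_smooth_differentiable:
  "periodic_smooth \<phi> \<Longrightarrow> \<phi> differentiable (at x)"
  unfolding periodic_smooth_def by (metis foldr_Nil id_apply)

lemma periodic_smooth_continuous:
  "periodic_smooth \<phi> \<Longrightarrow> continuous_on S \<phi>"
  by (intro continuous_at_imp_continuous_on ballI differentiable_imp_continuous_within
      periodic_smooth_differentiable)

lemma periodic_smooth_measurable: "periodic_smooth \<phi> \<Longrightarrow> \<phi> \<in> borel_measurable torus"
  by (intro continuous_measurable_torus periodic_smooth_continuous)

text \<open>The product of \<open>\<phi>\<close> and \<open>trig k z\<close> is periodic, so the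
  integral of its derivative vanishes by \<open>integral_partial_periodic\<close>.\<close>

lemma integral_partial_mult_trig:
  assumes \<phi>: "periodic_smooth \<phi>"
  shows "(\<integral>x. partial i \<phi> x * trig k z x \<partial>torus) = - (\<integral>x. \<phi> x * trig k (freq i k * z) x \<partial>torus)"
proof -
  note cont = periodic_smooth_continuous[OF \<phi>] periodic_smooth_continuous[OF periodic_smooth_trig]
    periodic_smooth_continuous[OF periodic_smooth_partial[OF \<phi>]]
  let ?\<psi> = "\<lambda>x. \<phi> x * trig k z x"
  have partial: "partial i ?\<psi> x = partial i \<phi> x * trig k z x + \<phi> x * trig k (freq i k * z) x" for x
  proof -
    have "(?\<psi> has_derivative (\<lambda>h. \<phi> x * frechet_derivative (trig k z) (at x) h + frechet_derivative \<phi> (at x) h * trig k z x)) (at x)"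
      by (intro has_derivative_mult frechet_derivative_works[THEN iffD1] periodic_smooth_differentiable[OF \<phi>]
          differentiable_trig)
    from fun_cong[OF frechet_derivative_at[OF this], of "axis i 1", symmetric] show ?thesis
      unfolding partial_trig[symmetric] partial_def by simp
  qed
  have "(\<integral>x. partial i ?\<psi> x \<partial>torus) = 0"
  proof (rule integral_partial_periodic)
    show "?\<psi> differentiable (at x)" for x
      by (intro differentiable_mult periodic_smooth_differentiable[OF \<phi>] differentiable_trig)
    show "continuous_on UNIV (partial i ?\<psi>)"
      unfolding partial by (intro continuous_intros cont)
    show "?\<psi> (x + axis i 1) = ?\<psi> x" for x
      using \<phi> periodic_smooth_trig[of k z] by (simp add: periodic_smooth_def)
  qed
  also have "(\<integral>x. partial i ?\<psi> x \<partial>torus) =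
      (\<integral>x. partial i \<phi> x * trig k z x \<partial>torus) + (\<integral>x. \<phi> x * trig k (freq i k * z) x \<partial>torus)"
    unfolding partial
    by (intro Bochner_Integration.integral_add integrable_torus_continuous continuous_intros cont)
  finally show ?thesis by simp
qed

section \<open>Uniqueness of Fourier coefficients\<close>

text \<open>There is no conjugate in \<open>fco\<close>: it is the usual coefficient at frequency \<open>-k\<close>, and the Fourier
  series of \<open>f\<close> is \<open>\<Sum>\<^sub>k fco f k * chr (- k)\<close>.\<close>

definition fco :: "(real^3 \<Rightarrow> complex) \<Rightarrow> int^3 \<Rightarrow> complex" where
  "fco f k = (\<integral>x. f x * chr k x \<partial>torus)"

lemma integrable_mult_bounded:
  fixes f g :: "'a \<Rightarrow> 'b::{real_normed_field, banach, second_countable_topology}"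
  assumes "integrable M f" "g \<in> borel_measurable M" "\<And>x. x \<in> space M \<Longrightarrow> norm (g x) \<le> B"
  shows "integrable M (\<lambda>x. g x * f x)"
proof (rule Bochner_Integration.integrable_bound)
  show "integrable M (\<lambda>x. B * norm (f x))" using assms(1) by simp
  show "AE x in M. norm (g x * f x) \<le> norm (B * norm (f x))"
  proof (rule AE_I2)
    fix x assume "x \<in> space M"
    with assms(3)[OF this] norm_ge_zero[of "g x"] have "norm (g x) * norm (f x) \<le> \<bar>B\<bar> * norm (f x)"
      by (intro mult_right_mono norm_ge_zero) linarith
    then show "norm (g x * f x) \<le> norm (B * norm (f x))"
      by (simp add: norm_mult abs_mult)
  qed
  show "(\<lambda>x. g x * f x) \<in> borel_measurable M"
    using assms by (intro borel_measurable_times) auto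
qed

lemma integrable_mult_chr: "integrable torus f \<Longrightarrow> integrable torus (\<lambda>x. f x * chr k x)"
  using integrable_mult_bounded[of torus f "chr k" 1] by (simp add: mult.commute)

text \<open>The functions with vanishing coefficients are stable under multiplication by characters, hence
  by polynomials in them, hence by Stone-Weierstrass orthogonal to continuous functions of the
  point \<open>torus_embed x\<close>, which determines \<open>x\<close> in the half-open cell.\<close>

definition fourier_null :: "(real^3 \<Rightarrow> complex) \<Rightarrow> bool" where
  "fourier_null f \<longleftrightarrow> integrable torus f \<and> (\<forall>k. fco f k = 0)"

lemma fourier_null_add: "fourier_null f \<Longrightarrow> fourier_null g \<Longrightarrow> fourier_null (\<lambda>x. f x + g x)"
  by (auto simp: fourier_null_def fco_def distrib_right integrable_mult_chr)

lemma fourier_null_cmult: "fourier_null f \<Longrightarrow> fourier_null (\<lambda>x. c * f x)"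
  by (auto simp: fourier_null_def fco_def mult.assoc)

lemma fourier_null_sum: "(\<And>i. i \<in> A \<Longrightarrow> fourier_null (f i)) \<Longrightarrow> fourier_null (\<lambda>x. \<Sum>i\<in>A. f i x)"
  by (induction A rule: infinite_finite_induct)
    (auto intro!: fourier_null_add, auto simp: fourier_null_def fco_def)

lemma fourier_null_chr: "fourier_null f \<Longrightarrow> fourier_null (\<lambda>x. chr m x * f x)"
proof -
  assume f: "fourier_null f"
  have "fco (\<lambda>x. chr m x * f x) k = fco f (m + k)" for k
    by (simp add: fco_def chr_add ac_simps)
  with f show ?thesis
    using integrable_mult_chr[of f m] by (simp add: fourier_null_def mult.commute)
qed

definition torus_embed :: "real^3 \<Rightarrow> complex^3" where
  "torus_embed x = (\<chi> i. chr (axis i 1) x)"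

lemma continuous_on_torus_embed: "continuous_on S torus_embed"
  unfolding torus_embed_def by (intro continuous_intros continuous_on_chr)

lemma measurable_torus_embed: "torus_embed \<in> borel_measurable torus"
  by (intro continuous_measurable_torus continuous_on_torus_embed)

lemma torus_embed_cball: "torus_embed x \<in> cball 0 3"
proof -
  have "norm (torus_embed x) \<le> (\<Sum>i\<in>(UNIV::3 set). norm (torus_embed x $ i))"
    unfolding norm_vec_def by (rule L2_set_le_sum) simp
  then show ?thesis by (simp add: torus_embed_def)
qed

text \<open>The real polynomial functions of the Stone-Weierstrass theorem are generated by
  real-linear functionals, which see \<open>Re\<close> and \<open>Im\<close> of the coordinates
  separately.\<close>

lemma bounded_linear_complex_vec:
  fixes L :: "complex^'n \<Rightarrow> real"
  assumes "bounded_linear L"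
  shows "L z = (\<Sum>i\<in>UNIV. Re (z $ i) * L (axis i 1) + Im (z $ i) * L (axis i \<i>))"
proof -
  interpret bounded_linear L by fact
  have "z = (\<Sum>i\<in>UNIV. Re (z $ i) *\<^sub>R axis i 1 + Im (z $ i) *\<^sub>R axis i \<i>)"
  proof -
    have "(\<Sum>i\<in>UNIV. Re (z $ i) *\<^sub>R axis i 1 + Im (z $ i) *\<^sub>R axis i \<i>) $ j = z $ j" for j
    proof -
      have "(\<Sum>i\<in>UNIV. Re (z $ i) *\<^sub>R axis i 1 + Im (z $ i) *\<^sub>R axis i \<i>) $ j
          = (\<Sum>i\<in>UNIV. if i = j then z $ i else 0)"
        unfolding sum_component by (intro sum.cong refl) (auto simp: axis_def complex_eq_iff)
      then show ?thesis by simp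
    qed
    then show ?thesis by (simp add: vec_eq_iff)
  qed
  then have "L z = L (\<Sum>i\<in>UNIV. Re (z $ i) *\<^sub>R axis i 1 + Im (z $ i) *\<^sub>R axis i \<i>)" by simp
  then show ?thesis by (simp add: sum add scaleR)
qed

lemma fourier_null_polynomial:
  assumes "real_polynomial_function p" "fourier_null f"
  shows "fourier_null (\<lambda>x. of_real (p (torus_embed x)) * f x)"
  using assms
proof (induction arbitrary: f)
  case (linear L)
  \<comment> \<open>By \<open>cnj_chr\<close> the conjugate of a character is the character of the
    opposite frequency. Writing \<open>Re\<close> and \<open>Im\<close> through \<open>w\<close> and
    \<open>cnj w\<close> therefore turns \<open>L\<close> into a combination of characters.\<close>
  have Re: "of_real (Re w) = (1/2) * (w + cnj w)" and Im: "of_real (Im w) = (- \<i>/2) * (w - cnj w)" for w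
    by (simp_all add: complex_add_cnj complex_diff_cnj mult.left_commute[of \<i>])
  define a b :: "3 \<Rightarrow> complex"
    where "a i = of_real (L (axis i 1)) / 2" and "b i = \<i> * of_real (L (axis i \<i>)) / 2" for i
  have eq: "(\<lambda>x. of_real (L (torus_embed x)) * f x) = (\<lambda>x. \<Sum>i\<in>UNIV.
      (a i - b i) * (chr (axis i 1) x * f x) + (a i + b i) * (chr (- axis i 1) x * f x))"
  proof
    fix x
    define w where "w i = chr (axis i 1) x" for i
    have w: "torus_embed x $ i = w i" "chr (- axis i 1) x = cnj (w i)" "chr (axis i 1) x = w i" for i
      by (simp_all add: torus_embed_def w_def cnj_chr)
    have "of_real (L (torus_embed x)) = (\<Sum>i\<in>UNIV. (a i - b i) * w i + (a i + b i) * cnj (w i))"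
      unfolding bounded_linear_complex_vec[OF linear(1), of "torus_embed x"] of_real_sum of_real_add of_real_mult Re Im
      by (intro sum.cong refl) (simp add: w a_def b_def algebra_simps add_divide_distrib diff_divide_distrib)
    then show "of_real (L (torus_embed x)) * f x = (\<Sum>i\<in>UNIV.
      (a i - b i) * (chr (axis i 1) x * f x) + (a i + b i) * (chr (- axis i 1) x * f x))"
      unfolding w by (simp only: sum_distrib_right distrib_right mult.assoc)
  qed
  show ?case
    unfolding eq using linear(2)
    by (intro fourier_null_sum fourier_null_add fourier_null_cmult fourier_null_chr)
next
  case (const c)
  then show ?case by (rule fourier_null_cmult)
next
  case (add p q)
  then show ?case by (simp add: distrib_right fourier_null_add)
next
  case (mult p q)
  have "fourier_null (\<lambda>x. of_real (p (torus_embed x)) * (of_real (q (torus_embed x)) * f x))"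
    using mult by blast
  then show ?case by (simp add: mult.assoc)
qed

text \<open>Replacing \<open>F\<close> by a polynomial within \<open>e\<close> of it on a ball
  containing the range of \<open>torus_embed\<close> changes the integral by at most
  \<open>e\<close> times the L^1 norm of \<open>f\<close>.\<close>

lemma fourier_null_continuous:
  fixes F :: "complex^3 \<Rightarrow> real"
  assumes F: "continuous_on UNIV F" and f: "fourier_null f"
  shows "(\<integral>x. of_real (F (torus_embed x)) * f x \<partial>torus) = 0"
proof -
  have f_int: "integrable torus f" using f by (simp add: fourier_null_def)
  define I where "I = (\<integral>x. norm (f x) \<partial>torus)"
  have I: "I \<ge> 0" by (simp add: I_def)
  have "norm (\<integral>x. of_real (F (torus_embed x)) * f x \<partial>torus) \<le> e * I" if "e > 0" for e
  proof -
    have "continuous_on (cball 0 3) F" using F continuous_on_subset by blast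
    from Stone_Weierstrass_polynomial_function[OF compact_cball this \<open>e > 0\<close>]
    obtain p where p: "real_polynomial_function p" "\<forall>z\<in>cball 0 3. norm (F z - p z) < e"
      by (auto simp: real_polynomial_function_eq)
    note fp = fourier_null_polynomial[OF p(1) f]
    have "fco (\<lambda>x. of_real (p (torus_embed x)) * f x) 0 = 0"
      using fp by (simp add: fourier_null_def)
    then have 0: "(\<integral>x. of_real (p (torus_embed x)) * f x \<partial>torus) = 0"
      by (simp add: fco_def)
    have [measurable]: "(\<lambda>x. F (torus_embed x)) \<in> borel_measurable torus"
      using measurable_comp[OF measurable_torus_embed borel_measurable_continuous_onI[OF F]]
      by (simp add: comp_def)
    have pint: "integrable torus (\<lambda>x. of_real (p (torus_embed x)) * f x)"
      using fp by (simp add: fourier_null_def)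
    have "compact (F ` cball 0 3)" by (intro compact_continuous_image compact_cball) fact
    then obtain B where B: "\<forall>y\<in>F ` cball 0 3. norm y \<le> B"
      by (meson bounded_iff compact_imp_bounded)
    have Fint: "integrable torus (\<lambda>x. of_real (F (torus_embed x)) * f x)"
      by (rule integrable_mult_bounded[OF f_int, of _ B]) (use B torus_embed_cball in auto)
    have "(\<integral>x. of_real (F (torus_embed x)) * f x \<partial>torus)
        = (\<integral>x. of_real (F (torus_embed x)) * f x - of_real (p (torus_embed x)) * f x \<partial>torus)"
      using 0 by (simp add: Bochner_Integration.integral_diff[OF Fint pint])
    also have "norm \<dots> \<le> (\<integral>x. norm (of_real (F (torus_embed x)) * f x - of_real (p (torus_embed x)) * f x) \<partial>torus)"
      by (rule integral_norm_bound)
    also have "\<dots> \<le> (\<integral>x. e * norm (f x) \<partial>torus)"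
    proof (rule integral_mono)
      show "integrable torus (\<lambda>x. norm (of_real (F (torus_embed x)) * f x - of_real (p (torus_embed x)) * f x))"
        by (intro integrable_norm Bochner_Integration.integrable_diff Fint pint)
      show "integrable torus (\<lambda>x. e * norm (f x))" using f_int by simp
      fix x
      have "norm (F (torus_embed x) - p (torus_embed x)) \<le> e" using p(2) torus_embed_cball less_imp_le by blast
      then have "norm (complex_of_real (F (torus_embed x) - p (torus_embed x))) \<le> e" by (simp only: norm_of_real) simp
      then show "norm (of_real (F (torus_embed x)) * f x - of_real (p (torus_embed x)) * f x) \<le> e * norm (f x)"
        by (simp add: left_diff_distrib[symmetric] norm_mult mult_right_mono flip: of_real_diff)
    qed
    finally show ?thesis by (simp add: I_def)
  qed
  then have "norm (\<integral>x. of_real (F (torus_embed x)) * f x \<partial>torus) \<le> 0"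
  proof -
    assume *: "\<And>e. e > 0 \<Longrightarrow> norm (\<integral>x. of_real (F (torus_embed x)) * f x \<partial>torus) \<le> e * I"
    show ?thesis
    proof (rule field_le_epsilon)
      fix e :: real assume "e > 0"
      \<comment> \<open>The denominator is \<open>I + 1\<close> because \<open>I\<close> itself may
        be 0.\<close>
      have "e / (I + 1) * I \<le> e" using I \<open>e > 0\<close> by (simp add: field_simps)
      then show "norm (\<integral>x. of_real (F (torus_embed x)) * f x \<partial>torus) \<le> 0 + e"
        using *[of "e / (I + 1)"] I \<open>e > 0\<close> by simp
    qed
  qed
  then show ?thesis by simp
qed

lemma fourier_null_open:
  assumes U: "open U" and f: "fourier_null f"
  shows "(\<integral>x. indicator U (torus_embed x) * f x \<partial>torus) = 0"
proof (cases "U = UNIV")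
  case True
  then show ?thesis using fourier_null_continuous[of "\<lambda>_. 1", OF _ f] by simp
next
  case False
  have f_int: "integrable torus f" using f by (simp add: fourier_null_def)
  note [measurable] = measurable_torus_embed
  have [measurable]: "U \<in> sets borel" using U by auto
  \<comment> \<open>Continuous functions increasing to the indicator of \<open>U\<close>. As
    \<open>infdist\<close> to the empty set is 0, they would all vanish for \<open>U = UNIV\<close>,
    hence the case distinction.\<close>
  define F where "F n z = min 1 (real n * infdist z (- U))" for n z
  have F_cont: "continuous_on UNIV (F n)" for n
    unfolding F_def[abs_def] by (intro continuous_intros)
  have [measurable]: "F n \<in> borel_measurable borel" for n
    using F_cont by (rule borel_measurable_continuous_onI)
  have F_lim: "(\<lambda>n. F n z) \<longlonglongrightarrow> indicator U z" for z
  proof (cases "z \<in> U")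
    case False
    then show ?thesis by (simp add: F_def infdist_nonneg)
  next
    case True
    then have "infdist z (- U) > 0"
      using U False by (intro infdist_pos_not_in_closed) auto
    then have "eventually (\<lambda>n. 1 \<le> real n * infdist z (- U)) sequentially"
      by real_asymp
    then have "eventually (\<lambda>n. F n z = 1) sequentially"
      by eventually_elim (simp add: F_def)
    then show ?thesis using True by (simp add: tendsto_eventually)
  qed
  have "(\<lambda>n. \<integral>x. of_real (F n (torus_embed x)) * f x \<partial>torus) \<longlonglongrightarrow> (\<integral>x. indicator U (torus_embed x) * f x \<partial>torus)"
  proof (rule integral_dominated_convergence)
    show "integrable torus (\<lambda>x. norm (f x))" using f_int by simp
    show "AE x in torus. (\<lambda>n. of_real (F n (torus_embed x)) * f x) \<longlonglongrightarrow> indicator U (torus_embed x) * f x"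
    proof (rule AE_I2)
      fix x
      have "(\<lambda>n. complex_of_real (F n (torus_embed x))) \<longlonglongrightarrow> of_real (indicator U (torus_embed x))"
        by (intro tendsto_of_real F_lim)
      moreover have "of_real (indicator U (torus_embed x)) = (indicator U (torus_embed x) :: complex)"
        by (simp add: indicator_def)
      ultimately show "(\<lambda>n. of_real (F n (torus_embed x)) * f x) \<longlonglongrightarrow> indicator U (torus_embed x) * f x"
        by (auto intro!: tendsto_mult_right)
    qed
    show "AE x in torus. norm (of_real (F n (torus_embed x)) * f x) \<le> norm (f x)" for n
      by (auto simp: norm_mult F_def infdist_nonneg intro!: mult_left_le_one_le)
  qed (use f_int in measurable)
  moreover have "(\<integral>x. of_real (F n (torus_embed x)) * f x \<partial>torus) = 0" for n
    by (rule fourier_null_continuous[OF F_cont f])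
  ultimately show ?thesis by (simp add: LIMSEQ_const_iff)
qed

text \<open>A Dynkin argument: open sets form an intersection-stable generator, and vanishing of the
  integral passes to disjoint unions and, since \<open>f\<close> itself has integral 0, to
  complements.\<close>

lemma fourier_null_borel:
  assumes B: "B \<in> sets borel" and f: "fourier_null f"
  shows "(\<integral>x. indicator B (torus_embed x) * f x \<partial>torus) = 0"
proof -
  have f_int: "integrable torus f" using f by (simp add: fourier_null_def)
  note [measurable] = measurable_torus_embed
  have int: "integrable torus (\<lambda>x. indicator B (torus_embed x) * f x)" if [measurable]: "B \<in> sets borel" for B
    by (rule integrable_mult_bounded[OF f_int, of _ 1]) (auto simp: indicator_def)
  have "Int_stable {U::(complex^3) set. open U}" by (auto simp: Int_stable_def)
  moreover have "{U::(complex^3) set. open U} \<subseteq> Pow UNIV" by simp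
  moreover have "B \<in> sigma_sets UNIV {U. open U}" using B by (simp add: borel_def)
  ultimately show ?thesis
  proof (induction rule: sigma_sets_induct_disjoint)
    case (basic A)
    then show ?case using fourier_null_open f by simp
  next
    case (compl A)
    then have A: "A \<in> sets borel" by (simp add: borel_def)
    have "(\<integral>x. indicator (UNIV - A) (torus_embed x) * f x \<partial>torus)
        = (\<integral>x. f x - indicator A (torus_embed x) * f x \<partial>torus)"
      by (intro Bochner_Integration.integral_cong refl) (auto simp: indicator_def)
    also have "\<dots> = (\<integral>x. f x \<partial>torus) - (\<integral>x. indicator A (torus_embed x) * f x \<partial>torus)"
      by (intro Bochner_Integration.integral_diff f_int int A)
    also have "(\<integral>x. f x \<partial>torus) = 0"
      using fourier_null_continuous[of "\<lambda>_. 1", OF _ f] by simp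
    finally show ?case using compl by simp
  next
    case (union A)
    then have A [measurable]: "A i \<in> sets borel" for i by (auto simp: borel_def)
    define A' where "A' i = torus_embed -` A i \<inter> space torus" for i
    have [measurable]: "A' i \<in> sets torus" for i unfolding A'_def by measurable
    have ind: "indicator (torus_embed -` B \<inter> space torus) x *\<^sub>R f x = indicator B (torus_embed x) * f x"
      if "x \<in> space torus" for x and B :: "(complex^3) set"
      using that by (simp add: indicator_def)
    have U: "(\<Union>i. A' i) = torus_embed -` (\<Union>i. A i) \<inter> space torus" by (auto simp: A'_def)
    have "(LINT x:(\<Union>i. A' i)|torus. f x) = (\<Sum>i. (LINT x:A' i|torus. f x))"
    proof (rule lebesgue_integral_countable_add)
      show "i \<noteq> j \<Longrightarrow> A' i \<inter> A' j = {}" for i j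
        using union(1) by (auto simp: A'_def disjoint_family_on_def)
      show "set_integrable torus (\<Union>i. A' i) f"
        unfolding set_integrable_def by (intro integrable_mult_indicator f_int) auto
    qed auto
    moreover have "(LINT x:(\<Union>i. A' i)|torus. f x) = (\<integral>x. indicator (\<Union>i. A i) (torus_embed x) * f x \<partial>torus)"
      unfolding set_lebesgue_integral_def U by (intro Bochner_Integration.integral_cong refl ind)
    moreover have "(LINT x:A' i|torus. f x) = 0" for i
    proof -
      have "(LINT x:A' i|torus. f x) = (\<integral>x. indicator (A i) (torus_embed x) * f x \<partial>torus)"
        unfolding set_lebesgue_integral_def A'_def by (intro Bochner_Integration.integral_cong refl ind)
      then show ?thesis using union by simp
    qed
    ultimately show ?case by simp
  qed simp_all
qed

text \<open>A left inverse of \<open>torus_embed\<close> on the cell: \<open>arccos\<close> recovers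
  the angle up to sign and the sign of \<open>Im\<close> selects the half circle. Clamping with
  \<open>max\<close> and \<open>min\<close> makes it Borel on the whole space.\<close>

definition torus_unembed :: "complex^3 \<Rightarrow> real^3" where
  "torus_unembed z = (\<chi> i. let a = arccos (max (-1) (min 1 (Re (z $ i)))) / (2 * pi)
     in if Im (z $ i) \<ge> 0 then a else 1 - a)"

lemma measurable_torus_unembed: "torus_unembed \<in> borel_measurable borel"
proof -
  have a: "(\<lambda>t::real. arccos (max (-1) (min 1 t))) \<in> borel_measurable borel"
    by (intro borel_measurable_continuous_onI continuous_on_arccos continuous_intros) auto
  have b: "(\<lambda>z::complex^3. Re (z $ i)) \<in> borel_measurable borel" for i
    by (intro borel_measurable_continuous_onI continuous_intros)
  have c: "(\<lambda>z::complex^3. Im (z $ i)) \<in> borel_measurable borel" for i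
    by (intro borel_measurable_continuous_onI continuous_intros)
  have "(\<lambda>z. torus_unembed z $ i) \<in> borel_measurable borel" for i
    unfolding torus_unembed_def Let_def vec_lambda_beta
    using measurable_compose[OF b a] c by (intro measurable_If) simp_all
  then show ?thesis
    by (subst borel_measurable_euclidean_space) (simp add: Basis_vec_def inner_axis)
qed

lemma torus_unembed: "x \<in> cell \<Longrightarrow> torus_unembed (torus_embed x) = x"
proof -
  assume x: "x \<in> cell"
  have "torus_unembed (torus_embed x) $ i = x $ i" for i
  proof -
    define t where "t = 2 * pi * x $ i"
    have t: "0 \<le> t" "t < 2 * pi" "x $ i = t / (2 * pi)" using x by (auto simp: cell_def t_def)
    have "(\<Sum>j\<in>UNIV. of_int (axis i 1 $ j) * x $ j) = (\<Sum>j\<in>UNIV. if j = i then x $ j else 0)"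
      by (intro sum.cong refl) (simp add: axis_def)
    then have "phase (axis i 1) x = t" by (simp add: phase_def t_def)
    then have emb: "torus_embed x $ i = cis t" by (simp add: torus_embed_def chr_def)
    show ?thesis
    proof (cases "t \<le> pi")
      case True
      then have "sin t \<ge> 0" using t by (intro sin_ge_zero)
      then show ?thesis using True t by (simp add: torus_unembed_def emb Let_def arccos_cos)
    next
      case False
      then have "sin t < 0" using t by (intro sin_lt_zero) auto
      moreover have "arccos (cos t) = 2 * pi - t"
        using arccos_cos[of "2 * pi - t"] False t by simp
      ultimately show ?thesis using t by (simp add: torus_unembed_def emb Let_def field_simps)
    qed
  qed
  then show ?thesis by (simp add: vec_eq_iff)
qed

text \<open>Every measurable subset of the cell is the preimage under \<open>torus_embed\<close> of
  the Borel set \<open>B\<close>, so \<open>f\<close> has integral 0 over it. Pulling back along the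
  left inverse avoids asking whether images of Borel sets are Borel.\<close>

theorem fourier_uniqueness:
  assumes "integrable torus f" "\<And>k. fco f k = 0"
  shows "AE x in torus. f x = 0"
proof (rule torus.density_zero[OF assms(1)])
  fix A assume A: "A \<in> sets torus"
  then have A': "A \<in> sets borel" "A \<subseteq> cell"
    by (auto simp: torus_cell sets_restrict_space)
  define B where "B = torus_unembed -` A"
  have "B \<in> sets borel"
    using measurable_sets[OF measurable_torus_unembed A'(1)] by (simp add: B_def)
  then have "(\<integral>x. indicator B (torus_embed x) * f x \<partial>torus) = 0"
    using assms by (intro fourier_null_borel) (auto simp: fourier_null_def)
  also have "(\<integral>x. indicator B (torus_embed x) * f x \<partial>torus) = (LINT x:A|torus. f x)"
    unfolding set_lebesgue_integral_def
    by (intro Bochner_Integration.integral_cong refl) (auto simp: B_def space_torus torus_unembed indicator_def)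
  finally show "(LINT x:A|torus. f x) = 0" .
qed

section \<open>Riesz-Fischer and Parseval\<close>

definition sqi :: "(real^3 \<Rightarrow> complex) \<Rightarrow> bool" where
  "sqi f \<longleftrightarrow> f \<in> borel_measurable torus \<and> integrable torus (\<lambda>x. (norm (f x))\<^sup>2)"

lemma sqi_measurable: "sqi f \<Longrightarrow> f \<in> borel_measurable torus"
  by (simp add: sqi_def)

lemma sqi_bounded:
  assumes "f \<in> borel_measurable torus" "\<And>x. norm (f x) \<le> B"
  shows "sqi f"
  unfolding sqi_def
proof
  show "integrable torus (\<lambda>x. (norm (f x))\<^sup>2)"
    by (rule integrable_torus_bounded[of _ "B\<^sup>2"]) (use assms in \<open>auto intro!: power_mono\<close>)
qed fact

lemma sqi_chr: "sqi (chr k)"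
  by (rule sqi_bounded[of _ 1]) auto

lemma sqi_add:
  assumes "sqi f" "sqi g"
  shows "sqi (\<lambda>x. f x + g x)"
  unfolding sqi_def
proof
  have [measurable]: "f \<in> borel_measurable torus" "g \<in> borel_measurable torus"
    using assms by (auto simp: sqi_def)
  show "(\<lambda>x. f x + g x) \<in> borel_measurable torus" by measurable
  show "integrable torus (\<lambda>x. (norm (f x + g x))\<^sup>2)"
  proof (rule Bochner_Integration.integrable_bound)
    show "integrable torus (\<lambda>x. 2 * (norm (f x))\<^sup>2 + 2 * (norm (g x))\<^sup>2)"
      using assms by (auto simp: sqi_def)
    have "(norm (a + b))\<^sup>2 \<le> 2 * (norm a)\<^sup>2 + 2 * (norm b)\<^sup>2" for a b :: complex
    proof -
      have "(norm (a + b))\<^sup>2 \<le> (norm a + norm b)\<^sup>2"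
        by (intro power_mono norm_triangle_ineq) auto
      also have "\<dots> \<le> 2 * (norm a)\<^sup>2 + 2 * (norm b)\<^sup>2"
        using zero_le_power2[of "norm a - norm b"] by (simp add: power2_eq_square algebra_simps)
      finally show ?thesis .
    qed
    then show "AE x in torus. norm ((norm (f x + g x))\<^sup>2) \<le> norm (2 * (norm (f x))\<^sup>2 + 2 * (norm (g x))\<^sup>2)"
      by (intro AE_I2) simp
  qed measurable
qed

lemma sqi_mult_bounded:
  assumes f: "sqi f" and g: "g \<in> borel_measurable torus" "\<And>x. norm (g x) \<le> B"
  shows "sqi (\<lambda>x. g x * f x)"
  unfolding sqi_def
proof
  have [measurable]: "f \<in> borel_measurable torus" using f by (simp add: sqi_def)
  note [measurable] = g(1)
  show "(\<lambda>x. g x * f x) \<in> borel_measurable torus" by measurable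
  have "(norm (g x))\<^sup>2 \<le> B\<^sup>2" for x by (intro power_mono g) simp
  then show "integrable torus (\<lambda>x. (norm (g x * f x))\<^sup>2)"
    unfolding norm_mult power_mult_distrib using f
    by (intro integrable_mult_bounded[of _ _ _ "B\<^sup>2"]) (auto simp: sqi_def)
qed

lemma sqi_cmult: "sqi f \<Longrightarrow> sqi (\<lambda>x. c * f x)"
  using sqi_mult_bounded[of f "\<lambda>_. c" "norm c"] by simp

lemma sqi_diff: "sqi f \<Longrightarrow> sqi g \<Longrightarrow> sqi (\<lambda>x. f x - g x)"
  using sqi_add[of f "\<lambda>x. (-1) * g x"] sqi_cmult[of g "-1"] by simp

lemma sqi_sum: "(\<And>i. i \<in> A \<Longrightarrow> sqi (f i)) \<Longrightarrow> sqi (\<lambda>x. \<Sum>i\<in>A. f i x)"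
  by (induction A rule: infinite_finite_induct) (simp_all add: sqi_add sqi_bounded[of _ 0])

lemma sqi_mult_chr: "sqi f \<Longrightarrow> sqi (\<lambda>x. f x * chr k x)"
  using sqi_mult_bounded[of f "chr k" 1] by (simp add: mult.commute)

lemma sqi_integrable_mult:
  assumes "sqi f" "sqi g"
  shows "integrable torus (\<lambda>x. f x * g x)"
proof (rule Bochner_Integration.integrable_bound)
  have [measurable]: "f \<in> borel_measurable torus" "g \<in> borel_measurable torus"
    using assms by (auto simp: sqi_def)
  show "(\<lambda>x. f x * g x) \<in> borel_measurable torus" by measurable
  show "integrable torus (\<lambda>x. (norm (f x))\<^sup>2 + (norm (g x))\<^sup>2)"
    using assms by (auto simp: sqi_def)
  have "norm (a * b) \<le> (norm a)\<^sup>2 + (norm b)\<^sup>2" for a b :: complex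
    using sum_squares_bound[of "norm a" "norm b"] mult_nonneg_nonneg[OF norm_ge_zero[of a] norm_ge_zero[of b]]
    unfolding norm_mult by linarith
  then show "AE x in torus. norm (f x * g x) \<le> norm ((norm (f x))\<^sup>2 + (norm (g x))\<^sup>2)"
    by (intro AE_I2) simp
qed

lemma sqi_integrable: "sqi f \<Longrightarrow> integrable torus f"
  using sqi_integrable_mult[OF _ sqi_chr[of 0]] by simp

lemma norm_integral_mult_le:
  assumes "sqi f" "sqi g"
  shows "(norm (\<integral>x. f x * g x \<partial>torus))\<^sup>2 \<le> (\<integral>x. (norm (f x))\<^sup>2 \<partial>torus) * (\<integral>x. (norm (g x))\<^sup>2 \<partial>torus)"
proof -
  have [measurable]: "f \<in> borel_measurable torus" "g \<in> borel_measurable torus"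
    using assms by (auto simp: sqi_def)
  have int: "integrable torus (\<lambda>x. norm (f x) * norm (g x))"
    using integrable_norm[OF sqi_integrable_mult[OF assms]] by (simp add: norm_mult)
  have "norm (\<integral>x. f x * g x \<partial>torus) \<le> (\<integral>x. norm (f x) * norm (g x) \<partial>torus)"
    using integral_norm_bound[of torus "\<lambda>x. f x * g x"] by (simp add: norm_mult)
  then have "(norm (\<integral>x. f x * g x \<partial>torus))\<^sup>2 \<le> (\<integral>x. norm (f x) * norm (g x) \<partial>torus)\<^sup>2"
    by (rule power_mono) simp
  also have "\<dots> \<le> (\<integral>x. (norm (f x))\<^sup>2 \<partial>torus) * (\<integral>x. (norm (g x))\<^sup>2 \<partial>torus)"
  proof -
    have "(\<integral>\<^sup>+x. ennreal (norm (f x)) * ennreal (norm (g x)) \<partial>torus)\<^sup>2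
      \<le> (\<integral>\<^sup>+x. (ennreal (norm (f x)))\<^sup>2 \<partial>torus) * (\<integral>\<^sup>+x. (ennreal (norm (g x)))\<^sup>2 \<partial>torus)"
      by (rule Cauchy_Schwarz_nn_integral) auto
    moreover have "(\<integral>\<^sup>+x. (ennreal (norm (f x)))\<^sup>2 \<partial>torus) = ennreal (\<integral>x. (norm (f x))\<^sup>2 \<partial>torus)"
      "(\<integral>\<^sup>+x. (ennreal (norm (g x)))\<^sup>2 \<partial>torus) = ennreal (\<integral>x. (norm (g x))\<^sup>2 \<partial>torus)"
      using assms by (auto simp: sqi_def ennreal_power nn_integral_eq_integral)
    moreover have "(\<integral>\<^sup>+x. ennreal (norm (f x)) * ennreal (norm (g x)) \<partial>torus) = ennreal (\<integral>x. norm (f x) * norm (g x) \<partial>torus)"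
      using int by (simp add: nn_integral_eq_integral flip: ennreal_mult)
    ultimately show ?thesis
      by (simp add: ennreal_power flip: ennreal_mult)
  qed
  finally show ?thesis .
qed

section \<open>Orthogonality of characters, trigonometric polynomials\<close>

lemma integral_chr: "(\<integral>x. chr k x \<partial>torus) = (if k = 0 then 1 else 0)"
proof (cases "k = 0")
  case False
  then obtain i where i: "k $ i \<noteq> 0" by (auto simp: vec_eq_iff)
  have "(\<integral>x. trig k z x \<partial>torus) = 0" for z
  proof -
    \<comment> \<open>Integration by parts against the constant function \<open>trig 0 1\<close>,
      whose derivative vanishes; dividing by \<open>freq i k\<close> is possible in a direction
      where \<open>k\<close> is nonzero.\<close>
    have "partial i (trig 0 1) = (\<lambda>x. 0)" by (simp add: partial_trig freq_def trig_def fun_eq_iff)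
    then have "(\<integral>x. trig 0 1 x * trig k (freq i k * (z / freq i k)) x \<partial>torus) = 0"
      using integral_partial_mult_trig[OF periodic_smooth_trig, of i 0 1 k "z / freq i k"] by simp
    moreover have "freq i k \<noteq> 0" using i by (simp add: freq_def)
    ultimately show ?thesis by (simp add: trig_def)
  qed
  then have "(\<integral>x. Re (chr k x) \<partial>torus) = 0" "(\<integral>x. Im (chr k x) \<partial>torus) = 0"
    by (simp_all add: chr_trig)
  with sqi_integrable[OF sqi_chr[of k]] show ?thesis
    using False by (simp add: complex_eq_iff)
qed (simp add: torus.prob_space)

definition tpoly :: "(int^3) set \<Rightarrow> (int^3 \<Rightarrow> complex) \<Rightarrow> real^3 \<Rightarrow> complex" where
  "tpoly A c x = (\<Sum>k\<in>A. c k * chr (- k) x)"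

lemma sqi_tpoly: "sqi (tpoly A c)"
  unfolding tpoly_def by (intro sqi_sum sqi_cmult sqi_chr)

lemma integral_tpoly_mult:
  assumes "sqi f"
  shows "(\<integral>x. tpoly A c x * f x \<partial>torus) = (\<Sum>k\<in>A. c k * fco f (- k))"
proof -
  have "(\<integral>x. tpoly A c x * f x \<partial>torus) = (\<integral>x. (\<Sum>k\<in>A. c k * (f x * chr (- k) x)) \<partial>torus)"
    unfolding tpoly_def sum_distrib_right
    by (intro Bochner_Integration.integral_cong sum.cong refl) (simp add: ac_simps)
  also have "\<dots> = (\<Sum>k\<in>A. (\<integral>x. c k * (f x * chr (- k) x) \<partial>torus))"
    by (intro Bochner_Integration.integral_sum integrable_mult_right sqi_integrable sqi_mult_chr assms)
  finally show ?thesis by (simp add: fco_def)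
qed

lemma fco_chr: "fco (chr l) k = (if k = - l then 1 else 0)"
  unfolding fco_def chr_add[symmetric] integral_chr by (simp add: eq_neg_iff_add_eq_0 add.commute)

lemma fco_tpoly: "finite A \<Longrightarrow> fco (tpoly A c) k = (if k \<in> A then c k else 0)"
  using integral_tpoly_mult[OF sqi_chr[of k], of A c]
  by (simp add: fco_def[of "tpoly A c"] fco_chr if_distrib[of "\<lambda>x. _ * x"] cong: if_cong)

lemma cnj_tpoly: "cnj (tpoly A c x) = (\<Sum>k\<in>A. cnj (c k) * chr k x)"
  by (simp add: tpoly_def cnj_chr)

lemma of_real_norm_power2: "complex_of_real ((norm z)\<^sup>2) = z * cnj z"
  by (metis complex_norm_square of_real_power)

lemma integral_mult_cnj_tpoly:
  assumes "sqi f"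
  shows "(\<integral>x. f x * cnj (tpoly A c x) \<partial>torus) = (\<Sum>k\<in>A. cnj (c k) * fco f k)"
proof -
  have "(\<integral>x. f x * cnj (tpoly A c x) \<partial>torus) = (\<integral>x. (\<Sum>k\<in>A. cnj (c k) * (f x * chr k x)) \<partial>torus)"
    unfolding cnj_tpoly sum_distrib_left
    by (intro Bochner_Integration.integral_cong sum.cong refl) (simp add: ac_simps)
  also have "\<dots> = (\<Sum>k\<in>A. (\<integral>x. cnj (c k) * (f x * chr k x) \<partial>torus))"
    by (intro Bochner_Integration.integral_sum integrable_mult_right sqi_integrable sqi_mult_chr assms)
  finally show ?thesis by (simp add: fco_def)
qed

lemma integral_norm_tpoly:
  assumes "finite A"
  shows "(\<integral>x. (norm (tpoly A c x))\<^sup>2 \<partial>torus) = (\<Sum>k\<in>A. (norm (c k))\<^sup>2)"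
proof -
  have "complex_of_real (\<integral>x. (norm (tpoly A c x))\<^sup>2 \<partial>torus) = (\<integral>x. tpoly A c x * cnj (tpoly A c x) \<partial>torus)"
    by (simp only: integral_complex_of_real[symmetric] of_real_norm_power2)
  also have "\<dots> = (\<Sum>k\<in>A. cnj (c k) * c k)"
    using assms by (simp add: integral_mult_cnj_tpoly[OF sqi_tpoly] fco_tpoly)
  also have "\<dots> = complex_of_real (\<Sum>k\<in>A. (norm (c k))\<^sup>2)"
    by (simp add: of_real_norm_power2 mult.commute del: of_real_power)
  finally show ?thesis by (simp only: of_real_eq_iff)
qed

text \<open>Pythagoras: the truncated Fourier series is the orthogonal projection onto the
  characters involved.\<close>

lemma integral_norm_diff_fco:
  assumes f: "sqi f" and A: "finite A"
  shows "(\<integral>x. (norm (f x - tpoly A (fco f) x))\<^sup>2 \<partial>torus) = (\<integral>x. (norm (f x))\<^sup>2 \<partial>torus) - (\<Sum>k\<in>A. (norm (fco f k))\<^sup>2)"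
proof -
  let ?p = "tpoly A (fco f)"
  have eq: "(norm (a - b))\<^sup>2 = (norm a)\<^sup>2 + (norm b)\<^sup>2 - 2 * Re (a * cnj b)" for a b :: complex
    unfolding cmod_power2 by (simp add: power2_eq_square algebra_simps)
  have int: "integrable torus (\<lambda>x. f x * cnj (?p x))"
  proof -
    have "sqi (\<lambda>x. cnj (?p x))" unfolding cnj_tpoly by (intro sqi_sum sqi_cmult sqi_chr)
    then show ?thesis by (intro sqi_integrable_mult f)
  qed
  have "(\<integral>x. (norm (f x - ?p x))\<^sup>2 \<partial>torus) = (\<integral>x. (norm (f x))\<^sup>2 + (norm (?p x))\<^sup>2 - 2 * Re (f x * cnj (?p x)) \<partial>torus)"
    by (simp only: eq)
  also have "\<dots> = (\<integral>x. (norm (f x))\<^sup>2 \<partial>torus) + (\<integral>x. (norm (?p x))\<^sup>2 \<partial>torus) - 2 * Re (\<integral>x. f x * cnj (?p x) \<partial>torus)"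
    using f sqi_tpoly[of A "fco f"] integrable_Re[OF int] integral_Re[OF int, symmetric]
    by (subst Bochner_Integration.integral_diff) (auto simp: sqi_def simp del: times_complex.sel complex_cnj integral_Re)
  also have "(\<integral>x. f x * cnj (?p x) \<partial>torus) = (\<Sum>k\<in>A. complex_of_real ((norm (fco f k))\<^sup>2))"
    by (simp only: integral_mult_cnj_tpoly[OF f] of_real_norm_power2 mult.commute)
  finally show ?thesis
    by (simp add: integral_norm_tpoly[OF A] Re_sum del: of_real_power)
qed

text \<open>Finite cubes exhausting the lattice; infinite sums over frequencies are handled as
  limits along them.\<close>

definition fbox :: "nat \<Rightarrow> (int^3) set" where
  "fbox N = {k. \<forall>i. \<bar>k $ i\<bar> \<le> int N}"

lemma finite_fbox [simp]: "finite (fbox N)"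
proof (rule inj_on_finite[of vec_nth])
  show "inj_on vec_nth (fbox N)" by (auto simp: inj_on_def vec_eq_iff)
  show "vec_nth ` fbox N \<subseteq> (UNIV \<rightarrow>\<^sub>E {- int N..int N})"
    by (auto simp: fbox_def abs_le_iff) (metis minus_le_iff)
  show "finite ((UNIV::3 set) \<rightarrow>\<^sub>E {- int N..int N})" by (intro finite_PiE) auto
qed

lemma fbox_mono: "m \<le> n \<Longrightarrow> fbox m \<subseteq> fbox n"
  by (auto simp: fbox_def intro: order_trans)

lemma eventually_fbox: "eventually (\<lambda>N. k \<in> fbox N) sequentially"
proof (rule eventually_sequentiallyI)
  fix N assume "(\<Sum>i\<in>UNIV. nat \<bar>k $ i\<bar>) \<le> N"
  moreover have "nat \<bar>k $ i\<bar> \<le> (\<Sum>i\<in>UNIV. nat \<bar>k $ i\<bar>)" for i by (rule member_le_sum) auto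
  ultimately have "nat \<bar>k $ i\<bar> \<le> N" for i using le_trans by blast
  then show "k \<in> fbox N" by (simp add: fbox_def nat_le_iff)
qed

lemma nn_integral_fbox:
  "(\<lambda>N. \<Sum>k\<in>fbox N. h k) \<longlonglongrightarrow> (\<integral>\<^sup>+k. h k \<partial>count_space UNIV)"
proof -
  have "(\<integral>\<^sup>+k. h k \<partial>count_space UNIV) = (\<integral>\<^sup>+k. (SUP N. h k * indicator (fbox N) k) \<partial>count_space UNIV)"
  proof (intro nn_integral_cong antisym)
    fix k
    obtain N where "k \<in> fbox N" using eventually_fbox[of k] by (auto simp: eventually_sequentially)
    then show "h k \<le> (SUP N. h k * indicator (fbox N) k)" by (intro SUP_upper2[of N]) auto
    show "(SUP N. h k * indicator (fbox N) k) \<le> h k" by (intro SUP_least) (auto simp: indicator_def)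
  qed
  also have "\<dots> = (SUP N. \<integral>\<^sup>+k. h k * indicator (fbox N) k \<partial>count_space UNIV)"
    by (rule nn_integral_monotone_convergence_SUP)
      (use fbox_mono in \<open>fastforce simp: incseq_def le_fun_def indicator_def\<close>, simp)
  also have "\<dots> = (SUP N. \<Sum>k\<in>fbox N. h k)"
  proof (intro SUP_cong refl)
    fix N
    show "(\<integral>\<^sup>+k. h k * indicator (fbox N) k \<partial>count_space UNIV) = (\<Sum>k\<in>fbox N. h k)"
      by (subst nn_integral_count_space'[of "fbox N"]) (auto intro!: sum.cong)
  qed
  finally have "(\<integral>\<^sup>+k. h k \<partial>count_space UNIV) = (SUP N. \<Sum>k\<in>fbox N. h k)" .
  moreover have "incseq (\<lambda>N. \<Sum>k\<in>fbox N. h k)"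
    by (auto simp: incseq_def intro!: sum_mono2 dest: fbox_mono)
  ultimately show ?thesis using LIMSEQ_SUP by metis
qed

lemma nn_integral_fbox_le: "(\<Sum>k\<in>fbox N. h k) \<le> (\<integral>\<^sup>+k. h k \<partial>count_space UNIV)"
proof -
  have "(\<Sum>k\<in>fbox N. h k) = (\<integral>\<^sup>+k. h k * indicator (fbox N) k \<partial>count_space UNIV)"
    by (subst nn_integral_count_space'[of "fbox N"]) (auto intro!: sum.cong)
  also have "\<dots> \<le> (\<integral>\<^sup>+k. h k \<partial>count_space UNIV)"
    by (intro nn_integral_mono) (auto simp: indicator_def)
  finally show ?thesis .
qed

text \<open>Fatou's lemma, for a bound that holds eventually.\<close>

lemma nn_integral_le_of_AE_tendsto:
  fixes u :: "nat \<Rightarrow> 'a \<Rightarrow> ennreal"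
  assumes "\<And>n. u n \<in> borel_measurable M" "AE x in M. (\<lambda>n. u n x) \<longlonglongrightarrow> v x"
    and "eventually (\<lambda>n. (\<integral>\<^sup>+x. u n x \<partial>M) \<le> C) sequentially"
  shows "(\<integral>\<^sup>+x. v x \<partial>M) \<le> C"
proof -
  have "(\<integral>\<^sup>+x. v x \<partial>M) = (\<integral>\<^sup>+x. liminf (\<lambda>n. u n x) \<partial>M)"
    using assms(2) by (intro nn_integral_cong_AE) (auto elim!: eventually_mono dest: lim_imp_Liminf[rotated])
  also have "\<dots> \<le> liminf (\<lambda>n. integral\<^sup>N M (u n))"
    by (rule nn_integral_liminf) fact
  also have "\<dots> \<le> limsup (\<lambda>n. integral\<^sup>N M (u n))" by (rule Liminf_le_Limsup) simp
  also have "\<dots> \<le> C" by (rule Limsup_bounded) fact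
  finally show ?thesis .
qed


lemma fco_eq_imp_AE_eq:
  assumes "integrable torus f" "integrable torus g" "\<And>k. fco f k = fco g k"
  shows "AE x in torus. f x = g x"
proof -
  have "AE x in torus. f x - g x = 0"
  proof (rule fourier_uniqueness)
    show "integrable torus (\<lambda>x. f x - g x)" using assms by simp
    show "fco (\<lambda>x. f x - g x) k = 0" for k
      using assms integrable_mult_chr[OF assms(1)] integrable_mult_chr[OF assms(2)]
      by (simp add: fco_def left_diff_distrib)
  qed
  then show ?thesis by simp
qed

lemma sqi_of_nn_integral:
  assumes "f \<in> borel_measurable torus" "(\<integral>\<^sup>+x. ennreal ((norm (f x))\<^sup>2) \<partial>torus) < \<infinity>"
  shows "sqi f"
  using assms by (auto simp: sqi_def integrable_iff_bounded)

lemma ennreal_power2_le_imp_le: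
  assumes "a\<^sup>2 \<le> (ennreal b)\<^sup>2" "0 \<le> b"
  shows "a \<le> ennreal b"
proof (cases a)
  case (real r)
  then show ?thesis using assms power2_le_imp_le[of r b]
    by (simp add: ennreal_power ennreal_leI)
next
  case top
  then show ?thesis using assms by (simp add: ennreal_power top_unique)
qed

lemma tpoly_diff: "finite B \<Longrightarrow> A \<subseteq> B \<Longrightarrow> tpoly B c x - tpoly A c x = tpoly (B - A) c x"
  unfolding tpoly_def by (simp add: sum_diff)

lemma integral_norm_tpoly_fbox_diff:
  "(\<integral>x. (norm (tpoly (fbox m) c x - tpoly (fbox n) c x))\<^sup>2 \<partial>torus)
    = \<bar>(\<Sum>k\<in>fbox m. (norm (c k))\<^sup>2) - (\<Sum>k\<in>fbox n. (norm (c k))\<^sup>2)\<bar>"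
proof -
  have *: "(\<integral>x. (norm (tpoly (fbox m) c x - tpoly (fbox n) c x))\<^sup>2 \<partial>torus)
    = (\<Sum>k\<in>fbox m. (norm (c k))\<^sup>2) - (\<Sum>k\<in>fbox n. (norm (c k))\<^sup>2)" if "n \<le> m" for m n
    using fbox_mono[OF that] by (simp add: tpoly_diff integral_norm_tpoly sum_diff)
  have le: "(\<Sum>k\<in>fbox n. (norm (c k))\<^sup>2) \<le> (\<Sum>k\<in>fbox m. (norm (c k))\<^sup>2)" if "n \<le> m" for m n
    using fbox_mono[OF that] by (intro sum_mono2) auto
  show ?thesis
    using *[of n m] *[of m n] le[of n m] le[of m n] norm_minus_commute[of "tpoly (fbox m) c _" "tpoly (fbox n) c _"]
    by (cases "n \<le> m") auto
qed

text \<open>The sum of the absolute increments has finite integral, so it is finite almost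
  everywhere, and the increments telescope.\<close>

lemma AE_convergent_of_summable_L1:
  fixes f :: "nat \<Rightarrow> 'a \<Rightarrow> complex"
  assumes [measurable]: "\<And>n. f n \<in> borel_measurable M"
    and "\<And>n. (\<integral>\<^sup>+x. norm (f (Suc n) x - f n x) \<partial>M) \<le> ennreal (b n)" "summable b" "\<And>n. 0 \<le> b n"
  shows "AE x in M. convergent (\<lambda>n. f n x)"
proof -
  have "(\<integral>\<^sup>+x. (\<Sum>n. ennreal (norm (f (Suc n) x - f n x))) \<partial>M) = (\<Sum>n. \<integral>\<^sup>+x. norm (f (Suc n) x - f n x) \<partial>M)"
    by (rule nn_integral_suminf) measurable
  also have "\<dots> \<le> (\<Sum>n. ennreal (b n))"
    using assms(2) by (intro suminf_le) auto
  also have "\<dots> < \<infinity>"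
    using assms(3,4) by (subst suminf_ennreal2) auto
  finally have "AE x in M. (\<Sum>n. ennreal (norm (f (Suc n) x - f n x))) \<noteq> \<infinity>"
    by (intro nn_integral_PInf_AE) auto
  then show ?thesis
  proof eventually_elim
    case (elim x)
    then have "summable (\<lambda>n. norm (f (Suc n) x - f n x))"
      by (intro summable_suminf_not_top) auto
    then have "summable (\<lambda>n. f (Suc n) x - f n x)"
      by (rule summable_norm_cancel)
    then have "(\<lambda>n. \<Sum>i<n. f (Suc i) x - f i x) \<longlonglongrightarrow> (\<Sum>n. f (Suc n) x - f n x)"
      by (rule summable_LIMSEQ)
    then have "(\<lambda>n. f n x - f 0 x) \<longlonglongrightarrow> (\<Sum>n. f (Suc n) x - f n x)"
      by (simp only: sum_lessThan_telescope[of "\<lambda>i. f i x"])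
    then have "(\<lambda>n. f n x - f 0 x + f 0 x) \<longlonglongrightarrow> (\<Sum>n. f (Suc n) x - f n x) + f 0 x"
      by (rule tendsto_add) (rule tendsto_const)
    then show ?case by (auto simp: convergent_def)
  qed
qed

text \<open>Partial sums are Cauchy in L^2; a rapidly convergent subsequence converges almost
  everywhere and Fatou identifies the limit. The subsequence belongs to the conclusion because later
  estimates pass to the limit pointwise, again by Fatou.\<close>

theorem riesz_fischer:
  assumes c: "(\<integral>\<^sup>+k. ennreal ((norm (c k))\<^sup>2) \<partial>count_space UNIV) < \<infinity>"
  obtains g r where "sqi g" "\<And>k. fco g k = c k" "filterlim r at_top sequentially"
    "AE x in torus. (\<lambda>n. tpoly (fbox (r n)) c x) \<longlonglongrightarrow> g x"
proof -
  define a where "a N = (\<Sum>k\<in>fbox N. (norm (c k))\<^sup>2)" for N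
  obtain L where L: "0 \<le> L" "(\<integral>\<^sup>+k. ennreal ((norm (c k))\<^sup>2) \<partial>count_space UNIV) = ennreal L"
    using c by (auto simp: less_top_ennreal)
  have "(\<lambda>N. ennreal (a N)) \<longlonglongrightarrow> ennreal L"
    using nn_integral_fbox[of "\<lambda>k. ennreal ((norm (c k))\<^sup>2)"] by (simp add: L a_def sum_ennreal)
  moreover have a_nonneg: "0 \<le> a N" for N by (simp add: a_def sum_nonneg)
  ultimately have a_lim: "a \<longlonglongrightarrow> L" using L by simp
  have a_mono: "a m \<le> a n" if "m \<le> n" for m n
    unfolding a_def using fbox_mono[OF that] by (intro sum_mono2) auto
  have a_le: "a n \<le> L" for n
    using a_mono by (intro LIMSEQ_le_const[OF a_lim]) blast
  \<comment> \<open>Squared distances of order \<open>(1/4)^n\<close> give L^2 distances, hence L^1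
    distances, of order \<open>(1/2)^n\<close>, which are summable.\<close>
  have "\<exists>m\<ge>n. \<bar>a m - L\<bar> < (1/4)^n" for n
  proof -
    have "eventually (\<lambda>m. dist (a m) L < (1/4)^n) sequentially"
      using a_lim by (rule tendstoD) simp
    then have "eventually (\<lambda>m. m \<ge> n \<and> \<bar>a m - L\<bar> < (1/4)^n) sequentially"
      using eventually_ge_at_top[of n] by eventually_elim (simp add: dist_real_def)
    then show ?thesis by (auto simp: eventually_sequentially)
  qed
  then obtain r where r: "\<And>n. r n \<ge> n" "\<And>n. \<bar>a (r n) - L\<bar> < (1/4)^n" by metis
  have r_lim: "filterlim r at_top sequentially"
    using r(1) by (intro filterlim_at_top_mono[OF filterlim_ident]) auto
  define S where "S N = tpoly (fbox N) c" for N
  have S_sqi: "sqi (S N)" for N by (simp add: S_def sqi_tpoly)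
  have S_meas [measurable]: "S N \<in> borel_measurable torus" for N using S_sqi by (rule sqi_measurable)
  have S_diff: "(\<integral>\<^sup>+x. ennreal ((norm (S m x - S n x))\<^sup>2) \<partial>torus) = ennreal \<bar>a m - a n\<bar>" for m n
    using sqi_diff[OF S_sqi[of m] S_sqi[of n]] integral_norm_tpoly_fbox_diff[of m c n]
    by (simp add: nn_integral_eq_integral sqi_def S_def a_def)
  have "AE x in torus. convergent (\<lambda>n. S (r n) x)"
  proof (rule AE_convergent_of_summable_L1)
    show "summable (\<lambda>n. 2 * (1/2)^n :: real)" by (intro summable_mult summable_geometric) simp
    fix n
    let ?I = "\<integral>\<^sup>+x. ennreal (norm (S (r (Suc n)) x - S (r n) x)) \<partial>torus"
    have "(\<integral>\<^sup>+x. ennreal (norm (S (r (Suc n)) x - S (r n) x)) * 1 \<partial>torus)\<^sup>2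
      \<le> (\<integral>\<^sup>+x. (ennreal (norm (S (r (Suc n)) x - S (r n) x)))\<^sup>2 \<partial>torus) * (\<integral>\<^sup>+x. 1\<^sup>2 \<partial>torus)"
      by (rule Cauchy_Schwarz_nn_integral) auto
    then have "?I\<^sup>2 \<le> ennreal \<bar>a (r (Suc n)) - a (r n)\<bar>"
      by (simp add: ennreal_power S_diff torus.emeasure_space_1)
    also have "\<dots> \<le> ennreal ((2 * (1/2)^n)\<^sup>2)"
    proof (rule ennreal_leI)
      have "(1/4)^Suc n \<le> (1/4::real)^n" by (rule power_decreasing) auto
      then have "\<bar>a (r (Suc n)) - a (r n)\<bar> \<le> 2 * (1/4)^n"
        using r(2)[of n] r(2)[of "Suc n"] by linarith
      also have "\<dots> \<le> (2 * (1/2)^n)\<^sup>2"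
        by (simp add: power_mult_distrib power2_eq_square flip: power_mult_distrib)
      finally show "\<bar>a (r (Suc n)) - a (r n)\<bar> \<le> (2 * (1/2)^n)\<^sup>2" .
    qed
    also have "\<dots> = (ennreal (2 * (1/2)^n))\<^sup>2" by (simp add: ennreal_power)
    finally show "?I \<le> ennreal (2 * (1/2)^n)"
      by (intro ennreal_power2_le_imp_le) auto
  qed (use S_meas in auto)
  then have conv: "AE x in torus. (\<lambda>n. S (r n) x) \<longlonglongrightarrow> lim (\<lambda>n. S (r n) x)"
    by eventually_elim (simp add: convergent_LIMSEQ_iff)
  define g where "g x = lim (\<lambda>n. S (r n) x)" for x
  have g_meas [measurable]: "g \<in> borel_measurable torus"
    unfolding g_def[abs_def] by (intro borel_measurable_lim_metric S_meas)
  have g_diff: "(\<integral>\<^sup>+x. ennreal ((norm (g x - S N x))\<^sup>2) \<partial>torus) \<le> ennreal (L - a N)" for N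
  proof (rule nn_integral_le_of_AE_tendsto)
    show "AE x in torus. (\<lambda>n. ennreal ((norm (S (r n) x - S N x))\<^sup>2)) \<longlonglongrightarrow> ennreal ((norm (g x - S N x))\<^sup>2)"
      using conv by eventually_elim (auto simp: g_def intro!: tendsto_intros)
    have "eventually (\<lambda>n. r n \<ge> N) sequentially"
      using r_lim by (simp add: filterlim_at_top)
    then show "eventually (\<lambda>n. (\<integral>\<^sup>+x. ennreal ((norm (S (r n) x - S N x))\<^sup>2) \<partial>torus) \<le> ennreal (L - a N)) sequentially"
    proof eventually_elim
      case (elim n)
      then show ?case using a_mono[of N "r n"] a_le[of "r n"]
        by (simp add: S_diff ennreal_leI)
    qed
  qed auto
  have gS_sqi: "sqi (\<lambda>x. g x - S N x)" for N
    using g_diff[of N] by (intro sqi_of_nn_integral) (auto intro: order.strict_trans1)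
  then have "sqi g" using sqi_add[OF gS_sqi[of 0] S_sqi[of 0]] by simp
  moreover have "fco g k = c k" for k
  proof -
    \<comment> \<open>Once the cube contains \<open>k\<close>, the partial sum already has the
      coefficient \<open>c k\<close>; Cauchy-Schwarz against \<open>chr k\<close> bounds the
      remaining error by the tail.\<close>
    have "eventually (\<lambda>N. (norm (fco g k - c k))\<^sup>2 \<le> L - a N) sequentially"
      using eventually_fbox[of k]
    proof eventually_elim
      case (elim N)
      have "fco (S N) k = c k" using elim by (simp add: S_def fco_tpoly)
      then have "fco g k - c k = (\<integral>x. (g x - S N x) * chr k x \<partial>torus)"
        using integrable_mult_chr[OF sqi_integrable[OF \<open>sqi g\<close>]] integrable_mult_chr[OF sqi_integrable[OF S_sqi]]
        by (simp add: fco_def left_diff_distrib)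
      then have "(norm (fco g k - c k))\<^sup>2 \<le> (\<integral>x. (norm (g x - S N x))\<^sup>2 \<partial>torus)"
        using norm_integral_mult_le[OF gS_sqi[of N] sqi_chr[of k]] by (simp add: torus.prob_space)
      also have "\<dots> \<le> L - a N"
        using g_diff[of N] gS_sqi[of N] a_le[of N]
        by (simp add: nn_integral_eq_integral sqi_def)
      finally show ?case .
    qed
    moreover have "(\<lambda>N. L - a N) \<longlonglongrightarrow> L - L" by (intro tendsto_intros a_lim)
    ultimately have "(norm (fco g k - c k))\<^sup>2 \<le> L - L"
      by (intro tendsto_lowerbound[of "\<lambda>N. L - a N" _ sequentially]) auto
    then show ?thesis by simp
  qed
  moreover have "AE x in torus. (\<lambda>n. tpoly (fbox (r n)) c x) \<longlonglongrightarrow> g x"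
    using conv by (simp add: S_def g_def)
  ultimately show ?thesis using that r_lim by blast
qed

lemma bessel:
  assumes "sqi f"
  shows "(\<integral>\<^sup>+k. ennreal ((norm (fco f k))\<^sup>2) \<partial>count_space UNIV) \<le> (\<integral>\<^sup>+x. ennreal ((norm (f x))\<^sup>2) \<partial>torus)"
proof (rule LIMSEQ_le_const2[OF nn_integral_fbox], intro exI allI impI)
  fix N
  have "(\<Sum>k\<in>fbox N. (norm (fco f k))\<^sup>2) \<le> (\<integral>x. (norm (f x))\<^sup>2 \<partial>torus)"
    using integral_norm_diff_fco[OF assms finite_fbox[of N]]
      Bochner_Integration.integral_nonneg[of torus "\<lambda>x. (norm (f x - tpoly (fbox N) (fco f) x))\<^sup>2"] by simp
  then show "(\<Sum>k\<in>fbox N. ennreal ((norm (fco f k))\<^sup>2)) \<le> (\<integral>\<^sup>+x. ennreal ((norm (f x))\<^sup>2) \<partial>torus)"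
    using assms by (simp add: sum_ennreal sqi_def nn_integral_eq_integral ennreal_leI)
qed

text \<open>Riesz-Fischer yields a function with the coefficients of \<open>f\<close>, and
  \<open>fourier_uniqueness\<close> identifies it with \<open>f\<close>.\<close>

lemma fco_AE_subsequence:
  assumes "sqi f"
  obtains r where "filterlim r at_top sequentially" "AE x in torus. (\<lambda>n. tpoly (fbox (r n)) (fco f) x) \<longlonglongrightarrow> f x"
proof -
  have "(\<integral>\<^sup>+k. ennreal ((norm (fco f k))\<^sup>2) \<partial>count_space UNIV) < \<infinity>"
    using bessel[OF assms] assms by (auto simp: sqi_def integrable_iff_bounded intro: order.strict_trans1)
  then obtain g r where g: "sqi g" "\<And>k. fco g k = fco f k" "filterlim r at_top sequentially"
    "AE x in torus. (\<lambda>n. tpoly (fbox (r n)) (fco f) x) \<longlonglongrightarrow> g x"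
    using riesz_fischer by blast
  have "AE x in torus. g x = f x"
    using g assms by (intro fco_eq_imp_AE_eq sqi_integrable)
  with g(4) have "AE x in torus. (\<lambda>n. tpoly (fbox (r n)) (fco f) x) \<longlonglongrightarrow> f x"
    by eventually_elim simp
  with g(3) that show ?thesis by blast
qed

text \<open>The squared errors \<open>d\<close> decrease to some \<open>D\<close>, so the partial
  sums have squared norms at most \<open>B - D\<close>. Fatou along the almost everywhere convergent
  subsequence gives \<open>B \<le> B - D\<close>, hence \<open>D = 0\<close>.\<close>

lemma fourier_L2_convergence:
  assumes f: "sqi f"
  shows "(\<lambda>N. \<integral>x. (norm (f x - tpoly (fbox N) (fco f) x))\<^sup>2 \<partial>torus) \<longlonglongrightarrow> 0"
proof -
  define d where "d N = (\<integral>x. (norm (f x - tpoly (fbox N) (fco f) x))\<^sup>2 \<partial>torus)" for N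
  define B where "B = (\<integral>x. (norm (f x))\<^sup>2 \<partial>torus)"
  obtain r where r: "filterlim r at_top sequentially" "AE x in torus. (\<lambda>n. tpoly (fbox (r n)) (fco f) x) \<longlonglongrightarrow> f x"
    using fco_AE_subsequence[OF f] by blast
  have d_eq: "d N = B - (\<Sum>k\<in>fbox N. (norm (fco f k))\<^sup>2)" for N
    using integral_norm_diff_fco[OF f finite_fbox] by (simp add: d_def B_def)
  have d_nonneg: "0 \<le> d N" for N by (simp add: d_def)
  have d_mono: "d n \<le> d m" if "m \<le> n" for m n
    unfolding d_eq using fbox_mono[OF that] by (auto intro!: sum_mono2)
  obtain D where D: "d \<longlonglongrightarrow> D" "\<And>n. D \<le> d n"
    using decseq_convergent[of d 0] d_mono d_nonneg by (auto simp: decseq_def)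
  have "ennreal B \<le> ennreal (B - D)"
  proof -
    have "ennreal B = (\<integral>\<^sup>+x. ennreal ((norm (f x))\<^sup>2) \<partial>torus)"
      using f by (simp add: B_def sqi_def nn_integral_eq_integral)
    also have "\<dots> \<le> ennreal (B - D)"
    proof (rule nn_integral_le_of_AE_tendsto)
      show "AE x in torus. (\<lambda>n. ennreal ((norm (tpoly (fbox (r n)) (fco f) x))\<^sup>2)) \<longlonglongrightarrow> ennreal ((norm (f x))\<^sup>2)"
        using r(2) by eventually_elim (auto intro!: tendsto_intros)
      show "(\<lambda>x. ennreal ((norm (tpoly (fbox (r n)) (fco f) x))\<^sup>2)) \<in> borel_measurable torus" for n
        using sqi_measurable[OF sqi_tpoly] by measurable
      have "(\<integral>\<^sup>+x. ennreal ((norm (tpoly (fbox n) (fco f) x))\<^sup>2) \<partial>torus) = ennreal (B - d n)" for n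
        using sqi_tpoly[of "fbox n" "fco f"] integral_norm_tpoly[OF finite_fbox, of n "fco f"]
        by (simp add: sqi_def nn_integral_eq_integral d_eq)
      then show "eventually (\<lambda>n. (\<integral>\<^sup>+x. ennreal ((norm (tpoly (fbox (r n)) (fco f) x))\<^sup>2) \<partial>torus) \<le> ennreal (B - D)) sequentially"
        using D(2) by (intro always_eventually allI) (simp add: ennreal_leI)
    qed
    finally show ?thesis .
  qed
  moreover have "B \<ge> 0" by (simp add: B_def)
  moreover have "D \<ge> 0" using D(1) d_nonneg by (intro LIMSEQ_le_const) auto
  moreover have "D \<le> B"
    using D(2)[of 0] d_eq[of 0] sum_nonneg[of "fbox 0" "\<lambda>k. (norm (fco f k))\<^sup>2"] by simp
  ultimately have "D = 0" by (auto simp: ennreal_le_iff2)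
  with D(1) show ?thesis by (simp add: d_def[abs_def])
qed

text \<open>The pairing is bilinear, without conjugation, so a coefficient of \<open>f\<close> meets
  that of \<open>h\<close> at the opposite frequency. The truncation error is controlled by
  Cauchy-Schwarz and \<open>fourier_L2_convergence\<close>.\<close>

theorem parseval_LIMSEQ:
  assumes f: "sqi f" and h: "sqi h"
  shows "(\<lambda>N. \<Sum>k\<in>fbox N. fco f k * fco h (- k)) \<longlonglongrightarrow> (\<integral>x. f x * h x \<partial>torus)"
proof -
  define d where "d N = (\<integral>x. (norm (f x - tpoly (fbox N) (fco f) x))\<^sup>2 \<partial>torus)" for N
  define B where "B = (\<integral>x. (norm (h x))\<^sup>2 \<partial>torus)"
  have "norm ((\<Sum>k\<in>fbox N. fco f k * fco h (- k)) - (\<integral>x. f x * h x \<partial>torus)) \<le> sqrt (d N * B)" for N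
  proof -
    have "(\<integral>x. f x * h x \<partial>torus) - (\<Sum>k\<in>fbox N. fco f k * fco h (- k))
        = (\<integral>x. (f x - tpoly (fbox N) (fco f) x) * h x \<partial>torus)"
      using sqi_integrable_mult[OF f h] sqi_integrable_mult[OF sqi_tpoly h]
      by (simp add: left_diff_distrib integral_tpoly_mult[OF h])
    then have "(norm ((\<Sum>k\<in>fbox N. fco f k * fco h (- k)) - (\<integral>x. f x * h x \<partial>torus)))\<^sup>2 \<le> d N * B"
      using norm_integral_mult_le[OF sqi_diff[OF f sqi_tpoly] h] unfolding d_def B_def
      by (subst norm_minus_commute) simp
    then show ?thesis by (rule real_le_rsqrt)
  qed
  moreover
  have "(\<lambda>N. sqrt (d N * B)) \<longlonglongrightarrow> sqrt (0 * B)"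
    unfolding d_def by (intro tendsto_intros fourier_L2_convergence f)
  then have "(\<lambda>N. sqrt (d N * B)) \<longlonglongrightarrow> 0" by (simp only: mult_zero_left real_sqrt_zero)
  ultimately have "(\<lambda>N. (\<Sum>k\<in>fbox N. fco f k * fco h (- k)) - (\<integral>x. f x * h x \<partial>torus)) \<longlonglongrightarrow> 0"
    by (rule Lim_null_comparison[OF always_eventually[OF allI]])
  then show ?thesis by (rule LIM_zero_cancel)
qed

corollary parseval:
  assumes f: "sqi f"
  shows "(\<integral>\<^sup>+k. ennreal ((norm (fco f k))\<^sup>2) \<partial>count_space UNIV) = (\<integral>\<^sup>+x. ennreal ((norm (f x))\<^sup>2) \<partial>torus)"
proof -
  have "(\<lambda>N. (\<integral>x. (norm (f x))\<^sup>2 \<partial>torus) - (\<integral>x. (norm (f x - tpoly (fbox N) (fco f) x))\<^sup>2 \<partial>torus))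
      \<longlonglongrightarrow> (\<integral>x. (norm (f x))\<^sup>2 \<partial>torus) - 0"
    by (intro tendsto_intros fourier_L2_convergence f)
  then have "(\<lambda>N. \<Sum>k\<in>fbox N. (norm (fco f k))\<^sup>2) \<longlonglongrightarrow> (\<integral>x. (norm (f x))\<^sup>2 \<partial>torus)"
    by (simp add: integral_norm_diff_fco[OF f])
  then have "(\<lambda>N. ennreal (\<Sum>k\<in>fbox N. (norm (fco f k))\<^sup>2)) \<longlonglongrightarrow> ennreal (\<integral>x. (norm (f x))\<^sup>2 \<partial>torus)"
    by (rule tendsto_ennrealI)
  then have "(\<lambda>N. \<Sum>k\<in>fbox N. ennreal ((norm (fco f k))\<^sup>2)) \<longlonglongrightarrow> (\<integral>\<^sup>+x. ennreal ((norm (f x))\<^sup>2) \<partial>torus)"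
    using f by (simp add: sum_ennreal sqi_def nn_integral_eq_integral)
  then show ?thesis by (rule LIMSEQ_unique[OF nn_integral_fbox])
qed

text \<open>Parseval for \<open>f\<close> and \<open>h * chr k\<close>, whose coefficient at
  \<open>- l\<close> is that of \<open>h\<close> at \<open>k - l\<close>.\<close>

lemma fco_mult_le:
  assumes f: "sqi f" and h: "sqi h"
  shows "ennreal (norm (fco (\<lambda>x. f x * h x) k))
    \<le> (\<integral>\<^sup>+l. ennreal (norm (fco f l)) * ennreal (norm (fco h (k - l))) \<partial>count_space UNIV)"
proof -
  have hk: "sqi (\<lambda>x. h x * chr k x)" using h by (rule sqi_mult_chr)
  have fco: "fco (\<lambda>x. h x * chr k x) (- l) = fco h (k - l)" for l
    by (simp add: fco_def mult.assoc flip: chr_add)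
  have "(\<lambda>N. \<Sum>l\<in>fbox N. fco f l * fco h (k - l)) \<longlonglongrightarrow> fco (\<lambda>x. f x * h x) k"
    using parseval_LIMSEQ[OF f hk] by (simp add: fco fco_def[of "\<lambda>x. f x * h x"] mult.assoc)
  then have "(\<lambda>N. ennreal (norm (\<Sum>l\<in>fbox N. fco f l * fco h (k - l)))) \<longlonglongrightarrow> ennreal (norm (fco (\<lambda>x. f x * h x) k))"
    by (intro tendsto_intros)
  then show ?thesis
  proof (rule LIMSEQ_le_const2, intro exI allI impI)
    fix N
    have "ennreal (norm (\<Sum>l\<in>fbox N. fco f l * fco h (k - l))) \<le> ennreal (\<Sum>l\<in>fbox N. norm (fco f l) * norm (fco h (k - l)))"
      by (intro ennreal_leI order_trans[OF norm_sum]) (simp add: norm_mult)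
    also have "\<dots> = (\<Sum>l\<in>fbox N. ennreal (norm (fco f l)) * ennreal (norm (fco h (k - l))))"
      by (simp add: ennreal_mult flip: sum_ennreal)
    also have "\<dots> \<le> (\<integral>\<^sup>+l. ennreal (norm (fco f l)) * ennreal (norm (fco h (k - l))) \<partial>count_space UNIV)"
      by (rule nn_integral_fbox_le)
    finally show "ennreal (norm (\<Sum>l\<in>fbox N. fco f l * fco h (k - l))) \<le> \<dots>" .
  qed
qed

section \<open>Weighted sequences and convolutions\<close>

abbreviation csum :: "('a \<Rightarrow> ennreal) \<Rightarrow> ennreal" where
  "csum f \<equiv> \<integral>\<^sup>+k. f k \<partial>count_space UNIV"

definition wt :: "int^3 \<Rightarrow> real" where
  "wt k = 1 + (\<Sum>i\<in>UNIV. (of_int (k $ i))\<^sup>2)"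

definition conv :: "(int^3 \<Rightarrow> ennreal) \<Rightarrow> (int^3 \<Rightarrow> ennreal) \<Rightarrow> int^3 \<Rightarrow> ennreal" where
  "conv f g k = csum (\<lambda>l. f l * g (k - l))"

definition wt_sum :: ennreal where
  "wt_sum = csum (\<lambda>k. (ennreal (1 / wt k))\<^sup>2)"

definition h2 :: "(int^3 \<Rightarrow> ennreal) \<Rightarrow> ennreal" where
  "h2 f = csum (\<lambda>k. (ennreal (wt k) * f k)\<^sup>2)"

lemma wt_ge_1: "1 \<le> wt k"
  by (simp add: wt_def sum_nonneg)

lemma wt_pos [simp]: "0 < wt k"
  using wt_ge_1[of k] by linarith

lemma wt_nonneg [simp]: "0 \<le> wt k"
  by (simp add: less_imp_le)

text \<open>This is what lets a weight on a convolution be moved onto one of the two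
  factors.\<close>

lemma wt_subadd: "wt k \<le> 2 * wt l + 2 * wt (k - l)"
proof -
  have "(of_int (k $ i))\<^sup>2 \<le> 2 * (of_int (l $ i))\<^sup>2 + 2 * (of_int ((k - l) $ i) :: real)\<^sup>2" for i
    using zero_le_power2[of "of_int (l $ i) - of_int ((k - l) $ i) :: real"]
    by (simp add: power2_eq_square algebra_simps)
  then have "(\<Sum>i\<in>UNIV. (of_int (k $ i))\<^sup>2) \<le> (\<Sum>i\<in>UNIV. 2 * (of_int (l $ i))\<^sup>2 + 2 * (of_int ((k - l) $ i) :: real)\<^sup>2)"
    by (intro sum_mono)
  then show ?thesis by (simp add: wt_def sum.distrib flip: sum_distrib_left)
qed

lemma csum_bij: "bij g \<Longrightarrow> csum (\<lambda>k. f (g k)) = csum f"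
  by (rule nn_integral_bij_count_space)

lemma csum_reflect: "csum (\<lambda>l::int^3. f (k - l)) = csum f"
  by (rule csum_bij) (auto intro!: bij_betwI[of _ _ _ "\<lambda>l. k - l"])

lemma csum_shift: "csum (\<lambda>k::int^3. f (k - l)) = csum f"
  by (rule csum_bij) (auto intro!: bij_betwI[of _ _ _ "\<lambda>k. k + l"])

lemma csum_swap: "csum (\<lambda>k. csum (\<lambda>l. f k l)) = csum (\<lambda>l. csum (\<lambda>k. f k l))"
  using nn_integral_fst_count_space[of "\<lambda>(k, l). f k l"] nn_integral_snd_count_space[of "\<lambda>(k, l). f k l"]
  by simp

lemma conv_commute: "conv f g = conv g f"
proof
  fix k
  show "conv f g k = conv g f k"
    unfolding conv_def using csum_reflect[of "\<lambda>l. f l * g (k - l)" k] by (simp add: mult.commute)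
qed

lemma csum_Cauchy_Schwarz: "(csum (\<lambda>k. f k * g k))\<^sup>2 \<le> csum (\<lambda>k. (f k)\<^sup>2) * csum (\<lambda>k. (g k)\<^sup>2)"
  by (rule Cauchy_Schwarz_nn_integral) auto

lemma csum_weighted_Cauchy_Schwarz: "(csum (\<lambda>k. w k * f k))\<^sup>2 \<le> csum (\<lambda>k. w k * (f k)\<^sup>2) * csum w"
  using Cauchy_Schwarz_nn_integral[of f "density (count_space UNIV) w" "\<lambda>_. 1"]
  by (simp add: nn_integral_density emeasure_density)

text \<open>Young's inequality: Cauchy-Schwarz with \<open>g\<close> as weight, followed by
  Tonelli.\<close>

lemma young_l2_l1: "csum (\<lambda>k. (conv f g k)\<^sup>2) \<le> csum (\<lambda>k. (f k)\<^sup>2) * (csum g)\<^sup>2"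
proof -
  have "csum (\<lambda>k. (conv f g k)\<^sup>2) \<le> csum (\<lambda>k. csum (\<lambda>l. g (k - l) * (f l)\<^sup>2) * csum g)"
  proof (rule nn_integral_mono)
    fix k
    show "(conv f g k)\<^sup>2 \<le> csum (\<lambda>l. g (k - l) * (f l)\<^sup>2) * csum g"
      using csum_weighted_Cauchy_Schwarz[of "\<lambda>l. g (k - l)" f] unfolding csum_reflect
      by (simp add: conv_def mult.commute)
  qed
  also have "\<dots> = csum (\<lambda>k. csum (\<lambda>l. g (k - l) * (f l)\<^sup>2)) * csum g"
    by (simp add: nn_integral_multc)
  also have "csum (\<lambda>k. csum (\<lambda>l. g (k - l) * (f l)\<^sup>2)) = csum (\<lambda>l. csum (\<lambda>k. g (k - l) * (f l)\<^sup>2))"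
    by (rule csum_swap)
  also have "\<dots> = csum g * csum (\<lambda>l. (f l)\<^sup>2)"
    by (simp add: nn_integral_multc nn_integral_cmult csum_shift)
  finally show ?thesis by (simp add: power2_eq_square ac_simps)
qed

lemma ennreal_power2_add_le: "(a + b)\<^sup>2 \<le> 2 * a\<^sup>2 + 2 * b\<^sup>2" for a b :: ennreal
proof (cases a; cases b)
  fix x y :: real assume xy: "a = ennreal x" "0 \<le> x" "b = ennreal y" "0 \<le> y"
  have "(x + y)\<^sup>2 \<le> 2 * x\<^sup>2 + 2 * y\<^sup>2"
    using zero_le_power2[of "x - y"] by (simp add: power2_eq_square algebra_simps)
  then have "ennreal ((x + y)\<^sup>2) \<le> ennreal (2 * x\<^sup>2 + 2 * y\<^sup>2)" by (rule ennreal_leI)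
  also have "\<dots> = 2 * ennreal (x\<^sup>2) + 2 * ennreal (y\<^sup>2)" by (simp add: ennreal_mult)
  finally show ?thesis using xy by (simp add: ennreal_power flip: ennreal_plus)
qed (auto simp: power2_eq_square ennreal_mult_top ennreal_top_mult)

lemma ennreal_inverse_wt_mult: "ennreal (1 / wt k) * (ennreal (wt k) * x) = x"
proof -
  have "ennreal (1 / wt k) * ennreal (wt k) = 1"
    by (simp add: less_imp_neq[symmetric] flip: ennreal_mult)
  then show ?thesis by (simp flip: mult.assoc)
qed

text \<open>The counterpart on coefficients of the embedding of W^{2,2} into bounded functions:
  Cauchy-Schwarz against \<open>1 / wt\<close>.\<close>

lemma csum_power2_le: "(csum g)\<^sup>2 \<le> wt_sum * h2 g"
  using csum_Cauchy_Schwarz[of "\<lambda>k. ennreal (1 / wt k)" "\<lambda>k. ennreal (wt k) * g k"]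
  unfolding ennreal_inverse_wt_mult by (simp add: wt_sum_def h2_def)

text \<open>By \<open>wt_subadd\<close> the weight falls on either factor; Young's inequality keeps
  the weighted factor in l^2 and the other in l^1, where \<open>csum_power2_le\<close> applies. Each
  of the two terms carries the constant 8.\<close>

lemma h2_conv_le: "h2 (conv f g) \<le> 16 * wt_sum * h2 f * h2 g"
proof -
  let ?f = "\<lambda>k. ennreal (wt k) * f k" and ?g = "\<lambda>k. ennreal (wt k) * g k"
  have "h2 (conv f g) \<le> csum (\<lambda>k. 8 * (conv ?f g k)\<^sup>2 + 8 * (conv ?g f k)\<^sup>2)"
    unfolding h2_def
  proof (rule nn_integral_mono)
    fix k
    have "ennreal (wt k) * conv f g k = csum (\<lambda>l. ennreal (wt k) * (f l * g (k - l)))"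
      by (simp add: conv_def nn_integral_cmult)
    also have "\<dots> \<le> csum (\<lambda>l. 2 * (?f l * g (k - l)) + 2 * (f l * ?g (k - l)))"
    proof (rule nn_integral_mono)
      fix l
      have "ennreal (wt k) \<le> ennreal (2 * wt l + 2 * wt (k - l))" by (intro ennreal_leI wt_subadd)
      also have "\<dots> = 2 * ennreal (wt l) + 2 * ennreal (wt (k - l))" by (simp add: ennreal_mult)
      finally have "ennreal (wt k) * (f l * g (k - l)) \<le> (2 * ennreal (wt l) + 2 * ennreal (wt (k - l))) * (f l * g (k - l))"
        by (rule mult_right_mono) simp
      also have "\<dots> = 2 * (?f l * g (k - l)) + 2 * (f l * ?g (k - l))"
        by (simp add: algebra_simps)
      finally show "ennreal (wt k) * (f l * g (k - l)) \<le> 2 * (?f l * g (k - l)) + 2 * (f l * ?g (k - l))" .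
    qed
    also have "\<dots> = 2 * conv ?f g k + 2 * conv f ?g k"
      by (simp add: conv_def nn_integral_add nn_integral_cmult)
    finally have "ennreal (wt k) * conv f g k \<le> 2 * conv ?f g k + 2 * conv ?g f k"
      by (simp only: conv_commute[of f])
    then have "(ennreal (wt k) * conv f g k)\<^sup>2 \<le> (2 * conv ?f g k + 2 * conv ?g f k)\<^sup>2"
      by (rule power_mono) simp
    also have "\<dots> \<le> 2 * (2 * conv ?f g k)\<^sup>2 + 2 * (2 * conv ?g f k)\<^sup>2"
      by (rule ennreal_power2_add_le)
    finally show "(ennreal (wt k) * conv f g k)\<^sup>2 \<le> 8 * (conv ?f g k)\<^sup>2 + 8 * (conv ?g f k)\<^sup>2"
      by (simp add: power_mult_distrib flip: mult.assoc)
  qed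
  also have "\<dots> = 8 * csum (\<lambda>k. (conv ?f g k)\<^sup>2) + 8 * csum (\<lambda>k. (conv ?g f k)\<^sup>2)"
    by (simp add: nn_integral_add nn_integral_cmult)
  also have "\<dots> \<le> 8 * (h2 f * (csum g)\<^sup>2) + 8 * (h2 g * (csum f)\<^sup>2)"
    unfolding h2_def by (intro add_mono mult_left_mono young_l2_l1) auto
  also have "\<dots> \<le> 8 * (h2 f * (wt_sum * h2 g)) + 8 * (h2 g * (wt_sum * h2 f))"
    by (intro add_mono mult_left_mono csum_power2_le) auto
  also have "h2 g * (wt_sum * h2 f) = h2 f * (wt_sum * h2 g)"
    by (simp only: ac_simps)
  also have "8 * (h2 f * (wt_sum * h2 g)) + 8 * (h2 f * (wt_sum * h2 g)) = (8 + 8) * (h2 f * (wt_sum * h2 g))"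
    by (simp only: distrib_right)
  also have "\<dots> = 16 * wt_sum * h2 f * h2 g"
    by (simp add: ac_simps)
  finally show ?thesis by simp
qed

text \<open>The core of the embedding of W^{1,2} into L^4. In the Cauchy-Schwarz inequality the
  weights \<open>sqrt (wt l) * sqrt (wt (k - l))\<close> are inserted; the reciprocal squares are
  products that split by the arithmetic-geometric mean inequality into two sums, each equal to
  \<open>wt_sum\<close> for every \<open>k\<close>.\<close>

lemma csum_conv_power2_le: "csum (\<lambda>k. (conv f f k)\<^sup>2) \<le> 2 * wt_sum * (csum (\<lambda>k. ennreal (wt k) * (f k)\<^sup>2))\<^sup>2"
proof -
  let ?h = "\<lambda>k. ennreal (wt k) * (f k)\<^sup>2"
  have "csum (\<lambda>k. (conv f f k)\<^sup>2) \<le> csum (\<lambda>k. conv ?h ?h k * (2 * wt_sum))"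
  proof (rule nn_integral_mono)
    fix k
    let ?w = "\<lambda>l. sqrt (wt l) * sqrt (wt (k - l))"
    have pos: "0 < ?w l" for l by simp
    have "(conv f f k)\<^sup>2 = (csum (\<lambda>l. (ennreal (?w l) * (f l * f (k - l))) * ennreal (1 / ?w l)))\<^sup>2"
    proof -
      have "(ennreal (?w l) * (f l * f (k - l))) * ennreal (1 / ?w l) = f l * f (k - l)" for l
      proof -
        have "ennreal (?w l) * ennreal (1 / ?w l) = 1"
          using pos[of l] by (simp add: less_imp_neq[symmetric] del: times_divide_eq_left flip: ennreal_mult)
        then show ?thesis by (metis mult.assoc mult.commute mult_1)
      qed
      then show ?thesis by (simp add: conv_def)
    qed
    also have "\<dots> \<le> csum (\<lambda>l. (ennreal (?w l) * (f l * f (k - l)))\<^sup>2) * csum (\<lambda>l. (ennreal (1 / ?w l))\<^sup>2)"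
      by (rule csum_Cauchy_Schwarz)
    also have "csum (\<lambda>l. (ennreal (?w l) * (f l * f (k - l)))\<^sup>2) = conv ?h ?h k"
    proof -
      have "(ennreal (?w l))\<^sup>2 = ennreal (wt l) * ennreal (wt (k - l))" for l
        by (simp add: ennreal_power power_mult_distrib ennreal_mult)
      then show ?thesis
        unfolding conv_def by (intro nn_integral_cong) (simp add: power_mult_distrib ac_simps)
    qed
    also have "csum (\<lambda>l. (ennreal (1 / ?w l))\<^sup>2) \<le> csum (\<lambda>l. (ennreal (1 / wt l))\<^sup>2 + (ennreal (1 / wt (k - l)))\<^sup>2)"
    proof (rule nn_integral_mono)
      fix l
      have "(1 / ?w l)\<^sup>2 = (1 / wt l) * (1 / wt (k - l))"
        by (simp add: power_divide power_mult_distrib)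
      also have "\<dots> \<le> (1 / wt l)\<^sup>2 + (1 / wt (k - l))\<^sup>2"
      proof -
        have "0 \<le> (1 / wt l) * (1 / wt (k - l))" by simp
        then show ?thesis using sum_squares_bound[of "1 / wt l" "1 / wt (k - l)"] by linarith
      qed
      finally show "(ennreal (1 / ?w l))\<^sup>2 \<le> (ennreal (1 / wt l))\<^sup>2 + (ennreal (1 / wt (k - l)))\<^sup>2"
        using pos[of l] by (simp add: ennreal_power ennreal_leI del: times_divide_eq_left flip: ennreal_plus)
    qed
    also have "\<dots> = 2 * wt_sum"
      using csum_reflect[of "\<lambda>l. (ennreal (1 / wt l))\<^sup>2" k]
      by (simp add: nn_integral_add wt_sum_def mult_2)
    finally show "(conv f f k)\<^sup>2 \<le> conv ?h ?h k * (2 * wt_sum)"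
      by (simp add: mult_left_mono)
  qed
  also have "\<dots> = csum (conv ?h ?h) * (2 * wt_sum)"
    by (simp add: nn_integral_multc)
  also have "csum (conv ?h ?h) = csum (\<lambda>l. csum (\<lambda>k. ?h l * ?h (k - l)))"
    unfolding conv_def by (rule csum_swap)
  also have "\<dots> = csum (\<lambda>l. ?h l * csum ?h)"
    by (intro nn_integral_cong) (simp add: nn_integral_cmult csum_shift[of ?h])
  also have "\<dots> = (csum ?h)\<^sup>2"
    by (simp add: nn_integral_multc power2_eq_square)
  finally show ?thesis by (simp add: ac_simps)
qed

text \<open>The exponent 2 is shared equally among the coordinates: each factor
  \<open>wt k powr - (2/3)\<close> is at most the value of \<open>q\<close> at one coordinate, so
  the lattice sum is dominated by the cube of a one-dimensional sum whose terms decay with exponent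
  4/3 > 1.\<close>

lemma wt_sum_finite: "wt_sum < \<infinity>"
proof -
  define q :: "int \<Rightarrow> ennreal" where "q n = ennreal ((1 + (of_int n)\<^sup>2) powr - (2/3))" for n
  have q_fin: "csum q < \<infinity>"
  proof -
    have "csum q = csum (\<lambda>n. q (int_decode n))"
      by (rule csum_bij[symmetric]) (rule bij_int_decode)
    also have "\<dots> = (\<Sum>n. q (int_decode n))" by (rule nn_integral_count_space_nat)
    also have "\<dots> \<le> (\<Sum>n. ennreal (8 * real (Suc n) powr - (4/3)))"
    proof (intro suminf_le summableI)
      fix n :: nat
      \<comment> \<open>\<open>int_decode\<close> runs through 0, -1, 1, -2, 2 and so on, so its
        n-th value has size about n/2. For \<open>n = 0\<close> the square of
        \<open>(n - 1) / 2\<close> is positive and the bound fails, hence the alternative.\<close>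
      have "(of_int (int_decode n) :: real)\<^sup>2 \<ge> ((real n - 1) / 2)\<^sup>2 \<or> n = 0"
      proof (cases "n = 0")
        case False
        have "\<bar>of_int (int_decode n) :: real\<bar> \<ge> (real n - 1) / 2"
        proof (cases "even n")
          case True
          then obtain m where "n = 2 * m" by (auto elim: evenE)
          then show ?thesis by (simp add: int_decode_def sum_decode_def)
        next
          case odd: False
          then obtain m where "n = 2 * m + 1" by (auto elim: oddE)
          then show ?thesis by (simp add: int_decode_def sum_decode_def)
        qed
        then show ?thesis using False
          by (metis abs_le_square_iff abs_of_nonneg divide_nonneg_pos diff_ge_0_iff_ge of_nat_1 of_nat_le_iff less_one not_less zero_less_numeral)
      qed auto
      then have "1 + (of_int (int_decode n) :: real)\<^sup>2 \<ge> (real (Suc n))\<^sup>2 / 8"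
      proof
        assume "(of_int (int_decode n) :: real)\<^sup>2 \<ge> ((real n - 1) / 2)\<^sup>2"
        \<comment> \<open>The difference of the two sides is
          \<open>(n - 3)\<^sup>2 / 8\<close>.\<close>
        moreover have "1 + ((real n - 1) / 2)\<^sup>2 \<ge> (real (Suc n))\<^sup>2 / 8"
          using zero_le_power2[of "real n - 3"] by (simp add: power2_eq_square field_simps)
        ultimately show ?thesis by linarith
      qed auto
      then have "(1 + (of_int (int_decode n) :: real)\<^sup>2) powr - (2/3) \<le> ((real (Suc n))\<^sup>2 / 8) powr - (2/3)"
        by (intro powr_mono2') auto
      also have "\<dots> = 8 powr (2/3) * ((real (Suc n))\<^sup>2) powr - (2/3)"
        by (subst powr_divide) (auto simp: powr_minus field_simps)
      also have "((real (Suc n))\<^sup>2) powr - (2/3) = real (Suc n) powr - (4/3)"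
      proof -
        have "(real (Suc n))\<^sup>2 = real (Suc n) powr 2" by simp
        then show ?thesis by (simp only: powr_powr) simp
      qed
      also have "8 powr (2/3) * real (Suc n) powr - (4/3) \<le> 8 powr 1 * real (Suc n) powr - (4/3)"
        by (intro mult_right_mono powr_mono) auto
      finally show "q (int_decode n) \<le> ennreal (8 * real (Suc n) powr - (4/3))"
        by (simp add: q_def ennreal_leI)
    qed
    also have "\<dots> < \<infinity>"
    proof -
      have "summable (\<lambda>n. real n powr - (4/3))" by (subst summable_real_powr_iff) auto
      then have "summable (\<lambda>n. 8 * real (Suc n) powr - (4/3))"
        by (intro summable_mult) (subst summable_Suc_iff)
      then show ?thesis by (subst suminf_ennreal2) auto
    qed
    finally show ?thesis .
  qed
  have "wt_sum \<le> csum (\<lambda>k::int^3. q (k $ 1) * (q (k $ 2) * q (k $ 3)))"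
    unfolding wt_sum_def
  proof (rule nn_integral_mono)
    fix k :: "int^3"
    let ?a = "\<lambda>i. 1 + (of_int (k $ i) :: real)\<^sup>2"
    have le: "?a i \<le> wt k" for i
      unfolding wt_def by (intro add_left_mono member_le_sum) auto
    have pos: "0 < ?a i" for i by (simp add: add_pos_nonneg)
    have p: "wt k powr - (2/3) \<le> ?a i powr - (2/3)" for i
      using le[of i] pos[of i] by (intro powr_mono2') auto
    have "(1 / wt k)\<^sup>2 = wt k powr - 2"
      using wt_pos[of k] by (simp add: powr_minus powr_numeral power_divide field_simps)
    also have "\<dots> = wt k powr - (2/3) * (wt k powr - (2/3) * wt k powr - (2/3))"
      by (simp add: powr_add[symmetric])
    also have "\<dots> \<le> ?a 1 powr - (2/3) * (?a 2 powr - (2/3) * ?a 3 powr - (2/3))"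
      by (intro mult_mono p) auto
    finally show "(ennreal (1 / wt k))\<^sup>2 \<le> q (k $ 1) * (q (k $ 2) * q (k $ 3))"
      by (simp add: q_def ennreal_power ennreal_leI flip: ennreal_mult)
  qed
  also have "\<dots> = csum (\<lambda>p. q (fst p) * (q (fst (snd p)) * q (snd (snd p))))"
  proof -
    have 1: "\<exists>k::int^3. k $ 1 = a \<and> k $ 2 = b \<and> k $ 3 = c" for a b c :: int
      by (rule exI[of _ "vector [a, b, c]"]) simp
    have "bij (\<lambda>k::int^3. (k $ 1, k $ 2, k $ 3))"
      using 1 by (auto simp: bij_def inj_def surj_def vec_eq_iff forall_3) metis
    from csum_bij[OF this, of "\<lambda>p. q (fst p) * (q (fst (snd p)) * q (snd (snd p)))"]
    show ?thesis by simp
  qed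
  also have "\<dots> = csum (\<lambda>a. csum (\<lambda>p. q a * (q (fst p) * q (snd p))))"
    by (subst nn_integral_fst_count_space[symmetric]) simp
  also have "\<dots> = csum q * csum (\<lambda>p. q (fst p) * q (snd p))"
    by (simp add: nn_integral_cmult nn_integral_multc)
  also have "csum (\<lambda>p. q (fst p) * q (snd p)) = csum (\<lambda>a. csum (\<lambda>b. q a * q b))"
    by (subst nn_integral_fst_count_space[symmetric]) simp
  also have "\<dots> = csum q * csum q"
    by (simp add: nn_integral_cmult nn_integral_multc)
  also have "csum q * (csum q * csum q) < \<infinity>"
    using q_fin by (simp add: ennreal_mult_less_top)
  finally show ?thesis .
qed

lemma h2_add_le: "h2 (\<lambda>k. f k + g k) \<le> 2 * h2 f + 2 * h2 g"
proof -
  have "h2 (\<lambda>k. f k + g k) \<le> csum (\<lambda>k. 2 * (ennreal (wt k) * f k)\<^sup>2 + 2 * (ennreal (wt k) * g k)\<^sup>2)"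
    unfolding h2_def by (intro nn_integral_mono) (simp only: distrib_left ennreal_power2_add_le)
  also have "\<dots> = 2 * h2 f + 2 * h2 g"
    by (simp add: nn_integral_add nn_integral_cmult h2_def)
  finally show ?thesis .
qed

lemma h2_cmult: "h2 (\<lambda>k. c * f k) = c\<^sup>2 * h2 f"
  by (simp add: h2_def power_mult_distrib mult.left_commute[of _ "c\<^sup>2"] nn_integral_cmult)

text \<open>The unknown \<open>b\<close> is dominated by the Picard iterates of \<open>c \<mapsto> G + \<theta> V * c\<close> up to an error that
  is uniformly small, so it inherits their bound although \<open>h2 b\<close> is not known to be finite.\<close>

lemma h2_le_of_conv_ineq:
  fixes b G V :: "int^3 \<Rightarrow> ennreal" and \<theta> B :: real
  assumes b: "\<And>k. b k \<le> G k + ennreal \<theta> * conv V b k" and B: "\<And>k. b k \<le> ennreal B"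
    and \<theta>: "0 \<le> \<theta>" and small: "64 * (wt_sum * ((ennreal \<theta>)\<^sup>2 * h2 V)) \<le> 1"
  shows "h2 b \<le> 8 * h2 G"
proof -
  define c where "c = rec_nat (\<lambda>k. 0::ennreal) (\<lambda>_ c k. G k + ennreal \<theta> * conv V c k)"
  have c_0: "c 0 = (\<lambda>k. 0)" and c_Suc: "c (Suc n) k = G k + ennreal \<theta> * conv V (c n) k" for n k
    by (simp_all add: c_def)
  \<comment> \<open>By \<open>small\<close> the iteration satisfies
    \<open>h2 (c (Suc n)) \<le> 2 * h2 G + h2 (c n) / 2\<close>: the factor 64 is chosen to make 2 *
    16 times the bracket at most 1/2. The fixed point of this recursion is 4 times
    \<open>h2 G\<close>.\<close>
  have c_bound: "h2 (c n) \<le> 4 * h2 G" for n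
  proof (induction n)
    case (Suc n)
    have "2 * h2 (\<lambda>k. ennreal \<theta> * conv V (c n) k) \<le> 2 * ((ennreal \<theta>)\<^sup>2 * (16 * wt_sum * h2 V * h2 (c n)))"
      unfolding h2_cmult by (intro mult_left_mono h2_conv_le) auto
    also have "\<dots> = (2 * 16) * ((wt_sum * ((ennreal \<theta>)\<^sup>2 * h2 V)) * h2 (c n))"
      by (simp only: ac_simps)
    also have "\<dots> \<le> (2 * 16) * ((wt_sum * ((ennreal \<theta>)\<^sup>2 * h2 V)) * (4 * h2 G))"
      by (intro mult_left_mono Suc) auto
    also have "\<dots> = (2 * 16 * 4) * ((wt_sum * ((ennreal \<theta>)\<^sup>2 * h2 V)) * h2 G)"
      by (simp only: ac_simps)
    also have "\<dots> = (64 * 2) * ((wt_sum * ((ennreal \<theta>)\<^sup>2 * h2 V)) * h2 G)"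
      by simp
    also have "\<dots> = 64 * (wt_sum * ((ennreal \<theta>)\<^sup>2 * h2 V)) * (2 * h2 G)"
      by (simp only: ac_simps)
    also have "\<dots> \<le> 1 * (2 * h2 G)"
      by (intro mult_right_mono small) auto
    finally have le: "2 * h2 (\<lambda>k. ennreal \<theta> * conv V (c n) k) \<le> 2 * h2 G" by simp
    have "h2 (c (Suc n)) \<le> 2 * h2 G + 2 * h2 (\<lambda>k. ennreal \<theta> * conv V (c n) k)"
      unfolding c_Suc[abs_def] by (rule h2_add_le)
    also have "\<dots> \<le> 2 * h2 G + 2 * h2 G" using le by (rule add_left_mono)
    finally show ?case by (simp flip: distrib_right)
  qed (simp add: c_0 h2_def)
  \<comment> \<open>The same smallness makes convolution with \<open>\<theta> V\<close> a
    contraction in the supremum norm, where \<open>b\<close> is known to be bounded.\<close>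
  have V_small: "ennreal \<theta> * csum V \<le> ennreal (1/2)"
  proof (rule ennreal_power2_le_imp_le)
    have "(ennreal \<theta> * csum V)\<^sup>2 \<le> (ennreal \<theta>)\<^sup>2 * (wt_sum * h2 V)"
      unfolding power_mult_distrib by (intro mult_left_mono csum_power2_le) auto
    then have "4 * (ennreal \<theta> * csum V)\<^sup>2 \<le> 64 * (wt_sum * ((ennreal \<theta>)\<^sup>2 * h2 V))"
      by (intro mult_mono) (auto simp: ac_simps)
    with small have le: "4 * (ennreal \<theta> * csum V)\<^sup>2 \<le> 1" by (rule order_trans[rotated])
    have "ennreal (1/4) * (4 * (ennreal \<theta> * csum V)\<^sup>2) \<le> ennreal (1/4) * 1"
      by (intro mult_left_mono le) auto
    moreover have "ennreal (1/4) * 4 = 1"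
      by (metis ennreal_1 ennreal_mult'' ennreal_numeral nonzero_eq_divide_eq zero_le_numeral zero_neq_numeral)
    ultimately have "(ennreal \<theta> * csum V)\<^sup>2 \<le> ennreal (1/4)"
      by (simp only: mult_1_left mult_1_right flip: mult.assoc)
    also have "ennreal (1/4) = (ennreal (1/2))\<^sup>2"
      by (subst ennreal_power) (simp_all add: power2_eq_square)
    finally show "(ennreal \<theta> * csum V)\<^sup>2 \<le> (ennreal (1/2))\<^sup>2" .
  qed simp
  have err: "b k \<le> c n k + ennreal (\<bar>B\<bar> * (1/2)^n)" for n k
  proof (induction n arbitrary: k)
    case 0
    show ?case using B[of k] order_trans[OF _ ennreal_leI[OF abs_ge_self]] by (simp add: c_0)
  next
    case (Suc n)
    have "conv V b k \<le> csum (\<lambda>l. V l * c n (k - l) + V l * ennreal (\<bar>B\<bar> * (1/2)^n))"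
      unfolding conv_def by (intro nn_integral_mono) (auto simp flip: distrib_left intro!: mult_left_mono Suc)
    also have "\<dots> = conv V (c n) k + csum V * ennreal (\<bar>B\<bar> * (1/2)^n)"
      by (simp add: nn_integral_add nn_integral_multc conv_def)
    finally have "ennreal \<theta> * conv V b k \<le> ennreal \<theta> * (conv V (c n) k + csum V * ennreal (\<bar>B\<bar> * (1/2)^n))"
      by (intro mult_left_mono) auto
    also have "\<dots> = ennreal \<theta> * conv V (c n) k + (ennreal \<theta> * csum V) * ennreal (\<bar>B\<bar> * (1/2)^n)"
      by (simp add: distrib_left ac_simps)
    also have "\<dots> \<le> ennreal \<theta> * conv V (c n) k + ennreal (1/2) * ennreal (\<bar>B\<bar> * (1/2)^n)"
      by (intro add_left_mono mult_right_mono V_small) auto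
    also have "ennreal (1/2) * ennreal (\<bar>B\<bar> * (1/2)^n) = ennreal (\<bar>B\<bar> * (1/2)^Suc n)"
      by (subst ennreal_mult[symmetric]) auto
    finally have "G k + ennreal \<theta> * conv V b k \<le> G k + (ennreal \<theta> * conv V (c n) k + ennreal (\<bar>B\<bar> * (1/2)^Suc n))"
      by (rule add_left_mono)
    with b[of k] show ?case by (auto simp: c_Suc add.assoc intro: order_trans)
  qed
  show ?thesis
    unfolding h2_def[of b]
  proof (rule LIMSEQ_le_const2[OF nn_integral_fbox], intro exI allI impI)
    fix N
    \<comment> \<open>A uniform error need not have finite weighted norm over all frequencies, but
      over a fixed cube it is at most \<open>W\<close> times a power of 1/4, so \<open>n\<close> is
      sent to infinity before the cube grows.\<close>
    define W where "W = (\<Sum>k\<in>fbox N. (wt k)\<^sup>2) * \<bar>B\<bar>\<^sup>2"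
    have W: "W \<ge> 0" by (simp add: W_def sum_nonneg)
    have bound: "(\<Sum>k\<in>fbox N. (ennreal (wt k) * b k)\<^sup>2) \<le> 8 * h2 G + ennreal (2 * W * (1/4)^n)" for n
    proof -
      have "(\<Sum>k\<in>fbox N. (ennreal (wt k) * b k)\<^sup>2)
        \<le> (\<Sum>k\<in>fbox N. 2 * (ennreal (wt k) * c n k)\<^sup>2 + 2 * ennreal ((wt k)\<^sup>2 * (\<bar>B\<bar>\<^sup>2 * (1/4)^n)))"
      proof (rule sum_mono)
        fix k
        have "(ennreal (wt k) * b k)\<^sup>2 \<le> (ennreal (wt k) * (c n k + ennreal (\<bar>B\<bar> * (1/2)^n)))\<^sup>2"
          by (intro power_mono mult_left_mono err) auto
        also have "\<dots> \<le> 2 * (ennreal (wt k) * c n k)\<^sup>2 + 2 * (ennreal (wt k) * ennreal (\<bar>B\<bar> * (1/2)^n))\<^sup>2"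
          unfolding distrib_left by (rule ennreal_power2_add_le)
        also have "(ennreal (wt k) * ennreal (\<bar>B\<bar> * (1/2)^n))\<^sup>2 = ennreal ((wt k)\<^sup>2 * (\<bar>B\<bar>\<^sup>2 * (1/4)^n))"
        proof -
          have "((1/2::real)^n)\<^sup>2 = (1/4)^n" by (simp add: power2_eq_square flip: power_mult_distrib)
          then show ?thesis
            by (simp add: ennreal_power power_mult_distrib flip: ennreal_mult)
        qed
        finally show "(ennreal (wt k) * b k)\<^sup>2 \<le> 2 * (ennreal (wt k) * c n k)\<^sup>2 + 2 * ennreal ((wt k)\<^sup>2 * (\<bar>B\<bar>\<^sup>2 * (1/4)^n))" .
      qed
      also have "\<dots> = 2 * (\<Sum>k\<in>fbox N. (ennreal (wt k) * c n k)\<^sup>2) + 2 * ennreal (W * (1/4)^n)"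
        by (simp add: sum.distrib sum_ennreal W_def sum_distrib_right mult.assoc flip: sum_distrib_left)
      also have "\<dots> \<le> 2 * (4 * h2 G) + 2 * ennreal (W * (1/4)^n)"
        using nn_integral_fbox_le[of "\<lambda>k. (ennreal (wt k) * c n k)\<^sup>2" N] c_bound[of n]
        unfolding h2_def[of "c n"] by (intro add_right_mono mult_left_mono) auto
      also have "\<dots> = 8 * h2 G + ennreal (2 * W * (1/4)^n)"
        using W by (simp add: ennreal_mult mult.assoc[symmetric])
      finally show ?thesis .
    qed
    have "(\<lambda>n. 8 * h2 G + ennreal (2 * W * (1/4)^n)) \<longlonglongrightarrow> 8 * h2 G + ennreal (2 * W * 0)"
      by (intro tendsto_add tendsto_const tendsto_ennrealI tendsto_mult LIMSEQ_power_zero) auto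
    then show "(\<Sum>k\<in>fbox N. (ennreal (wt k) * b k)\<^sup>2) \<le> 8 * h2 G"
      using bound by (intro LIMSEQ_le_const[where X="\<lambda>n. 8 * h2 G + ennreal (2 * W * (1/4)^n)"]) auto
  qed
qed

section \<open>Weak derivatives and Fourier coefficients\<close>

definition vfco :: "(real^3 \<Rightarrow> real^3) \<Rightarrow> int^3 \<Rightarrow> complex^3" where
  "vfco f k = (\<chi> i. fco (\<lambda>x. complex_of_real (f x $ i)) k)"

abbreviation cf :: "L2_torus \<Rightarrow> int^3 \<Rightarrow> complex^3" where
  "cf u \<equiv> vfco (rep_L2_torus u)"

text \<open>In spite of its name a square: it is comparable with the square of the W^{2,2} norm, in
  both directions.\<close>

abbreviation h2_norm :: "L2_torus \<Rightarrow> ennreal" where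
  "h2_norm u \<equiv> h2 (\<lambda>k. ennreal (norm (cf u k)))"

lemma ae_eq_refl: "ae_eq f f \<longleftrightarrow> sq_integrable f"
  by (simp add: ae_eq_def)

lemma sq_integrable_rep: "sq_integrable (rep_L2_torus u)"
  using Quotient_rep_reflp[OF Quotient_L2_torus, of u] by (simp add: ae_eq_refl)

lemma rep_abs: "sq_integrable f \<Longrightarrow> ae_eq (rep_L2_torus (abs_L2_torus f)) f"
  using Quotient_rep_abs[OF Quotient_L2_torus, of f] by (simp add: ae_eq_refl)

lemma inner_L2_torus_rep: "u \<bullet> v = (\<integral>x. rep_L2_torus u x \<bullet> rep_L2_torus v x \<partial>torus)"
  by (simp add: inner_L2_torus_def)

lemma sq_integrable_component:
  assumes "sq_integrable f"
  shows "sqi (\<lambda>x. complex_of_real (f x $ i))"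
  unfolding sqi_def
proof
  have [measurable]: "f \<in> borel_measurable torus" using assms by (simp add: sq_integrable_def)
  show "(\<lambda>x. complex_of_real (f x $ i)) \<in> borel_measurable torus" by measurable
  show "integrable torus (\<lambda>x. (norm (complex_of_real (f x $ i)))\<^sup>2)"
  proof (rule Bochner_Integration.integrable_bound)
    show "integrable torus (\<lambda>x. (norm (f x))\<^sup>2)" using assms by (simp add: sq_integrable_def)
    show "AE x in torus. norm ((norm (complex_of_real (f x $ i)))\<^sup>2) \<le> norm ((norm (f x))\<^sup>2)"
      by (auto intro!: AE_I2 abs_le_square_iff[THEN iffD1] simp: component_le_norm_cart)
  qed measurable
qed

lemma sq_integrable_integrable: "sq_integrable f \<Longrightarrow> integrable torus f"
proof (rule Bochner_Integration.integrable_bound)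
  assume "sq_integrable f"
  then show "integrable torus (\<lambda>x. 1 + (norm (f x))\<^sup>2)" by (simp add: sq_integrable_def)
  show "AE x in torus. norm (f x) \<le> norm (1 + (norm (f x))\<^sup>2)"
  proof (rule AE_I2)
    fix x
    have "norm (f x) \<le> 1 + (norm (f x))\<^sup>2"
      using zero_le_power2[of "norm (f x) - 1"] zero_le_power2[of "norm (f x)"]
      by (simp add: power2_eq_square algebra_simps) (smt (verit) norm_ge_zero)
    then show "norm (f x) \<le> norm (1 + (norm (f x))\<^sup>2)" by simp
  qed
qed (simp add: sq_integrable_def)

lemma integrable_component:
  "integrable torus f \<Longrightarrow> integrable torus (\<lambda>x. f x $ i)" for f :: "real^3 \<Rightarrow> real^3"
  by (rule integrable_bounded_linear[OF bounded_linear_vec_nth])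

lemma integral_component:
  "integrable torus f \<Longrightarrow> (\<integral>x. f x \<partial>torus) $ i = (\<integral>x. f x $ i \<partial>torus)" for f :: "real^3 \<Rightarrow> real^3"
  using integral_bounded_linear[OF bounded_linear_vec_nth, of torus f i] by simp

lemma vfco_cong_AE:
  assumes [measurable]: "f \<in> borel_measurable torus" "g \<in> borel_measurable torus" and eq: "AE x in torus. f x = g x"
  shows "vfco f = vfco g"
proof -
  have "fco (\<lambda>x. complex_of_real (f x $ i)) k = fco (\<lambda>x. complex_of_real (g x $ i)) k" for i k
    unfolding fco_def by (rule integral_cong_AE) (use eq in auto)
  then show ?thesis by (simp add: vfco_def fun_eq_iff)
qed

lemma vfco_rep_abs: "sq_integrable f \<Longrightarrow> cf (abs_L2_torus f) = vfco f"
  using rep_abs[of f] by (intro vfco_cong_AE) (auto simp: ae_eq_def sq_integrable_def)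

lemma Re_mult_fco:
  assumes "integrable torus g"
  shows "Re (z * fco (\<lambda>x. complex_of_real (g x)) k) = (\<integral>x. g x * trig k z x \<partial>torus)"
proof -
  have int: "integrable torus (\<lambda>x. complex_of_real (g x) * chr k x)"
    using assms by (intro integrable_mult_chr integrable_of_real)
  have "Re (z * fco (\<lambda>x. complex_of_real (g x)) k) = Re (\<integral>x. z * (complex_of_real (g x) * chr k x) \<partial>torus)"
    by (simp add: fco_def)
  also have "\<dots> = (\<integral>x. Re (z * (complex_of_real (g x) * chr k x)) \<partial>torus)"
    by (intro integral_Re[symmetric] integrable_mult_right int)
  also have "\<dots> = (\<integral>x. g x * trig k z x \<partial>torus)"
    by (intro Bochner_Integration.integral_cong refl) (simp add: trig_def algebra_simps)
  finally show ?thesis .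
qed

text \<open>Test functions are real, so an identity between complex coefficients is obtained from
  the real parts of all its multiples; compare \<open>Re_mult_fco\<close>.\<close>

lemma complex_eq_iff_Re_mult: "w = w' \<longleftrightarrow> (\<forall>z. Re (z * w) = Re (z * w'))"
proof
  assume *: "\<forall>z. Re (z * w) = Re (z * w')"
  show "w = w'" using *[rule_format, of 1] *[rule_format, of "- \<i>"] by (simp add: complex_eq_iff)
qed auto

lemma vfco_eq_imp_AE_eq:
  assumes "integrable torus f" "integrable torus g" "vfco f = vfco g"
  shows "AE x in torus. f x = g x"
proof -
  have "AE x in torus. complex_of_real (f x $ i) = complex_of_real (g x $ i)" for i
    using assms integrable_component[of f] integrable_component[of g]
    by (intro fco_eq_imp_AE_eq) (auto simp: vfco_def fun_eq_iff vec_eq_iff)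
  then have "AE x in torus. \<forall>i. complex_of_real (f x $ i) = complex_of_real (g x $ i)"
    by (intro AE_all_countable[THEN iffD2]) simp
  then show ?thesis by eventually_elim (simp add: vec_eq_iff)
qed

lemma ennreal_norm_power2_vec: "ennreal ((norm v)\<^sup>2) = (\<Sum>i\<in>UNIV. ennreal ((norm (v $ i))\<^sup>2))"
  for v :: "'a::real_normed_vector^'n"
  by (simp add: norm_vec_def L2_set_def sum_nonneg sum_ennreal)

lemma vfco_parseval:
  assumes "sq_integrable f"
  shows "csum (\<lambda>k. ennreal ((norm (vfco f k))\<^sup>2)) = (\<integral>\<^sup>+x. ennreal ((norm (f x))\<^sup>2) \<partial>torus)"
proof -
  have [measurable]: "f \<in> borel_measurable torus" using assms by (simp add: sq_integrable_def)
  have "csum (\<lambda>k. ennreal ((norm (vfco f k))\<^sup>2)) = (\<Sum>i\<in>UNIV. csum (\<lambda>k. ennreal ((norm (fco (\<lambda>x. complex_of_real (f x $ i)) k))\<^sup>2)))"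
    unfolding ennreal_norm_power2_vec vfco_def by (simp add: nn_integral_sum del: sum_ennreal)
  also have "\<dots> = (\<Sum>i\<in>UNIV. \<integral>\<^sup>+x. ennreal ((norm (f x $ i))\<^sup>2) \<partial>torus)"
    using parseval[OF sq_integrable_component[OF assms]] by simp
  also have "\<dots> = (\<integral>\<^sup>+x. ennreal ((norm (f x))\<^sup>2) \<partial>torus)"
    unfolding ennreal_norm_power2_vec by (rule nn_integral_sum[symmetric]) measurable
  finally show ?thesis .
qed

text \<open>The Fourier symbol of \<open>mpartial \<alpha>\<close>. On \<open>fco\<close> it acts at
  the opposite frequency \<open>- k\<close>.\<close>

definition dsym :: "multi_index \<Rightarrow> int^3 \<Rightarrow> complex" where
  "dsym \<alpha> k = freq 1 k ^ (\<alpha> $ 1) * (freq 2 k ^ (\<alpha> $ 2) * freq 3 k ^ (\<alpha> $ 3))"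

lemma funpow_partial_trig: "(partial i ^^ n) (trig k z) = trig k (freq i k ^ n * z)"
  by (induction n) (simp_all add: partial_trig mult.assoc)

lemma mpartial_trig: "mpartial \<alpha> (trig k z) = trig k (dsym \<alpha> k * z)"
  by (simp add: mpartial_def funpow_partial_trig dsym_def mult.assoc)

lemma periodic_smooth_funpow: "periodic_smooth \<phi> \<Longrightarrow> periodic_smooth ((partial i ^^ n) \<phi>)"
  by (induction n) (auto intro: periodic_smooth_partial)

lemma periodic_smooth_mpartial: "periodic_smooth \<phi> \<Longrightarrow> periodic_smooth (mpartial \<alpha> \<phi>)"
  unfolding mpartial_def by (intro periodic_smooth_funpow)

lemma periodic_smooth_integrable: "periodic_smooth \<phi> \<Longrightarrow> integrable torus \<phi>"
  by (intro integrable_torus_continuous periodic_smooth_continuous)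

lemma fco_partial:
  assumes "periodic_smooth \<phi>"
  shows "fco (\<lambda>x. complex_of_real (partial i \<phi> x)) k = - freq i k * fco (\<lambda>x. complex_of_real (\<phi> x)) k"
  unfolding complex_eq_iff_Re_mult
proof
  fix z
  have "Re (z * fco (\<lambda>x. complex_of_real (partial i \<phi> x)) k) = - Re (freq i k * z * fco (\<lambda>x. complex_of_real (\<phi> x)) k)"
    using integral_partial_mult_trig[OF assms, of i k z]
    by (simp only: Re_mult_fco periodic_smooth_integrable periodic_smooth_partial assms)
  then show "Re (z * fco (\<lambda>x. complex_of_real (partial i \<phi> x)) k) = Re (z * (- freq i k * fco (\<lambda>x. complex_of_real (\<phi> x)) k))"
    by (simp only: mult_minus_left mult_minus_right uminus_complex.sel mult.assoc mult.left_commute)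
qed

lemma fco_funpow_partial:
  assumes "periodic_smooth \<phi>"
  shows "fco (\<lambda>x. complex_of_real ((partial i ^^ n) \<phi> x)) k = (- freq i k) ^ n * fco (\<lambda>x. complex_of_real (\<phi> x)) k"
  by (induction n) (simp_all add: fco_partial[OF periodic_smooth_funpow[OF assms]])

lemma freq_minus: "freq i (- k) = - freq i k"
  by (simp add: freq_def)

lemma fco_mpartial:
  assumes "periodic_smooth \<phi>"
  shows "fco (\<lambda>x. complex_of_real (mpartial \<alpha> \<phi> x)) k = dsym \<alpha> (- k) * fco (\<lambda>x. complex_of_real (\<phi> x)) k"
  using assms by (simp add: mpartial_def fco_funpow_partial periodic_smooth_funpow dsym_def freq_minus)

lemma deg_eq: "deg \<alpha> = \<alpha> $ 1 + \<alpha> $ 2 + \<alpha> $ 3"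
  by (simp add: deg_def sum_3)

lemma dsym_minus: "dsym \<alpha> (- k) = (-1) ^ deg \<alpha> * dsym \<alpha> k"
  by (simp add: dsym_def freq_minus deg_eq power_add power_minus[of "freq _ k"])

lemma dsym_cnj: "cnj (dsym \<alpha> k) = dsym \<alpha> (- k)"
  by (simp add: dsym_def freq_def)

text \<open>Trigonometric functions are admissible test functions, and by
  \<open>mpartial_trig\<close> differentiating one only multiplies its complex coefficient by the
  symbol.\<close>

lemma vfco_weak_deriv:
  assumes "is_weak_deriv \<alpha> f g"
  shows "vfco g k $ i = dsym \<alpha> (- k) * vfco f k $ i"
proof -
  have f: "integrable torus f" and g: "integrable torus g" using assms by (auto simp: is_weak_deriv_def)
  have bdd: "integrable torus (\<lambda>x. trig k z x *\<^sub>R f x)" if "integrable torus f" for z and f :: "real^3 \<Rightarrow> real^3"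
  proof (rule Bochner_Integration.integrable_bound)
    show "integrable torus (\<lambda>x. norm z * norm (f x))" using that by simp
    show "(\<lambda>x. trig k z x *\<^sub>R f x) \<in> borel_measurable torus"
      using that periodic_smooth_measurable[OF periodic_smooth_trig] by (intro borel_measurable_scaleR) auto
    have "\<bar>trig k z x\<bar> \<le> norm z" for x
      using abs_Re_le_cmod[of "z * chr k x"] by (simp add: trig_def norm_mult)
    then show "AE x in torus. norm (trig k z x *\<^sub>R f x) \<le> norm (norm z * norm (f x))"
      by (auto intro!: mult_right_mono)
  qed
  have "fco (\<lambda>x. complex_of_real (g x $ i)) k = (-1) ^ deg \<alpha> * dsym \<alpha> k * fco (\<lambda>x. complex_of_real (f x $ i)) k"
    unfolding complex_eq_iff_Re_mult
  proof
    fix z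
    have "(\<integral>x. trig k (dsym \<alpha> k * z) x *\<^sub>R f x \<partial>torus) $ i = ((-1) ^ deg \<alpha> *\<^sub>R (\<integral>x. trig k z x *\<^sub>R g x \<partial>torus)) $ i"
      using assms[unfolded is_weak_deriv_def, THEN conjunct2, THEN conjunct2, THEN spec, of "trig k z"]
        periodic_smooth_trig[of k z] by (simp only: mpartial_trig simp_thms)
    then have "(\<integral>x. trig k (dsym \<alpha> k * z) x * f x $ i \<partial>torus) = (-1) ^ deg \<alpha> * (\<integral>x. trig k z x * g x $ i \<partial>torus)"
      by (simp add: integral_component bdd f g)
    then have "Re (dsym \<alpha> k * z * fco (\<lambda>x. complex_of_real (f x $ i)) k) = (-1) ^ deg \<alpha> * Re (z * fco (\<lambda>x. complex_of_real (g x $ i)) k)"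
      by (simp only: Re_mult_fco integrable_component f g mult.commute)
    then show "Re (z * fco (\<lambda>x. complex_of_real (g x $ i)) k)
        = Re (z * ((-1) ^ deg \<alpha> * dsym \<alpha> k * fco (\<lambda>x. complex_of_real (f x $ i)) k))"
      by (cases "even (deg \<alpha>)") (simp_all add: ac_simps)
  qed
  then show ?thesis by (simp add: vfco_def dsym_minus)
qed

lemma fco_cnj: "fco (\<lambda>x. cnj (f x)) k = cnj (fco f (- k))"
proof -
  have "fco (\<lambda>x. cnj (f x)) k = (\<integral>x. cnj (f x * chr (- k) x) \<partial>torus)"
    by (simp add: fco_def cnj_chr)
  then show ?thesis by (simp only: Bochner_Integration.integral_cnj fco_def)
qed

text \<open>The converse of \<open>vfco_weak_deriv\<close>: Riesz-Fischer builds the components of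
  the derivative from the multiplied coefficients, and Parseval against a smooth periodic function
  verifies the integration by parts.\<close>

lemma exists_weak_deriv:
  assumes f: "sq_integrable f" and fin: "csum (\<lambda>k. ennreal ((norm (dsym \<alpha> k))\<^sup>2 * (norm (vfco f k))\<^sup>2)) < \<infinity>"
  shows "\<exists>g. is_weak_deriv \<alpha> f g \<and> sq_integrable g"
proof -
  define fi where "fi i x = complex_of_real (f x $ i)" for i x
  have fi_sqi: "sqi (fi i)" for i unfolding fi_def[abs_def] by (rule sq_integrable_component[OF f])
  have fi_cnj: "fco (fi i) (- k) = cnj (fco (fi i) k)" for i k
    using fco_cnj[of "fi i" "- k"] by (simp add: fi_def[abs_def])
  have "\<exists>g. sqi g \<and> (\<forall>k. fco g k = dsym \<alpha> (- k) * fco (fi i) k)" for i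
  proof -
    have "csum (\<lambda>k. ennreal ((norm (dsym \<alpha> (- k) * fco (fi i) k))\<^sup>2))
      \<le> csum (\<lambda>k. ennreal ((norm (dsym \<alpha> k))\<^sup>2 * (norm (vfco f k))\<^sup>2))"
    proof (rule nn_integral_mono)
      fix k
      have "norm (vfco f k $ i) \<le> norm (vfco f k)" by (rule Finite_Cartesian_Product.norm_nth_le)
      then have "norm (fco (fi i) k) \<le> norm (vfco f k)" by (simp add: vfco_def fi_def[abs_def])
      then show "ennreal ((norm (dsym \<alpha> (- k) * fco (fi i) k))\<^sup>2) \<le> ennreal ((norm (dsym \<alpha> k))\<^sup>2 * (norm (vfco f k))\<^sup>2)"
        by (auto simp: norm_mult power_mult_distrib dsym_minus norm_power
            intro!: ennreal_leI mult_left_mono power_mono)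
    qed
    then have "csum (\<lambda>k. ennreal ((norm (dsym \<alpha> (- k) * fco (fi i) k))\<^sup>2)) < \<infinity>"
      using fin by (rule order.strict_trans1)
    from riesz_fischer[OF this] show ?thesis by metis
  qed
  then obtain G where G: "\<And>i. sqi (G i)" "\<And>i k. fco (G i) k = dsym \<alpha> (- k) * fco (fi i) k" by metis
  \<comment> \<open>The functions \<open>G i\<close> are complex. Their coefficients have the
    conjugate symmetry of a real function, by \<open>fi_cnj\<close> and \<open>dsym_cnj\<close>, so
    passing to the real part preserves them.\<close>
  define g where "g x = (\<chi> i. Re (G i x))" for x
  have [measurable]: "G i \<in> borel_measurable torus" for i using G(1) by (rule sqi_measurable)
  have "(\<lambda>x. Re (G i x)) \<in> borel_measurable torus" for i by measurable
  then have [measurable]: "g \<in> borel_measurable torus"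
    by (subst borel_measurable_euclidean_space) (simp add: Basis_vec_def inner_axis g_def)
  have g_sq: "sq_integrable g"
    unfolding sq_integrable_def
  proof
    show "integrable torus (\<lambda>x. (norm (g x))\<^sup>2)"
    proof (rule Bochner_Integration.integrable_bound)
      show "integrable torus (\<lambda>x. \<Sum>i\<in>UNIV. (norm (G i x))\<^sup>2)"
        using G(1) by (intro Bochner_Integration.integrable_sum) (simp add: sqi_def)
      have "(norm (g x))\<^sup>2 \<le> (\<Sum>i\<in>UNIV. (norm (G i x))\<^sup>2)" for x
        unfolding norm_vec_def L2_set_def g_def
        by (simp add: sum_nonneg) (intro sum_mono, metis abs_Re_le_cmod abs_ge_zero power2_abs power_mono)
      then show "AE x in torus. norm ((norm (g x))\<^sup>2) \<le> norm (\<Sum>i\<in>UNIV. (norm (G i x))\<^sup>2)"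
        by (auto simp: sum_nonneg)
    qed measurable
  qed measurable
  have gi_fco: "fco (\<lambda>x. complex_of_real (g x $ i)) k = dsym \<alpha> (- k) * fco (fi i) k" for i k
  proof -
    have G_int: "integrable torus (G i)" using G(1) by (rule sqi_integrable)
    have *: "integrable torus (\<lambda>x. cnj (G i x) * chr k x)"
      using G_int by (intro integrable_mult_chr) simp
    have "fco (\<lambda>x. complex_of_real (g x $ i)) k = (\<integral>x. (1/2) * (G i x * chr k x + cnj (G i x) * chr k x) \<partial>torus)"
      unfolding fco_def
      by (intro Bochner_Integration.integral_cong refl) (simp add: g_def complex_add_cnj flip: distrib_right)
    also have "\<dots> = (1/2) * (fco (G i) k + fco (\<lambda>x. cnj (G i x)) k)"
      using * integrable_mult_chr[OF G_int] by (simp add: fco_def)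
    also have "fco (\<lambda>x. cnj (G i x)) k = fco (G i) k"
      by (simp add: fco_cnj G(2) fi_cnj dsym_cnj)
    finally show ?thesis by (simp add: G(2))
  qed
  have "is_weak_deriv \<alpha> f g"
    unfolding is_weak_deriv_def
  proof (intro conjI allI impI)
    show f_int: "integrable torus f" and g_int: "integrable torus g"
      using f g_sq by (auto intro: sq_integrable_integrable)
    fix \<phi> assume \<phi>: "periodic_smooth \<phi>"
    have sm: "sqi (\<lambda>x. complex_of_real (\<psi> x))" "integrable torus (\<lambda>x. \<psi> x *\<^sub>R h x)"
      if \<psi>: "periodic_smooth \<psi>" and h: "integrable torus h" for \<psi> and h :: "real^3 \<Rightarrow> real^3"
    proof -
      have c: "continuous_on UNIV \<psi>" using \<psi> by (rule periodic_smooth_continuous)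
      have "compact (\<psi> ` cbox 0 1)" by (intro compact_continuous_image continuous_on_subset[OF c]) auto
      then obtain B where B: "\<forall>y\<in>\<psi> ` cbox 0 1. norm y \<le> B" by (meson bounded_iff compact_imp_bounded)
      have B': "\<bar>\<psi> x\<bar> \<le> B" if "x \<in> cell" for x
        using B that by (auto simp: cell_def mem_box_cart less_imp_le)
      have [measurable]: "\<psi> \<in> borel_measurable torus" using \<psi> by (rule periodic_smooth_measurable)
      show "sqi (\<lambda>x. complex_of_real (\<psi> x))"
        unfolding sqi_def using c by (auto intro!: integrable_torus_continuous continuous_intros)
      show "integrable torus (\<lambda>x. \<psi> x *\<^sub>R h x)"
      proof (rule Bochner_Integration.integrable_bound)
        show "integrable torus (\<lambda>x. B * norm (h x))" using h by simp
        show "(\<lambda>x. \<psi> x *\<^sub>R h x) \<in> borel_measurable torus" using h by (intro borel_measurable_scaleR) auto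
        show "AE x in torus. norm (\<psi> x *\<^sub>R h x) \<le> norm (B * norm (h x))"
        proof (rule AE_I2)
          fix x assume "x \<in> space torus"
          then have "\<bar>\<psi> x\<bar> * norm (h x) \<le> \<bar>B\<bar> * norm (h x)"
            using B'[of x] by (intro mult_right_mono) (auto simp: space_torus)
          then show "norm (\<psi> x *\<^sub>R h x) \<le> norm (B * norm (h x))" by (simp add: abs_mult)
        qed
      qed
    qed
    note m\<phi> = periodic_smooth_mpartial[OF \<phi>, of \<alpha>]
    have "(\<integral>x. mpartial \<alpha> \<phi> x *\<^sub>R f x \<partial>torus) $ i = ((-1) ^ deg \<alpha> *\<^sub>R (\<integral>x. \<phi> x *\<^sub>R g x \<partial>torus)) $ i" for i
    proof -
      have "(\<lambda>N. \<Sum>k\<in>fbox N. fco (\<lambda>x. complex_of_real (mpartial \<alpha> \<phi> x)) k * fco (fi i) (- k))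
          \<longlonglongrightarrow> (\<integral>x. complex_of_real (mpartial \<alpha> \<phi> x) * fi i x \<partial>torus)"
        by (rule parseval_LIMSEQ[OF sm(1)[OF m\<phi> f_int] fi_sqi])
      moreover have "(\<lambda>N. (-1) ^ deg \<alpha> * (\<Sum>k\<in>fbox N. fco (\<lambda>x. complex_of_real (\<phi> x)) k * fco (\<lambda>x. complex_of_real (g x $ i)) (- k)))
          \<longlonglongrightarrow> (-1) ^ deg \<alpha> * (\<integral>x. complex_of_real (\<phi> x) * complex_of_real (g x $ i) \<partial>torus)"
        by (intro tendsto_mult_left parseval_LIMSEQ sm(1)[OF \<phi> f_int] sq_integrable_component g_sq)
      moreover have "(\<Sum>k\<in>fbox N. fco (\<lambda>x. complex_of_real (mpartial \<alpha> \<phi> x)) k * fco (fi i) (- k))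
          = (-1) ^ deg \<alpha> * (\<Sum>k\<in>fbox N. fco (\<lambda>x. complex_of_real (\<phi> x)) k * fco (\<lambda>x. complex_of_real (g x $ i)) (- k))" for N
        unfolding sum_distrib_left gi_fco fco_mpartial[OF \<phi>]
        by (intro sum.cong refl) (simp add: dsym_minus)
      ultimately have "(\<integral>x. complex_of_real (mpartial \<alpha> \<phi> x) * fi i x \<partial>torus)
          = (-1) ^ deg \<alpha> * (\<integral>x. complex_of_real (\<phi> x) * complex_of_real (g x $ i) \<partial>torus)"
        by (metis (no_types, lifting) LIMSEQ_unique ext)
      then have "complex_of_real (\<integral>x. mpartial \<alpha> \<phi> x * f x $ i \<partial>torus) = (-1) ^ deg \<alpha> * complex_of_real (\<integral>x. \<phi> x * g x $ i \<partial>torus)"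
        unfolding fi_def by (simp only: of_real_mult[symmetric] integral_complex_of_real)
      then have "complex_of_real (\<integral>x. mpartial \<alpha> \<phi> x * f x $ i \<partial>torus) = complex_of_real ((-1) ^ deg \<alpha> * (\<integral>x. \<phi> x * g x $ i \<partial>torus))"
        by simp
      then have "(\<integral>x. mpartial \<alpha> \<phi> x * f x $ i \<partial>torus) = (-1) ^ deg \<alpha> * (\<integral>x. \<phi> x * g x $ i \<partial>torus)"
        by (simp only: of_real_eq_iff)
      then show ?thesis
        using sm(2)[OF m\<phi> f_int] sm(2)[OF \<phi> g_int] by (simp add: integral_component)
    qed
    then show "(\<integral>x. mpartial \<alpha> \<phi> x *\<^sub>R f x \<partial>torus) = (-1) ^ deg \<alpha> *\<^sub>R (\<integral>x. \<phi> x *\<^sub>R g x \<partial>torus)"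
      by (simp add: vec_eq_iff)
  qed
  with g_sq show ?thesis by blast
qed

section \<open>Sobolev norms and Fourier coefficients\<close>

lemma finite_deg_le: "finite {\<alpha>. deg \<alpha> \<le> k}"
proof (rule inj_on_finite[of vec_nth])
  show "inj_on vec_nth {\<alpha>. deg \<alpha> \<le> k}" by (auto simp: inj_on_def vec_eq_iff)
  have "\<alpha> $ i \<le> deg \<alpha>" for \<alpha> i unfolding deg_def by (rule member_le_sum) auto
  then show "vec_nth ` {\<alpha>. deg \<alpha> \<le> k} \<subseteq> (UNIV \<rightarrow>\<^sub>E {..k})"
    by (auto intro: order_trans)
  show "finite ((UNIV::3 set) \<rightarrow>\<^sub>E {..k})" by (intro finite_PiE) auto
qed

lemma ennroot_2_power2: "(ennroot 2 x)\<^sup>2 = x"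
proof (cases x)
  case (real r)
  then have "(r powr (1/2))\<^sup>2 = r" by (simp add: powr_half_sqrt)
  with real show ?thesis by (simp add: ennroot_def ennreal_power)
qed (simp add: ennroot_def power2_eq_square)

lemma norm_vec_cmult:
  fixes v w :: "complex^'n"
  assumes "\<And>i. w $ i = c * v $ i"
  shows "norm w = norm c * norm v"
  unfolding norm_vec_def assms norm_mult by (simp add: L2_set_right_distrib)

lemma norm_vfco_weak_deriv:
  assumes "is_weak_deriv \<alpha> f g"
  shows "norm (vfco g k) = norm (dsym \<alpha> k) * norm (vfco f k)"
  using norm_vec_cmult[of "vfco g k" "dsym \<alpha> (- k)" "vfco f k"] vfco_weak_deriv[OF assms]
  by (simp add: dsym_minus norm_mult norm_power)

text \<open>A weak derivative is only required to be integrable; if its square has infinite integral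
  the bound is trivial, otherwise Parseval applies.\<close>

lemma weak_deriv_bessel:
  assumes "is_weak_deriv \<alpha> f g"
  shows "csum (\<lambda>k. ennreal ((norm (dsym \<alpha> k))\<^sup>2 * (norm (vfco f k))\<^sup>2)) \<le> (\<integral>\<^sup>+x. ennreal ((norm (g x))\<^sup>2) \<partial>torus)"
proof (cases "(\<integral>\<^sup>+x. ennreal ((norm (g x))\<^sup>2) \<partial>torus) < \<infinity>")
  case True
  then have "sq_integrable g"
    using assms unfolding is_weak_deriv_def sq_integrable_def by (auto simp: integrable_iff_bounded)
  from vfco_parseval[OF this] show ?thesis
    by (simp add: norm_vfco_weak_deriv[OF assms] power_mult_distrib)
qed (simp add: not_less top_unique)

text \<open>All weak derivatives share their coefficients and so agree almost everywhere. Hence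
  square integrability carries over from the one just constructed to any other, in particular to the
  one picked by \<open>SOME\<close>.\<close>

lemma weak_deriv_sq_integrable:
  assumes g: "is_weak_deriv \<alpha> f g" and f: "sq_integrable f"
    and fin: "csum (\<lambda>k. ennreal ((norm (dsym \<alpha> k))\<^sup>2 * (norm (vfco f k))\<^sup>2)) < \<infinity>"
  shows "sq_integrable g"
proof -
  obtain g' where g': "is_weak_deriv \<alpha> f g'" "sq_integrable g'" using exists_weak_deriv[OF f fin] by blast
  have "vfco g' = vfco g"
    using vfco_weak_deriv[OF g] vfco_weak_deriv[OF g'(1)] by (simp add: fun_eq_iff vec_eq_iff)
  then have "AE x in torus. g' x = g x"
    using g g'(1) by (intro vfco_eq_imp_AE_eq) (auto simp: is_weak_deriv_def)
  moreover have [measurable]: "g \<in> borel_measurable torus" "g' \<in> borel_measurable torus"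
    using g g' by (auto simp: is_weak_deriv_def)
  ultimately have "integrable torus (\<lambda>x. (norm (g' x))\<^sup>2) \<longleftrightarrow> integrable torus (\<lambda>x. (norm (g x))\<^sup>2)"
    by (intro Bochner_Integration.integrable_cong_AE) (measurable, auto)
  with g'(2) show ?thesis by (simp add: sq_integrable_def)
qed

lemma is_weak_deriv_weak_deriv:
  "\<exists>g. is_weak_deriv \<alpha> (rep_L2_torus u) g \<Longrightarrow> is_weak_deriv \<alpha> (rep_L2_torus u) (weak_deriv \<alpha> u)"
  using someI_ex[of "is_weak_deriv \<alpha> (rep_L2_torus u)"] by (simp add: weak_deriv_def)

lemma norm_freq: "norm (freq i k) = 2 * pi * \<bar>of_int (k $ i)\<bar>"
  by (simp add: freq_def norm_mult)

lemma wt_ge_square: "(of_int (k $ i))\<^sup>2 \<le> wt k"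
  using member_le_sum[of i UNIV "\<lambda>i. (of_int (k $ i) :: real)\<^sup>2"] by (simp add: wt_def)

lemma norm_freq_power2_le: "(norm (freq i k))\<^sup>2 \<le> 64 * wt k"
proof -
  have "(2 * pi)\<^sup>2 \<le> 8\<^sup>2" using pi_less_4 pi_gt_zero by (intro power_mono) auto
  then have "(2 * pi)\<^sup>2 * (of_int (k $ i))\<^sup>2 \<le> 64 * wt k"
    using wt_ge_square[of k i] by (intro mult_mono) auto
  then show ?thesis by (simp add: norm_freq power_mult_distrib)
qed

lemma norm_dsym_power2_le:
  assumes "deg \<alpha> \<le> m"
  shows "(norm (dsym \<alpha> k))\<^sup>2 \<le> (64 * wt k) ^ m"
proof -
  let ?W = "64 * wt k"
  have "(norm (dsym \<alpha> k))\<^sup>2 = ((norm (freq 1 k))\<^sup>2) ^ (\<alpha> $ 1) * (((norm (freq 2 k))\<^sup>2) ^ (\<alpha> $ 2) * ((norm (freq 3 k))\<^sup>2) ^ (\<alpha> $ 3))"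
    by (simp add: dsym_def norm_mult norm_power power_mult_distrib mult.commute flip: power_mult)
  also have "\<dots> \<le> ?W ^ (\<alpha> $ 1) * (?W ^ (\<alpha> $ 2) * ?W ^ (\<alpha> $ 3))"
    by (intro mult_mono power_mono norm_freq_power2_le) auto
  also have "\<dots> = ?W ^ deg \<alpha>" by (simp only: deg_eq power_add ac_simps)
  also have "\<dots> \<le> ?W ^ m" using assms wt_ge_1[of k] by (intro power_increasing) auto
  finally show ?thesis .
qed



text \<open>The function and its three pure second derivatives suffice: the square of
  \<open>1 + a + b + c\<close> is at most four times the sum of the squares, and
  \<open>2 * pi\<close> is at least 1.\<close>

lemma wt_power2_le: "(wt k)\<^sup>2 \<le> 4 * (\<Sum>\<alpha> | deg \<alpha> \<le> 2. (norm (dsym \<alpha> k))\<^sup>2)"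
proof -
  define x where "x i = (of_int (k $ i) :: real)\<^sup>2" for i
  define A :: "multi_index set" where "A = {0, axis 1 2, axis 2 2, axis 3 2}"
  have "deg (axis i 2) = 2" for i
    by (simp add: deg_def axis_def)
  then have A: "A \<subseteq> {\<alpha>. deg \<alpha> \<le> 2}" by (auto simp: A_def deg_def)
  have d: "(x i)\<^sup>2 \<le> (norm (dsym (axis i 2) k))\<^sup>2" for i
  proof (rule power_mono)
    have "norm (dsym (axis i 2) k) = (norm (freq i k))\<^sup>2"
      using exhaust_3[of i] by (auto simp: dsym_def axis_def norm_power)
    also have "\<dots> = (2 * pi)\<^sup>2 * x i" by (simp add: norm_freq x_def power_mult_distrib)
    finally have eq: "norm (dsym (axis i 2) k) = (2 * pi)\<^sup>2 * x i" .
    have "1\<^sup>2 \<le> (2 * pi)\<^sup>2" using pi_ge_two by (intro power_mono) auto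
    then have "1 * x i \<le> (2 * pi)\<^sup>2 * x i" by (intro mult_right_mono) (auto simp: x_def)
    then show "x i \<le> norm (dsym (axis i 2) k)" by (simp add: eq)
  qed (simp add: x_def)
  have "wt k = 1 + x 1 + x 2 + x 3" by (simp add: wt_def x_def sum_3)
  moreover have "(1 + a + b + c)\<^sup>2 \<le> 4 * (1 + a\<^sup>2 + b\<^sup>2 + c\<^sup>2)" for a b c :: real
    using zero_le_power2[of "1 - a"] zero_le_power2[of "1 - b"] zero_le_power2[of "1 - c"]
      zero_le_power2[of "a - b"] zero_le_power2[of "a - c"] zero_le_power2[of "b - c"]
    by (simp add: power2_eq_square algebra_simps)
  ultimately have "(wt k)\<^sup>2 \<le> 4 * (1 + (x 1)\<^sup>2 + (x 2)\<^sup>2 + (x 3)\<^sup>2)" by simp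
  also have "\<dots> \<le> 4 * (\<Sum>\<alpha>\<in>A. (norm (dsym \<alpha> k))\<^sup>2)"
  proof -
    have 0: "axis i 2 \<noteq> (0 :: multi_index)" for i by (simp add: axis_eq_0_iff)
    have ne: "axis 1 2 \<noteq> (axis 2 2 :: multi_index)" "axis 1 2 \<noteq> (axis 3 2 :: multi_index)" "axis 2 2 \<noteq> (axis 3 2 :: multi_index)"
      by (auto simp: axis_eq_axis)
    have "(norm (dsym 0 k))\<^sup>2 = 1" by (simp add: dsym_def)
    then have "(\<Sum>\<alpha>\<in>A. (norm (dsym \<alpha> k))\<^sup>2) = 1 + ((norm (dsym (axis 1 2) k))\<^sup>2 + ((norm (dsym (axis 2 2) k))\<^sup>2 + (norm (dsym (axis 3 2) k))\<^sup>2))"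
      unfolding A_def using 0[symmetric] ne by simp
    then show ?thesis using d[of 1] d[of 2] d[of 3] by simp
  qed
  also have "\<dots> \<le> 4 * (\<Sum>\<alpha> | deg \<alpha> \<le> 2. (norm (dsym \<alpha> k))\<^sup>2)"
    by (intro mult_left_mono sum_mono2 A finite_deg_le) auto
  finally show ?thesis .
qed

lemma h2_ennreal: "0 \<le> c \<Longrightarrow> (ennreal (wt k) * ennreal c)\<^sup>2 = ennreal ((wt k)\<^sup>2 * c\<^sup>2)"
  by (simp add: ennreal_power power_mult_distrib flip: ennreal_mult)

lemma sobolev_norm_2_power2:
  assumes "\<And>\<alpha>. deg \<alpha> \<le> k \<Longrightarrow> \<exists>g. is_weak_deriv \<alpha> (rep_L2_torus u) g"
  shows "(sobolev_norm k 2 u)\<^sup>2 = (\<Sum>\<alpha> | deg \<alpha> \<le> k. \<integral>\<^sup>+x. ennreal ((norm (weak_deriv \<alpha> u x))\<^sup>2) \<partial>torus)"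
  using assms by (simp add: sobolev_norm_def ennroot_2_power2)

lemma h2_norm_le_sobolev_norm: "h2_norm u \<le> 4 * (sobolev_norm 2 2 u)\<^sup>2"
proof (cases "\<forall>\<alpha>. deg \<alpha> \<le> 2 \<longrightarrow> (\<exists>g. is_weak_deriv \<alpha> (rep_L2_torus u) g)")
  case True
  have "h2_norm u = csum (\<lambda>k. ennreal ((wt k)\<^sup>2 * (norm (cf u k))\<^sup>2))"
    by (simp add: h2_def h2_ennreal)
  also have "\<dots> \<le> csum (\<lambda>k. 4 * (\<Sum>\<alpha> | deg \<alpha> \<le> 2. ennreal ((norm (dsym \<alpha> k))\<^sup>2 * (norm (cf u k))\<^sup>2)))"
  proof (rule nn_integral_mono)
    fix k
    have "(wt k)\<^sup>2 * (norm (cf u k))\<^sup>2 \<le> 4 * (\<Sum>\<alpha> | deg \<alpha> \<le> 2. (norm (dsym \<alpha> k))\<^sup>2) * (norm (cf u k))\<^sup>2"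
      by (intro mult_right_mono wt_power2_le) auto
    then have "ennreal ((wt k)\<^sup>2 * (norm (cf u k))\<^sup>2) \<le> ennreal (4 * (\<Sum>\<alpha> | deg \<alpha> \<le> 2. (norm (dsym \<alpha> k))\<^sup>2 * (norm (cf u k))\<^sup>2))"
      by (intro ennreal_leI) (simp only: sum_distrib_right mult.assoc)
    also have "ennreal (4 * (\<Sum>\<alpha> | deg \<alpha> \<le> 2. (norm (dsym \<alpha> k))\<^sup>2 * (norm (cf u k))\<^sup>2))
        = 4 * (\<Sum>\<alpha> | deg \<alpha> \<le> 2. ennreal ((norm (dsym \<alpha> k))\<^sup>2 * (norm (cf u k))\<^sup>2))"
      by (subst ennreal_mult) (simp_all add: sum_nonneg)
    finally show "ennreal ((wt k)\<^sup>2 * (norm (cf u k))\<^sup>2) \<le> 4 * (\<Sum>\<alpha> | deg \<alpha> \<le> 2. ennreal ((norm (dsym \<alpha> k))\<^sup>2 * (norm (cf u k))\<^sup>2))" .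
  qed
  also have "\<dots> = 4 * (\<Sum>\<alpha> | deg \<alpha> \<le> 2. csum (\<lambda>k. ennreal ((norm (dsym \<alpha> k))\<^sup>2 * (norm (cf u k))\<^sup>2)))"
    by (simp add: nn_integral_cmult nn_integral_sum del: sum_ennreal)
  also have "\<dots> \<le> 4 * (\<Sum>\<alpha> | deg \<alpha> \<le> 2. \<integral>\<^sup>+x. ennreal ((norm (weak_deriv \<alpha> u x))\<^sup>2) \<partial>torus)"
    using True by (intro mult_left_mono sum_mono weak_deriv_bessel is_weak_deriv_weak_deriv) auto
  also have "\<dots> = 4 * (sobolev_norm 2 2 u)\<^sup>2"
    using True by (simp add: sobolev_norm_2_power2)
  finally show ?thesis .
next
  case False
  then have "sobolev_norm 2 2 u = \<infinity>" by (auto simp: sobolev_norm_def)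
  then show ?thesis by (simp add: power2_eq_square ennreal_mult_top)
qed

text \<open>The constant is the square of 64, the factor by which \<open>norm_dsym_power2_le\<close>
  loses for every derivative.\<close>

lemma csum_dsym_le_h2_norm:
  assumes "deg \<alpha> \<le> 2"
  shows "csum (\<lambda>k. ennreal ((norm (dsym \<alpha> k))\<^sup>2 * (norm (cf u k))\<^sup>2)) \<le> 4096 * h2_norm u"
proof -
  have "csum (\<lambda>k. ennreal ((norm (dsym \<alpha> k))\<^sup>2 * (norm (cf u k))\<^sup>2)) \<le> csum (\<lambda>k. 4096 * ennreal ((wt k)\<^sup>2 * (norm (cf u k))\<^sup>2))"
  proof (rule nn_integral_mono)
    fix k
    have "(norm (dsym \<alpha> k))\<^sup>2 * (norm (cf u k))\<^sup>2 \<le> (64 * wt k)\<^sup>2 * (norm (cf u k))\<^sup>2"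
      by (intro mult_right_mono norm_dsym_power2_le assms) simp
    also have "\<dots> = 4096 * ((wt k)\<^sup>2 * (norm (cf u k))\<^sup>2)" by (simp add: power_mult_distrib)
    finally show "ennreal ((norm (dsym \<alpha> k))\<^sup>2 * (norm (cf u k))\<^sup>2) \<le> 4096 * ennreal ((wt k)\<^sup>2 * (norm (cf u k))\<^sup>2)"
      using ennreal_leI by (fastforce simp: ennreal_mult)
  qed
  also have "\<dots> = 4096 * h2_norm u"
    by (simp add: nn_integral_cmult h2_def h2_ennreal)
  finally show ?thesis .
qed

lemma sobolev_weak_derivs:
  assumes fin: "h2_norm u < \<infinity>" and \<alpha>: "deg \<alpha> \<le> 2"
  shows "is_weak_deriv \<alpha> (rep_L2_torus u) (weak_deriv \<alpha> u)" and "sq_integrable (weak_deriv \<alpha> u)"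
    and "(\<integral>\<^sup>+x. ennreal ((norm (weak_deriv \<alpha> u x))\<^sup>2) \<partial>torus) \<le> 4096 * h2_norm u"
proof -
  have fin': "csum (\<lambda>k. ennreal ((norm (dsym \<alpha> k))\<^sup>2 * (norm (cf u k))\<^sup>2)) < \<infinity>"
    by (rule order.strict_trans1[OF csum_dsym_le_h2_norm[OF \<alpha>]])
      (use fin in \<open>simp add: ennreal_mult_less_top\<close>)
  show wd: "is_weak_deriv \<alpha> (rep_L2_torus u) (weak_deriv \<alpha> u)"
    using exists_weak_deriv[OF sq_integrable_rep fin'] by (intro is_weak_deriv_weak_deriv) blast
  show sq: "sq_integrable (weak_deriv \<alpha> u)"
    by (rule weak_deriv_sq_integrable[OF wd sq_integrable_rep fin'])
  have "(\<integral>\<^sup>+x. ennreal ((norm (weak_deriv \<alpha> u x))\<^sup>2) \<partial>torus) = csum (\<lambda>k. ennreal ((norm (dsym \<alpha> k))\<^sup>2 * (norm (cf u k))\<^sup>2))"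
    unfolding vfco_parseval[OF sq, symmetric] norm_vfco_weak_deriv[OF wd] power_mult_distrib ..
  also have "\<dots> \<le> 4096 * h2_norm u" by (rule csum_dsym_le_h2_norm[OF \<alpha>])
  finally show "(\<integral>\<^sup>+x. ennreal ((norm (weak_deriv \<alpha> u x))\<^sup>2) \<partial>torus) \<le> 4096 * h2_norm u" .
qed

definition num_idx :: nat where
  "num_idx = card {\<alpha>. deg \<alpha> \<le> 2}"

lemma num_idx_pos: "num_idx > 0"
proof -
  have "(0::multi_index) \<in> {\<alpha>. deg \<alpha> \<le> 2}" by (simp add: deg_def)
  then show ?thesis unfolding num_idx_def using finite_deg_le[of 2] by (auto simp: card_gt_0_iff)
qed

lemma sum_deg_le:
  fixes c :: ennreal
  assumes "m \<le> 2" "\<And>\<alpha>. deg \<alpha> \<le> 2 \<Longrightarrow> deg \<alpha> \<le> m \<Longrightarrow> h \<alpha> \<le> c"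
  shows "(\<Sum>\<alpha> | deg \<alpha> \<le> m. h \<alpha>) \<le> of_nat num_idx * c"
proof -
  have "(\<Sum>\<alpha> | deg \<alpha> \<le> m. h \<alpha>) \<le> (\<Sum>\<alpha> | deg \<alpha> \<le> m. c)"
    using assms by (intro sum_mono) auto
  also have "\<dots> \<le> (\<Sum>\<alpha> | deg \<alpha> \<le> 2. c)"
    using assms(1) by (intro sum_mono2 finite_deg_le) auto
  finally show ?thesis by (simp add: num_idx_def)
qed

lemma sobolev_norm_le_h2_norm:
  assumes "m \<le> 2"
  shows "(sobolev_norm m 2 u)\<^sup>2 \<le> of_nat (4096 * num_idx) * h2_norm u"
proof (cases "h2_norm u < \<infinity>")
  case True
  have "(sobolev_norm m 2 u)\<^sup>2 = (\<Sum>\<alpha> | deg \<alpha> \<le> m. \<integral>\<^sup>+x. ennreal ((norm (weak_deriv \<alpha> u x))\<^sup>2) \<partial>torus)"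
    using sobolev_weak_derivs(1)[OF True] assms by (intro sobolev_norm_2_power2) (meson order_trans)
  also have "\<dots> \<le> of_nat num_idx * (4096 * h2_norm u)"
    by (intro sum_deg_le assms sobolev_weak_derivs(3) True)
  finally show ?thesis by (simp add: ac_simps)
next
  case False
  then show ?thesis using num_idx_pos by (simp add: not_less top_unique ennreal_mult_top)
qed

text \<open>The L^4 norm of a trigonometric polynomial is governed by the L^2 norm of its square,
  whose coefficients are dominated by a self-convolution; then \<open>csum_conv_power2_le\<close>.
  Working first with partial sums ensures that the square is square integrable, and Fatou removes
  the truncation.\<close>

lemma integral_norm4_le:
  assumes f: "sqi f"
  shows "(\<integral>\<^sup>+x. ennreal ((norm (f x)) ^ 4) \<partial>torus) \<le> 2 * wt_sum * (csum (\<lambda>k. ennreal (wt k) * (ennreal (norm (fco f k)))\<^sup>2))\<^sup>2"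
proof -
  obtain r where r: "AE x in torus. (\<lambda>n. tpoly (fbox (r n)) (fco f) x) \<longlonglongrightarrow> f x"
    using fco_AE_subsequence[OF f] by blast
  show ?thesis
  proof (rule nn_integral_le_of_AE_tendsto)
    show "AE x in torus. (\<lambda>n. ennreal ((norm (tpoly (fbox (r n)) (fco f) x)) ^ 4)) \<longlonglongrightarrow> ennreal ((norm (f x)) ^ 4)"
      using r by eventually_elim (auto intro!: tendsto_intros)
    show "(\<lambda>x. ennreal ((norm (tpoly (fbox (r n)) (fco f) x)) ^ 4)) \<in> borel_measurable torus" for n
      using sqi_measurable[OF sqi_tpoly] by measurable
    have "(\<integral>\<^sup>+x. ennreal ((norm (tpoly (fbox n) (fco f) x)) ^ 4) \<partial>torus)
      \<le> 2 * wt_sum * (csum (\<lambda>k. ennreal (wt k) * (ennreal (norm (fco f k)))\<^sup>2))\<^sup>2" for n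
    proof -
      let ?p = "tpoly (fbox n) (fco f)"
      let ?F = "\<lambda>k. ennreal (norm (fco ?p k))"
      have p: "sqi ?p" by (rule sqi_tpoly)
      have "norm (?p x) \<le> (\<Sum>k\<in>fbox n. norm (fco f k))" for x
        unfolding tpoly_def by (rule order_trans[OF norm_sum]) (simp add: norm_mult)
      then have pp: "sqi (\<lambda>x. ?p x * ?p x)"
        by (intro sqi_mult_bounded p sqi_measurable)
      have "(\<integral>\<^sup>+x. ennreal ((norm (?p x)) ^ 4) \<partial>torus) = (\<integral>\<^sup>+x. ennreal ((norm (?p x * ?p x))\<^sup>2) \<partial>torus)"
        by (simp add: norm_mult power2_eq_square power4_eq_xxxx ac_simps)
      also have "\<dots> = csum (\<lambda>k. ennreal ((norm (fco (\<lambda>x. ?p x * ?p x) k))\<^sup>2))"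
        by (rule parseval[OF pp, symmetric])
      also have "\<dots> \<le> csum (\<lambda>k. (conv ?F ?F k)\<^sup>2)"
      proof (rule nn_integral_mono)
        fix k
        show "ennreal ((norm (fco (\<lambda>x. ?p x * ?p x) k))\<^sup>2) \<le> (conv ?F ?F k)\<^sup>2"
          unfolding conv_def using power_mono[OF fco_mult_le[OF p p, of k], of 2] by (simp add: ennreal_power)
      qed
      also have "\<dots> \<le> 2 * wt_sum * (csum (\<lambda>k. ennreal (wt k) * (?F k)\<^sup>2))\<^sup>2"
        by (rule csum_conv_power2_le)
      also have "\<dots> \<le> 2 * wt_sum * (csum (\<lambda>k. ennreal (wt k) * (ennreal (norm (fco f k)))\<^sup>2))\<^sup>2"
        by (intro mult_left_mono power_mono nn_integral_mono) (auto simp: fco_tpoly)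
      finally show ?thesis .
    qed
    then show "eventually (\<lambda>n. (\<integral>\<^sup>+x. ennreal ((norm (tpoly (fbox (r n)) (fco f) x)) ^ 4) \<partial>torus)
      \<le> 2 * wt_sum * (csum (\<lambda>k. ennreal (wt k) * (ennreal (norm (fco f k)))\<^sup>2))\<^sup>2) sequentially"
      by simp
  qed
qed

lemma norm4_vec_le: "(norm v) ^ 4 \<le> 3 * (\<Sum>i\<in>UNIV. \<bar>v $ i\<bar> ^ 4)" for v :: "real^3"
proof -
  have "(norm v)\<^sup>2 = (v $ 1)\<^sup>2 + (v $ 2)\<^sup>2 + (v $ 3)\<^sup>2"
    by (simp add: norm_vec_def L2_set_def sum_3)
  then have "(norm v) ^ 4 = ((v $ 1)\<^sup>2 + (v $ 2)\<^sup>2 + (v $ 3)\<^sup>2)\<^sup>2"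
    by (metis power_mult mult_2 numeral_Bit0)
  also have "\<dots> \<le> 3 * (((v $ 1)\<^sup>2)\<^sup>2 + ((v $ 2)\<^sup>2)\<^sup>2 + ((v $ 3)\<^sup>2)\<^sup>2)"
    using zero_le_power2[of "(v $ 1)\<^sup>2 - (v $ 2)\<^sup>2"] zero_le_power2[of "(v $ 1)\<^sup>2 - (v $ 3)\<^sup>2"]
      zero_le_power2[of "(v $ 2)\<^sup>2 - (v $ 3)\<^sup>2"] by (simp add: power2_eq_square algebra_simps)
  also have "\<dots> = 3 * (\<Sum>i\<in>UNIV. \<bar>v $ i\<bar> ^ 4)"
    by (simp add: sum_3)
  finally show ?thesis .
qed

text \<open>The growth condition on the noise contains the squared W^{1,4} norm, so this bound keeps
  the noise under control where \<open>h2_norm\<close> is bounded.\<close>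

lemma sobolev_1_4_le_h2_norm:
  "\<exists>K>0. \<forall>u. (sobolev_norm 1 4 u)\<^sup>2 \<le> ennreal K * h2_norm u"
proof -
  define A where "A = enn2real wt_sum"
  have A: "wt_sum = ennreal A" "0 \<le> A"
    using wt_sum_finite by (simp_all add: A_def)
  \<comment> \<open>A factor 3 from \<open>norm4_vec_le\<close> and three components make 9; the
    bracket is the constant of \<open>integral_norm4_le\<close> with the symbol bound 64 squared.
    The added 1 only secures positivity.\<close>
  define K2 where "K2 = real num_idx * (9 * (2 * A * 64\<^sup>2)) + 1"
  have K2: "K2 > 0" using A(2) by (simp add: K2_def add_nonneg_pos)
  have "(sobolev_norm 1 4 u)\<^sup>2 \<le> ennreal (sqrt K2) * h2_norm u" for u
  proof (cases "h2_norm u < \<infinity>")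
    case True
    then obtain h where h: "h2_norm u = ennreal h" "0 \<le> h" by (auto simp: less_top_ennreal)
    have S: "(\<integral>\<^sup>+x. ennreal (norm (weak_deriv \<alpha> u x) powr 4) \<partial>torus) \<le> ennreal (9 * (2 * A * 64\<^sup>2) * h\<^sup>2)"
      if \<alpha>: "deg \<alpha> \<le> 2" "deg \<alpha> \<le> 1" for \<alpha>
    proof -
      let ?g = "weak_deriv \<alpha> u"
      note wd = sobolev_weak_derivs(1,2)[OF True \<alpha>(1)]
      have [measurable]: "?g \<in> borel_measurable torus" using wd(2) by (simp add: sq_integrable_def)
      have i: "(\<integral>\<^sup>+x. ennreal (\<bar>?g x $ i\<bar> ^ 4) \<partial>torus) \<le> ennreal (2 * A * (64 * h)\<^sup>2)" for i
      proof -
        let ?f = "\<lambda>x. complex_of_real (?g x $ i)"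
        have "(\<integral>\<^sup>+x. ennreal (\<bar>?g x $ i\<bar> ^ 4) \<partial>torus) = (\<integral>\<^sup>+x. ennreal ((norm (?f x)) ^ 4) \<partial>torus)"
          by simp
        also have "\<dots> \<le> 2 * wt_sum * (csum (\<lambda>k. ennreal (wt k) * (ennreal (norm (fco ?f k)))\<^sup>2))\<^sup>2"
          by (rule integral_norm4_le[OF sq_integrable_component[OF wd(2)]])
        also have "\<dots> \<le> 2 * wt_sum * (ennreal (64 * h))\<^sup>2"
        proof (intro mult_left_mono power_mono)
          have "csum (\<lambda>k. ennreal (wt k) * (ennreal (norm (fco ?f k)))\<^sup>2) \<le> csum (\<lambda>k. 64 * ennreal ((wt k)\<^sup>2 * (norm (cf u k))\<^sup>2))"
        proof (rule nn_integral_mono)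
          fix k
          have "norm (fco ?f k) \<le> norm (vfco ?g k)"
            using Finite_Cartesian_Product.norm_nth_le[of "vfco ?g k" i] by (simp add: vfco_def)
          also have "\<dots> = norm (dsym \<alpha> k) * norm (cf u k)" by (rule norm_vfco_weak_deriv[OF wd(1)])
          finally have "(norm (fco ?f k))\<^sup>2 \<le> (norm (dsym \<alpha> k) * norm (cf u k))\<^sup>2"
            by (rule power_mono) simp
          also have "\<dots> \<le> (64 * wt k) * (norm (cf u k))\<^sup>2"
            using norm_dsym_power2_le[OF \<alpha>(2), of k] by (simp add: power_mult_distrib mult_right_mono)
          finally have "wt k * (norm (fco ?f k))\<^sup>2 \<le> wt k * ((64 * wt k) * (norm (cf u k))\<^sup>2)"
            by (rule mult_left_mono) simp
          then have "ennreal (wt k * (norm (fco ?f k))\<^sup>2) \<le> ennreal (64 * ((wt k)\<^sup>2 * (norm (cf u k))\<^sup>2))"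
            by (intro ennreal_leI) (simp add: power2_eq_square ac_simps)
          then show "ennreal (wt k) * (ennreal (norm (fco ?f k)))\<^sup>2 \<le> 64 * ennreal ((wt k)\<^sup>2 * (norm (cf u k))\<^sup>2)"
            by (simp add: ennreal_mult ennreal_power)
        qed
        also have "csum (\<lambda>k. 64 * ennreal ((wt k)\<^sup>2 * (norm (cf u k))\<^sup>2)) = ennreal (64 * h)"
          using h by (simp add: nn_integral_cmult ennreal_mult h2_def h2_ennreal)
        finally show "csum (\<lambda>k. ennreal (wt k) * (ennreal (norm (fco ?f k)))\<^sup>2) \<le> ennreal (64 * h)" .
        qed auto
        also have "\<dots> = ennreal (2 * A * (64 * h)\<^sup>2)"
        proof -
          have "ennreal (2 * A * H\<^sup>2) = ennreal 2 * ennreal A * (ennreal H)\<^sup>2" if "0 \<le> H" for H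
            using A(2) that by (simp only: ennreal_mult ennreal_power mult_nonneg_nonneg zero_le_power2 zero_le_numeral)
          from this[of "64 * h"] h(2) show ?thesis by (simp only: A(1) ennreal_numeral mult_nonneg_nonneg zero_le_numeral)
        qed
        finally show ?thesis .
      qed
      have "(\<integral>\<^sup>+x. ennreal (norm (?g x) powr 4) \<partial>torus) \<le> (\<integral>\<^sup>+x. 3 * (\<Sum>i\<in>UNIV. ennreal (\<bar>?g x $ i\<bar> ^ 4)) \<partial>torus)"
      proof (rule nn_integral_mono)
        fix x
        have "ennreal (norm (?g x) powr 4) \<le> ennreal (3 * (\<Sum>i\<in>UNIV. \<bar>?g x $ i\<bar> ^ 4))"
          using norm4_vec_le[of "?g x"] by (intro ennreal_leI) simp
        then show "ennreal (norm (?g x) powr 4) \<le> 3 * (\<Sum>i\<in>UNIV. ennreal (\<bar>?g x $ i\<bar> ^ 4))"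
          by (simp add: ennreal_mult sum_nonneg sum_ennreal)
      qed
      also have "\<dots> = 3 * (\<Sum>i\<in>UNIV. \<integral>\<^sup>+x. ennreal (\<bar>?g x $ i\<bar> ^ 4) \<partial>torus)"
        by (subst nn_integral_cmult) (auto simp: nn_integral_sum simp del: sum_ennreal)
      also have "\<dots> \<le> 3 * (\<Sum>i\<in>(UNIV::3 set). ennreal (2 * A * (64 * h)\<^sup>2))"
        by (intro mult_left_mono sum_mono i) auto
      also have "\<dots> = ennreal (9 * (2 * A * 64\<^sup>2) * h\<^sup>2)"
      proof -
        define X where "X = 2 * A * (64 * h)\<^sup>2"
        have "3 * (\<Sum>i\<in>(UNIV::3 set). ennreal X) = ennreal 9 * ennreal X"
          by (simp add: mult.assoc[symmetric])
        also have "\<dots> = ennreal (9 * X)"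
          using A(2) by (subst ennreal_mult) (auto simp: X_def)
        also have "9 * X = 9 * (2 * A * 64\<^sup>2) * h\<^sup>2"
          by (simp add: X_def power_mult_distrib)
        finally show ?thesis by (simp only: X_def)
      qed
      finally show ?thesis .
    qed
    have ex: "\<forall>\<alpha>. deg \<alpha> \<le> 1 \<longrightarrow> (\<exists>g. is_weak_deriv \<alpha> (rep_L2_torus u) g)"
      using sobolev_weak_derivs(1)[OF True] by (meson le_trans one_le_numeral)
    let ?S = "\<Sum>\<alpha> | deg \<alpha> \<le> 1. \<integral>\<^sup>+x. ennreal (norm (weak_deriv \<alpha> u x) powr 4) \<partial>torus"
    have "?S \<le> of_nat num_idx * ennreal (9 * (2 * A * 64\<^sup>2) * h\<^sup>2)"
      by (rule sum_deg_le) (use S in auto)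
    also have "\<dots> = ennreal (real num_idx * (9 * (2 * A * 64\<^sup>2) * h\<^sup>2))"
      using A(2) by (subst ennreal_mult) (auto simp: ennreal_of_nat_eq_real_of_nat)
    also have "\<dots> \<le> ennreal (K2 * h\<^sup>2)"
      by (intro ennreal_leI) (simp add: K2_def algebra_simps)
    finally have S_le: "?S \<le> ennreal (K2 * h\<^sup>2)" .
    then obtain s where s: "?S = ennreal s" "0 \<le> s" "s \<le> K2 * h\<^sup>2"
      using K2 by (cases ?S) (auto simp: top_unique)
    have "(sobolev_norm 1 4 u)\<^sup>2 = ennreal ((s powr (1/4))\<^sup>2)"
      unfolding sobolev_norm_def if_P[OF ex] s(1) using s(2) by (simp add: ennroot_def ennreal_power)
    also have "(s powr (1/4))\<^sup>2 = sqrt s"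
      using s(2) by (simp add: power2_eq_square powr_half_sqrt flip: powr_add)
    also have "ennreal (sqrt s) \<le> ennreal (sqrt (K2 * h\<^sup>2))"
      by (intro ennreal_leI real_sqrt_le_mono s)
    also have "\<dots> = ennreal (sqrt K2) * h2_norm u"
      using h K2 by (simp add: real_sqrt_mult ennreal_mult)
    finally show ?thesis .
  next
    case False
    then show ?thesis using K2 by (simp add: not_less top_unique ennreal_mult_top)
  qed
  then show ?thesis using K2 by (intro exI[of _ "sqrt K2"]) auto
qed

section \<open>The Euler equation tested with plane waves\<close>

definition tfield :: "real^3 \<Rightarrow> int^3 \<Rightarrow> complex \<Rightarrow> real^3 \<Rightarrow> real^3" where
  "tfield a k z x = trig k z x *\<^sub>R a"

lemma trig_bound: "\<bar>trig k z x\<bar> \<le> norm z"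
  using abs_Re_le_cmod[of "z * chr k x"] by (simp add: trig_def norm_mult)

lemma continuous_on_trig: "continuous_on S (trig k z)"
  by (rule periodic_smooth_continuous[OF periodic_smooth_trig])

lemma sq_integrable_tfield: "sq_integrable (tfield a k z)"
proof -
  have c: "continuous_on UNIV (tfield a k z)"
    unfolding tfield_def by (intro continuous_intros continuous_on_trig)
  then show ?thesis
    unfolding sq_integrable_def
    by (intro conjI continuous_measurable_torus integrable_torus_continuous continuous_intros)
qed

lemma rep_tfield: "AE x in torus. rep_L2_torus (abs_L2_torus (tfield a k z)) x = tfield a k z x"
  using rep_abs[OF sq_integrable_tfield] by (simp add: ae_eq_def)

lemma vfco_tfield: "vfco (tfield a k z) l $ i = of_real (a $ i) * fco (\<lambda>x. complex_of_real (trig k z x)) l"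
proof -
  have "fco (\<lambda>x. complex_of_real (tfield a k z x $ i)) l = (\<integral>x. of_real (a $ i) * (complex_of_real (trig k z x) * chr l x) \<partial>torus)"
    unfolding fco_def by (intro Bochner_Integration.integral_cong refl) (simp add: tfield_def)
  also have "\<dots> = of_real (a $ i) * fco (\<lambda>x. complex_of_real (trig k z x)) l"
    by (simp only: integral_mult_right_zero fco_def)
  finally show ?thesis by (simp add: vfco_def)
qed

lemma vfco_tfield_freq: "vfco (tfield a k (freq j k * z)) l $ i = - freq j l * vfco (tfield a k z) l $ i"
  using fco_partial[OF periodic_smooth_trig, of j k z l]
  by (simp add: vfco_tfield partial_trig)

lemma fco_trig_eq_0:
  assumes "l \<noteq> k" "l \<noteq> - k"
  shows "fco (\<lambda>x. complex_of_real (trig k z x)) l = 0"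
proof -
  have eq: "complex_of_real (trig k z x) = (z / 2) * chr k x + (cnj z / 2) * chr (- k) x" for x
  proof -
    have "complex_of_real (trig k z x) = (z * chr k x + cnj (z * chr k x)) / 2"
      by (simp add: trig_def complex_add_cnj del: complex_cnj_mult)
    then show ?thesis by (simp add: cnj_chr add_divide_distrib)
  qed
  have "fco (\<lambda>x. complex_of_real (trig k z x)) l = (\<integral>x. (z / 2) * (chr k x * chr l x) + (cnj z / 2) * (chr (- k) x * chr l x) \<partial>torus)"
    unfolding fco_def eq by (intro Bochner_Integration.integral_cong refl) (simp only: distrib_right mult.assoc)
  also have "\<dots> = (z / 2) * fco (chr k) l + (cnj z / 2) * fco (chr (- k)) l"
    unfolding fco_def using sqi_integrable_mult[OF sqi_chr sqi_chr]
    by (subst Bochner_Integration.integral_add) (auto simp del: times_divide_eq_left)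
  also have "\<dots> = 0" using assms by (simp add: fco_chr)
  finally show ?thesis .
qed

text \<open>Only the frequencies \<open>k\<close> and \<open>- k\<close> occur. Finiteness gives
  access to \<open>sobolev_weak_derivs\<close> for plane waves.\<close>

lemma h2_norm_tfield: "h2_norm (abs_L2_torus (tfield a k z)) < \<infinity>"
proof -
  have "vfco (tfield a k z) l = 0" if "l \<noteq> k" "l \<noteq> - k" for l
    using fco_trig_eq_0[OF that] by (simp add: vec_eq_iff vfco_tfield)
  then have "h2_norm (abs_L2_torus (tfield a k z))
      = (\<Sum>l\<in>{k, - k}. (ennreal (wt l) * ennreal (norm (vfco (tfield a k z) l)))\<^sup>2)"
    unfolding h2_def vfco_rep_abs[OF sq_integrable_tfield]
    by (intro nn_integral_count_space') auto
  also have "\<dots> < \<infinity>" unfolding h2_ennreal[OF norm_ge_zero] by simp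
  finally show ?thesis .
qed

lemma deg_axis [simp]: "deg (axis j n) = n"
  by (simp add: deg_def axis_def)

lemma dsym_axis: "dsym (axis j (Suc 0)) k = freq j k"
  using exhaust_3[of j] by (auto simp: dsym_def axis_def)

lemma is_weak_deriv_measurable: "is_weak_deriv \<alpha> f g \<Longrightarrow> g \<in> borel_measurable torus"
  unfolding is_weak_deriv_def by auto

lemma tfield_measurable: "tfield a k z \<in> borel_measurable torus"
  using sq_integrable_tfield by (simp add: sq_integrable_def)

lemma rep_measurable: "rep_L2_torus u \<in> borel_measurable torus"
  using sq_integrable_rep by (simp add: sq_integrable_def)

text \<open>The derivative chosen by \<open>SOME\<close> is identified with the classical one
  through its coefficients.\<close>

lemma weak_partial_tfield:
  "AE x in torus. weak_partial j (abs_L2_torus (tfield a k z)) x = tfield a k (freq j k * z) x"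
proof (rule vfco_eq_imp_AE_eq)
  have wd: "is_weak_deriv (axis j 1) (rep_L2_torus (abs_L2_torus (tfield a k z))) (weak_partial j (abs_L2_torus (tfield a k z)))"
    by (rule sobolev_weak_derivs(1)[OF h2_norm_tfield]) simp
  then show "integrable torus (weak_partial j (abs_L2_torus (tfield a k z)))"
    by (simp add: is_weak_deriv_def)
  show "integrable torus (tfield a k (freq j k * z))"
    by (intro sq_integrable_integrable sq_integrable_tfield)
  show "vfco (weak_partial j (abs_L2_torus (tfield a k z))) = vfco (tfield a k (freq j k * z))"
    using vfco_weak_deriv[OF wd]
    by (simp add: fun_eq_iff vec_eq_iff vfco_tfield_freq vfco_rep_abs[OF sq_integrable_tfield] dsym_axis freq_minus)
qed

lemma tfield_sobolev_div:
  assumes "(\<Sum>i\<in>UNIV. a $ i * of_int (k $ i)) = 0"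
  shows "abs_L2_torus (tfield a k z) \<in> sobolev_div 1"
proof -
  let ?u = "abs_L2_torus (tfield a k z)"
  have "(sobolev_norm 1 2 ?u)\<^sup>2 < \<infinity>"
    by (rule order.strict_trans1[OF sobolev_norm_le_h2_norm])
      (use h2_norm_tfield[of a k z] in \<open>auto simp: ennreal_mult_less_top of_nat_less_top\<close>)
  then have "sobolev_norm 1 2 ?u < \<infinity>"
    by (cases "sobolev_norm 1 2 ?u") (auto simp: power2_eq_square)
  moreover have "div_free ?u"
    unfolding div_free_def
  proof (intro allI impI)
    fix \<phi> assume \<phi>: "periodic_smooth \<phi>"
    note p = periodic_smooth_partial[OF \<phi>]
    have [measurable]: "partial i \<phi> \<in> borel_measurable torus" for i
      by (rule periodic_smooth_measurable[OF p])
    have [measurable]: "rep_L2_torus ?u \<in> borel_measurable torus" "tfield a k z \<in> borel_measurable torus"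
      using sq_integrable_rep sq_integrable_tfield by (auto simp: sq_integrable_def)
    have "(\<integral>x. (\<Sum>i\<in>UNIV. rep_L2_torus ?u x $ i * partial i \<phi> x) \<partial>torus)
        = (\<integral>x. (\<Sum>i\<in>UNIV. tfield a k z x $ i * partial i \<phi> x) \<partial>torus)"
      using rep_tfield[of a k z] by (intro integral_cong_AE) (measurable, auto)
    also have "\<dots> = (\<integral>x. (\<Sum>i\<in>UNIV. a $ i * (partial i \<phi> x * trig k z x)) \<partial>torus)"
      by (intro Bochner_Integration.integral_cong sum.cong refl) (simp add: tfield_def)
    also have "\<dots> = (\<Sum>i\<in>UNIV. a $ i * (\<integral>x. partial i \<phi> x * trig k z x \<partial>torus))"
      by (subst Bochner_Integration.integral_sum)
        (auto intro!: integrable_torus_continuous continuous_intros continuous_on_trig periodic_smooth_continuous[OF p])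
    also have "\<dots> = (\<Sum>i\<in>UNIV. a $ i * Re (z * (- freq i k * fco (\<lambda>x. complex_of_real (\<phi> x)) k)))"
      unfolding Re_mult_fco[OF periodic_smooth_integrable[OF p], symmetric] fco_partial[OF \<phi>] ..
    also have "\<dots> = (\<Sum>i\<in>UNIV. a $ i * of_int (k $ i)) * Re (z * (- (2 * pi * \<i>) * fco (\<lambda>x. complex_of_real (\<phi> x)) k))"
      unfolding sum_distrib_right by (intro sum.cong refl) (simp add: freq_def algebra_simps)
    finally show "(\<integral>x. (\<Sum>i\<in>UNIV. rep_L2_torus ?u x $ i * partial i \<phi> x) \<partial>torus) = 0"
      using assms by simp
  qed
  ultimately show ?thesis by (simp add: sobolev_div_def sobolev_def)
qed

lemma integral_inner_tfield:
  assumes "integrable torus f"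
  shows "(\<integral>x. f x \<bullet> tfield a k z x \<partial>torus) = Re (z * (\<Sum>i\<in>UNIV. of_real (a $ i) * vfco f k $ i))"
proof -
  have int: "integrable torus (\<lambda>x. f x $ i * trig k z x)" for i
    using integrable_mult_bounded[OF integrable_component[OF assms] periodic_smooth_measurable[OF periodic_smooth_trig], of k z "norm z" i]
    by (simp add: trig_bound mult.commute)
  have "(\<integral>x. f x \<bullet> tfield a k z x \<partial>torus) = (\<integral>x. (\<Sum>i\<in>UNIV. a $ i * (f x $ i * trig k z x)) \<partial>torus)"
    by (intro Bochner_Integration.integral_cong refl) (simp add: inner_vec_def tfield_def ac_simps)
  also have "\<dots> = (\<Sum>i\<in>UNIV. a $ i * (\<integral>x. f x $ i * trig k z x \<partial>torus))"
    using int by (subst Bochner_Integration.integral_sum) auto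
  also have "\<dots> = (\<Sum>i\<in>UNIV. a $ i * Re (z * vfco f k $ i))"
    unfolding vfco_def vec_lambda_beta Re_mult_fco[OF integrable_component[OF assms]] ..
  also have "\<dots> = Re (z * (\<Sum>i\<in>UNIV. of_real (a $ i) * vfco f k $ i))"
    unfolding sum_distrib_left Re_sum by (intro sum.cong refl) (simp add: algebra_simps)
  finally show ?thesis .
qed

lemma inner_abs_tfield: "u \<bullet> abs_L2_torus (tfield a k z) = Re (z * (\<Sum>i\<in>UNIV. of_real (a $ i) * cf u k $ i))"
proof -
  have [measurable]: "rep_L2_torus v \<in> borel_measurable torus" "tfield a k z \<in> borel_measurable torus" for v
    using sq_integrable_rep sq_integrable_tfield by (auto simp: sq_integrable_def)
  have "u \<bullet> abs_L2_torus (tfield a k z) = (\<integral>x. rep_L2_torus u x \<bullet> tfield a k z x \<partial>torus)"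
    unfolding inner_L2_torus_rep using rep_tfield[of a k z] by (intro integral_cong_AE) (measurable, auto)
  then show ?thesis
    by (simp only: integral_inner_tfield sq_integrable_integrable sq_integrable_rep)
qed

text \<open>The eigenvalue of minus the Laplacian at frequency \<open>k\<close>.\<close>

definition lam :: "int^3 \<Rightarrow> real" where
  "lam k = (\<Sum>j\<in>UNIV. (2 * pi * of_int (k $ j))\<^sup>2)"

lemma dirichlet_tfield:
  assumes wd: "\<And>j. is_weak_deriv (axis j 1) (rep_L2_torus u) (weak_partial j u)"
  shows "dirichlet u (abs_L2_torus (tfield a k z)) = lam k * (u \<bullet> abs_L2_torus (tfield a k z))"
proof -
  let ?\<phi> = "abs_L2_torus (tfield a k z)"
  let ?s = "\<Sum>i\<in>UNIV. of_real (a $ i) * cf u k $ i"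
  have wint: "integrable torus (weak_partial j u)" for j using wd by (simp add: is_weak_deriv_def)
  have wd\<phi>: "is_weak_deriv (axis j 1) (rep_L2_torus ?\<phi>) (weak_partial j ?\<phi>)" for j
    by (rule sobolev_weak_derivs(1)[OF h2_norm_tfield]) simp
  have [measurable]: "weak_partial j u \<in> borel_measurable torus" "weak_partial j ?\<phi> \<in> borel_measurable torus"
    "tfield a k z \<in> borel_measurable torus" for j z
    by (rule is_weak_deriv_measurable[OF wd] is_weak_deriv_measurable[OF wd\<phi>] tfield_measurable)+
  have ae: "AE x in torus. \<forall>j. weak_partial j ?\<phi> x = tfield a k (freq j k * z) x"
    using weak_partial_tfield by (intro AE_all_countable[THEN iffD2]) simp
  have int: "integrable torus (\<lambda>x. weak_partial j u x \<bullet> tfield a k z x)" for j z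
  proof (rule Bochner_Integration.integrable_bound)
    show "integrable torus (\<lambda>x. norm (weak_partial j u x) * (norm z * norm a))"
      using wint by simp
    show "AE x in torus. norm (weak_partial j u x \<bullet> tfield a k z x) \<le> norm (norm (weak_partial j u x) * (norm z * norm a))"
    proof (rule AE_I2)
      fix x
      have "norm (weak_partial j u x \<bullet> tfield a k z x) \<le> norm (weak_partial j u x) * norm (tfield a k z x)"
        by (simp add: Cauchy_Schwarz_ineq2)
      also have "\<dots> \<le> norm (weak_partial j u x) * (norm z * norm a)"
        unfolding tfield_def norm_scaleR by (intro mult_left_mono mult_right_mono) (auto simp: trig_bound)
      finally show "norm (weak_partial j u x \<bullet> tfield a k z x) \<le> norm (norm (weak_partial j u x) * (norm z * norm a))" by simp
    qed
  qed measurable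
  have "dirichlet u ?\<phi> = (\<integral>x. (\<Sum>j\<in>UNIV. weak_partial j u x \<bullet> tfield a k (freq j k * z) x) \<partial>torus)"
    unfolding dirichlet_def using ae by (intro integral_cong_AE) (measurable, auto)
  also have "\<dots> = (\<Sum>j\<in>UNIV. \<integral>x. weak_partial j u x \<bullet> tfield a k (freq j k * z) x \<partial>torus)"
    by (intro Bochner_Integration.integral_sum int)
  also have "\<dots> = (\<Sum>j\<in>UNIV. (2 * pi * of_int (k $ j))\<^sup>2 * Re (z * ?s))"
  proof (rule sum.cong[OF refl])
    fix j
    have v: "vfco (weak_partial j u) k $ i = - freq j k * cf u k $ i" for i
      using vfco_weak_deriv[OF wd] by (simp add: dsym_axis freq_minus)
    have f2: "freq j k * - freq j k = of_real ((2 * pi * of_int (k $ j))\<^sup>2)"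
      by (simp add: freq_def power2_eq_square)
    have "(\<integral>x. weak_partial j u x \<bullet> tfield a k (freq j k * z) x \<partial>torus)
        = Re (freq j k * z * (\<Sum>i\<in>UNIV. of_real (a $ i) * vfco (weak_partial j u) k $ i))"
      by (rule integral_inner_tfield[OF wint])
    also have "(\<Sum>i\<in>UNIV. of_real (a $ i) * vfco (weak_partial j u) k $ i) = - freq j k * ?s"
      unfolding v sum_distrib_left by (intro sum.cong refl) simp
    also have "freq j k * z * (- freq j k * ?s) = (freq j k * - freq j k) * (z * ?s)"
      by (simp only: ac_simps)
    finally show "(\<integral>x. weak_partial j u x \<bullet> tfield a k (freq j k * z) x \<partial>torus) = (2 * pi * of_int (k $ j))\<^sup>2 * Re (z * ?s)"
      unfolding f2 by simp
  qed
  finally show ?thesis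
    by (simp only: inner_abs_tfield lam_def sum_distrib_right)
qed

definition pco :: "L2_torus \<Rightarrow> L2_torus \<Rightarrow> 3 \<Rightarrow> 3 \<Rightarrow> int^3 \<Rightarrow> complex" where
  "pco u v i j k = fco (\<lambda>x. complex_of_real (rep_L2_torus u x $ i) * complex_of_real (rep_L2_torus v x $ j)) k"

lemma convection_tfield:
  "convection u v (abs_L2_torus (tfield a k z))
    = Re (z * (\<Sum>i\<in>UNIV. of_real (a $ i) * (\<Sum>j\<in>UNIV. freq j k * pco u v i j k)))"
proof -
  let ?\<phi> = "abs_L2_torus (tfield a k z)" and ?p = "\<lambda>i j x. rep_L2_torus u x $ i * rep_L2_torus v x $ j"
  have wd\<phi>: "is_weak_deriv (axis j 1) (rep_L2_torus ?\<phi>) (weak_partial j ?\<phi>)" for j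
    by (rule sobolev_weak_derivs(1)[OF h2_norm_tfield]) simp
  have [measurable]: "weak_partial j ?\<phi> \<in> borel_measurable torus" "rep_L2_torus u \<in> borel_measurable torus"
    "tfield a k z \<in> borel_measurable torus" for j z u
    by (rule is_weak_deriv_measurable[OF wd\<phi>] rep_measurable tfield_measurable)+
  have ae: "AE x in torus. \<forall>j. weak_partial j ?\<phi> x = tfield a k (freq j k * z) x"
    using weak_partial_tfield by (intro AE_all_countable[THEN iffD2]) simp
  have pint: "integrable torus (?p i j)" for i j
    using integrable_Re[OF sqi_integrable_mult[OF sq_integrable_component[OF sq_integrable_rep[of u], of i]
        sq_integrable_component[OF sq_integrable_rep[of v], of j]]] by simp
  have tint: "integrable torus (\<lambda>x. ?p i j x * trig k z x)" for i j z
    using integrable_mult_bounded[OF pint periodic_smooth_measurable[OF periodic_smooth_trig], of k z "norm z" i j]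
    by (simp add: trig_bound mult.commute mult.left_commute)
  have "convection u v ?\<phi> = (\<integral>x. (\<Sum>i\<in>UNIV. \<Sum>j\<in>UNIV. ?p i j x * tfield a k (freq j k * z) x $ i) \<partial>torus)"
    unfolding convection_def using ae by (intro integral_cong_AE) (measurable, auto)
  also have "\<dots> = (\<integral>x. (\<Sum>i\<in>UNIV. \<Sum>j\<in>UNIV. a $ i * (?p i j x * trig k (freq j k * z) x)) \<partial>torus)"
    by (intro Bochner_Integration.integral_cong sum.cong refl) (simp add: tfield_def)
  also have "\<dots> = (\<Sum>i\<in>UNIV. \<Sum>j\<in>UNIV. a $ i * (\<integral>x. ?p i j x * trig k (freq j k * z) x \<partial>torus))"
    using tint
    by (subst Bochner_Integration.integral_sum, force, intro sum.cong refl, subst Bochner_Integration.integral_sum) auto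
  also have "\<dots> = (\<Sum>i\<in>UNIV. \<Sum>j\<in>UNIV. a $ i * Re (freq j k * z * pco u v i j k))"
    by (simp only: pco_def of_real_mult[symmetric] Re_mult_fco[OF pint])
  also have "\<dots> = Re (z * (\<Sum>i\<in>UNIV. of_real (a $ i) * (\<Sum>j\<in>UNIV. freq j k * pco u v i j k)))"
    unfolding sum_distrib_left Re_sum by (intro sum.cong refl) (simp add: algebra_simps)
  finally show ?thesis .
qed

lemma div_free_cf:
  assumes "div_free u"
  shows "(\<Sum>i\<in>UNIV. of_int (k $ i) * cf u k $ i) = 0"
proof -
  have int: "integrable torus (\<lambda>x. rep_L2_torus u x $ i)" for i
    by (intro integrable_component sq_integrable_integrable sq_integrable_rep)
  have "(\<Sum>i\<in>UNIV. freq i k * cf u k $ i) = 0"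
    unfolding complex_eq_iff_Re_mult
  proof
    fix z
    have tint: "integrable torus (\<lambda>x. rep_L2_torus u x $ i * trig k (freq i k * z) x)" for i
      using integrable_mult_bounded[OF int periodic_smooth_measurable[OF periodic_smooth_trig], of k "freq i k * z" "norm (freq i k * z)" i]
      by (simp only: trig_bound real_norm_def mult.commute)
    have "0 = (\<integral>x. (\<Sum>i\<in>UNIV. rep_L2_torus u x $ i * partial i (trig k z) x) \<partial>torus)"
      by (rule assms[unfolded div_free_def, rule_format, OF periodic_smooth_trig, symmetric])
    also have "\<dots> = (\<Sum>i\<in>UNIV. \<integral>x. rep_L2_torus u x $ i * trig k (freq i k * z) x \<partial>torus)"
      unfolding partial_trig by (intro Bochner_Integration.integral_sum tint)
    also have "\<dots> = (\<Sum>i\<in>UNIV. Re (freq i k * z * cf u k $ i))"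
      unfolding vfco_def vec_lambda_beta Re_mult_fco[OF int] ..
    also have "\<dots> = Re (z * (\<Sum>i\<in>UNIV. freq i k * cf u k $ i))"
      unfolding sum_distrib_left Re_sum by (simp only: ac_simps)
    finally show "Re (z * (\<Sum>i\<in>UNIV. freq i k * cf u k $ i)) = Re (z * 0)" by simp
  qed
  also have "(\<Sum>i\<in>UNIV. freq i k * cf u k $ i) = (2 * pi * \<i>) * (\<Sum>i\<in>UNIV. of_int (k $ i) * cf u k $ i)"
    unfolding sum_distrib_left by (intro sum.cong refl) (simp add: freq_def)
  finally show ?thesis by simp
qed

lemma sobolev_1_weak_partial:
  assumes "u \<in> sobolev 1 2"
  shows "is_weak_deriv (axis j 1) (rep_L2_torus u) (weak_partial j u)"
proof (rule is_weak_deriv_weak_deriv)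
  have "\<forall>\<alpha>. deg \<alpha> \<le> 1 \<longrightarrow> (\<exists>g. is_weak_deriv \<alpha> (rep_L2_torus u) g)"
    using assms unfolding sobolev_def sobolev_norm_def by (auto split: if_splits)
  then show "\<exists>g. is_weak_deriv (axis j 1) (rep_L2_torus u) g" by simp
qed

text \<open>The equation is available for divergence-free test fields, that is, for real amplitudes
  orthogonal to \<open>k\<close>. Since \<open>w\<close> is divergence free, the real and imaginary
  parts of its coefficient are such amplitudes; so the equation can be paired with that coefficient
  itself, and neither pressure nor Leray projection appears.\<close>

lemma euler_step_cf:
  assumes w: "w \<in> sobolev_div 1"
    and eq: "\<And>\<phi>. \<phi> \<in> sobolev_div 1 \<Longrightarrow> w \<bullet> \<phi> - \<tau> * convection w v \<phi> = - \<mu> * \<tau> * dirichlet w \<phi> + v \<bullet> \<phi> + \<xi> \<bullet> \<phi>"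
  shows "of_real ((1 + \<mu> * \<tau> * lam k) * (norm (cf w k))\<^sup>2)
    = (\<Sum>i\<in>UNIV. cnj (cf w k $ i) * (cf v k $ i + cf \<xi> k $ i))
      + of_real \<tau> * (\<Sum>i\<in>UNIV. cnj (cf w k $ i) * (\<Sum>j\<in>UNIV. freq j k * pco w v i j k))"
proof -
  have ws: "w \<in> sobolev 1 2" "div_free w" using w by (auto simp: sobolev_div_def)
  define D where "D i = (\<Sum>j\<in>UNIV. freq j k * pco w v i j k)" for i
  \<comment> \<open>The residual of the equation at frequency \<open>k\<close>; it need not vanish,
    only its component orthogonal to \<open>k\<close> does.\<close>
  define L where "L i = of_real (1 + \<mu> * \<tau> * lam k) * cf w k $ i - (cf v k $ i + cf \<xi> k $ i)
      - of_real \<tau> * D i" for i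
  have L: "(\<Sum>i\<in>UNIV. of_real (a $ i) * L i) = 0" if a: "(\<Sum>i\<in>UNIV. a $ i * of_int (k $ i)) = 0" for a
    unfolding complex_eq_iff_Re_mult
  proof
    fix z
    let ?\<phi> = "abs_L2_torus (tfield a k z)"
    have "(1 + \<mu> * \<tau> * lam k) * (w \<bullet> ?\<phi>) - (v \<bullet> ?\<phi> + \<xi> \<bullet> ?\<phi>) - \<tau> * convection w v ?\<phi> = 0"
      using eq[OF tfield_sobolev_div[OF a, of z]] dirichlet_tfield[OF sobolev_1_weak_partial[OF ws(1)], of a k z]
      by (simp add: algebra_simps)
    moreover have "(\<Sum>i\<in>UNIV. of_real (a $ i) * L i) = of_real (1 + \<mu> * \<tau> * lam k) * (\<Sum>i\<in>UNIV. of_real (a $ i) * cf w k $ i)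
      - ((\<Sum>i\<in>UNIV. of_real (a $ i) * cf v k $ i) + (\<Sum>i\<in>UNIV. of_real (a $ i) * cf \<xi> k $ i))
      - of_real \<tau> * (\<Sum>i\<in>UNIV. of_real (a $ i) * D i)"
      unfolding sum_distrib_left[of "of_real _"] sum.distrib[symmetric] sum_subtractf[symmetric]
      by (intro sum.cong refl) (simp only: L_def right_diff_distrib distrib_left ac_simps)
    ultimately show "Re (z * (\<Sum>i\<in>UNIV. of_real (a $ i) * L i)) = Re (z * 0)"
      unfolding inner_abs_tfield convection_tfield D_def[symmetric]
      by (simp add: right_diff_distrib distrib_left mult.left_commute[of z])
  qed
  have k: "(\<Sum>i\<in>UNIV. of_int (k $ i) * cf w k $ i) = 0" by (rule div_free_cf[OF ws(2)])
  \<comment> \<open>Two real amplitudes, combined with the factor \<open>- \<i>\<close> into the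
    conjugate of the coefficient of \<open>w\<close>.\<close>
  define p q :: "real^3" where "p = (\<chi> i. Re (cf w k $ i))" and "q = (\<chi> i. Im (cf w k $ i))"
  have "(\<Sum>i\<in>UNIV. p $ i * of_int (k $ i)) = 0" "(\<Sum>i\<in>UNIV. q $ i * of_int (k $ i)) = 0"
    using k by (simp_all add: complex_eq_iff Re_sum Im_sum p_def q_def mult.commute)
  from L[OF this(1)] L[OF this(2)]
  have "(\<Sum>i\<in>UNIV. of_real (p $ i) * L i) - \<i> * (\<Sum>i\<in>UNIV. of_real (q $ i) * L i) = 0" by simp
  also have "(\<Sum>i\<in>UNIV. of_real (p $ i) * L i) - \<i> * (\<Sum>i\<in>UNIV. of_real (q $ i) * L i) = (\<Sum>i\<in>UNIV. cnj (cf w k $ i) * L i)"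
  proof -
    have "cnj (cf w k $ i) = of_real (p $ i) - \<i> * of_real (q $ i)" for i
      by (simp add: p_def q_def complex_eq_iff)
    then show ?thesis
      by (simp add: sum_distrib_left left_diff_distrib mult.assoc flip: sum_subtractf)
  qed
  finally have 0: "(\<Sum>i\<in>UNIV. cnj (cf w k $ i) * L i) = 0" .
  have norm: "of_real ((norm (cf w k))\<^sup>2) = (\<Sum>i\<in>UNIV. cnj (cf w k $ i) * cf w k $ i)"
    by (simp add: norm_vec_def L2_set_def sum_nonneg of_real_norm_power2 mult.commute del: of_real_power)
  have "(\<Sum>i\<in>UNIV. cnj (cf w k $ i) * L i) = of_real (1 + \<mu> * \<tau> * lam k) * (\<Sum>i\<in>UNIV. cnj (cf w k $ i) * cf w k $ i)
      - (\<Sum>i\<in>UNIV. cnj (cf w k $ i) * (cf v k $ i + cf \<xi> k $ i))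
      - of_real \<tau> * (\<Sum>i\<in>UNIV. cnj (cf w k $ i) * D i)"
    unfolding sum_distrib_left[of "of_real _"] sum_subtractf[symmetric]
    by (intro sum.cong refl) (simp only: L_def right_diff_distrib ac_simps)
  then show ?thesis unfolding 0 norm[symmetric] of_real_mult D_def[symmetric] by (simp only: diff_diff_eq right_minus_eq eq_commute[of 0])
qed

section \<open>The deterministic step\<close>

lemma lam_ge: "norm (freq j k) \<le> sqrt (lam k)"
proof (rule real_le_rsqrt)
  have "(norm (freq j k))\<^sup>2 = (2 * pi * of_int (k $ j))\<^sup>2" by (simp add: norm_freq power_mult_distrib)
  also have "\<dots> \<le> lam k" unfolding lam_def by (rule member_le_sum) auto
  finally show "(norm (freq j k))\<^sup>2 \<le> lam k" .
qed

lemma lam_nonneg: "0 \<le> lam k"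
  by (simp add: lam_def sum_nonneg)

text \<open>Supplies the uniform bound that \<open>h2_le_of_conv_ineq\<close> requires; it costs
  nothing beyond membership in L^2.\<close>

lemma norm_cf_bound: "(norm (cf w k))\<^sup>2 \<le> (norm w)\<^sup>2"
proof -
  have "ennreal ((norm (cf w k))\<^sup>2) \<le> csum (\<lambda>k. ennreal ((norm (cf w k))\<^sup>2))"
    by (rule nn_integral_ge_point) simp
  also have "\<dots> = (\<integral>\<^sup>+x. ennreal ((norm (rep_L2_torus w x))\<^sup>2) \<partial>torus)"
    by (rule vfco_parseval[OF sq_integrable_rep])
  also have "\<dots> = ennreal ((norm w)\<^sup>2)"
    using sq_integrable_rep[of w]
    by (simp add: sq_integrable_def nn_integral_eq_integral power2_norm_eq_inner inner_L2_torus_rep)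
  finally show ?thesis by simp
qed

lemma euler_step_pointwise:
  assumes w: "w \<in> sobolev_div 1" and \<tau>: "0 < \<tau>" and \<mu>: "0 < \<mu>"
    and eq: "\<And>\<phi>. \<phi> \<in> sobolev_div 1 \<Longrightarrow> w \<bullet> \<phi> - \<tau> * convection w v \<phi> = - \<mu> * \<tau> * dirichlet w \<phi> + v \<bullet> \<phi> + \<xi> \<bullet> \<phi>"
  shows "norm (cf w k) \<le> 3 * (norm (cf v k) + norm (cf \<xi> k)) + sqrt (\<tau> / \<mu>) * (\<Sum>i\<in>UNIV. \<Sum>j\<in>UNIV. norm (pco w v i j k))"
proof -
  let ?b = "norm (cf w k)" and ?g = "norm (cf v k) + norm (cf \<xi> k)" and ?D = "\<Sum>i\<in>UNIV. \<Sum>j\<in>UNIV. norm (pco w v i j k)"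
  let ?m = "1 + \<mu> * \<tau> * lam k"
  have comp: "norm (cf u k $ i) \<le> norm (cf u k)" for u i by (rule Finite_Cartesian_Product.norm_nth_le)
  have m: "1 \<le> ?m" using \<tau> \<mu> lam_nonneg[of k] by simp
  have D: "0 \<le> ?D" by (intro sum_nonneg) auto
  \<comment> \<open>The components are bounded one by one by the full vector norms; the three of
    them account for the factor 3.\<close>
  have 1: "norm (\<Sum>i\<in>UNIV. cnj (cf w k $ i) * (cf v k $ i + cf \<xi> k $ i)) \<le> ?b * (3 * ?g)"
  proof -
    have "norm (\<Sum>i\<in>UNIV. cnj (cf w k $ i) * (cf v k $ i + cf \<xi> k $ i)) \<le> (\<Sum>i\<in>(UNIV::3 set). ?b * ?g)"
    proof (intro sum_norm_le)
      fix i
      have "norm (cnj (cf w k $ i) * (cf v k $ i + cf \<xi> k $ i)) \<le> norm (cf w k $ i) * (norm (cf v k $ i) + norm (cf \<xi> k $ i))"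
        unfolding norm_mult complex_mod_cnj by (intro mult_left_mono norm_triangle_ineq) auto
      also have "\<dots> \<le> ?b * ?g" by (intro mult_mono add_mono comp) auto
      finally show "norm (cnj (cf w k $ i) * (cf v k $ i + cf \<xi> k $ i)) \<le> ?b * ?g" .
    qed
    then show ?thesis by (simp add: algebra_simps)
  qed
  have 2: "norm (\<Sum>i\<in>UNIV. cnj (cf w k $ i) * (\<Sum>j\<in>UNIV. freq j k * pco w v i j k)) \<le> ?b * (sqrt (lam k) * ?D)"
  proof -
    have "norm (\<Sum>i\<in>UNIV. cnj (cf w k $ i) * (\<Sum>j\<in>UNIV. freq j k * pco w v i j k))
      \<le> (\<Sum>i\<in>UNIV. ?b * (sqrt (lam k) * (\<Sum>j\<in>UNIV. norm (pco w v i j k))))"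
    proof (intro sum_norm_le)
      fix i
      have "norm (\<Sum>j\<in>UNIV. freq j k * pco w v i j k) \<le> (\<Sum>j\<in>UNIV. sqrt (lam k) * norm (pco w v i j k))"
        by (intro sum_norm_le) (simp add: norm_mult lam_ge mult_right_mono)
      then show "norm (cnj (cf w k $ i) * (\<Sum>j\<in>UNIV. freq j k * pco w v i j k)) \<le> ?b * (sqrt (lam k) * (\<Sum>j\<in>UNIV. norm (pco w v i j k)))"
        unfolding norm_mult complex_mod_cnj sum_distrib_left[symmetric] by (intro mult_mono comp) auto
    qed
    then show ?thesis by (simp add: sum_distrib_left)
  qed
  have "norm (complex_of_real (?m * ?b\<^sup>2)) \<le> ?b * (3 * ?g) + norm (complex_of_real \<tau>) * (?b * (sqrt (lam k) * ?D))"
  proof -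
    have "complex_of_real (?m * ?b\<^sup>2) = (\<Sum>i\<in>UNIV. cnj (cf w k $ i) * (cf v k $ i + cf \<xi> k $ i))
      + of_real \<tau> * (\<Sum>i\<in>UNIV. cnj (cf w k $ i) * (\<Sum>j\<in>UNIV. freq j k * pco w v i j k))"
      by (rule euler_step_cf[OF w]) (rule eq)
    also have "norm \<dots> \<le> norm (\<Sum>i\<in>UNIV. cnj (cf w k $ i) * (cf v k $ i + cf \<xi> k $ i))
      + norm (complex_of_real \<tau>) * norm (\<Sum>i\<in>UNIV. cnj (cf w k $ i) * (\<Sum>j\<in>UNIV. freq j k * pco w v i j k))"
      unfolding norm_mult[symmetric] by (rule norm_triangle_ineq)
    also have "\<dots> \<le> ?b * (3 * ?g) + norm (complex_of_real \<tau>) * (?b * (sqrt (lam k) * ?D))"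
      by (intro add_mono 1 mult_left_mono 2 norm_ge_zero)
    finally show ?thesis .
  qed
  moreover have "norm (complex_of_real (?m * ?b\<^sup>2)) = ?m * ?b\<^sup>2"
    using m by (simp only: norm_of_real abs_of_nonneg mult_nonneg_nonneg zero_le_power2 order_trans[OF zero_le_one])
  ultimately have ineq: "?b * (?m * ?b) \<le> ?b * (3 * ?g + \<tau> * sqrt (lam k) * ?D)"
    using \<tau> by (simp add: power2_eq_square algebra_simps)
  have s: "\<tau> * sqrt (lam k) \<le> sqrt (\<tau> / \<mu>) * ?m"
  proof -
    \<comment> \<open>Here \<open>s \<le> 1 + s\<^sup>2\<close> is the viscous absorption: the
      frequency growing with the derivative is paid for by \<open>\<mu> * \<tau> * lam k\<close> on
      the left, leaving the factor \<open>sqrt (\<tau> / \<mu>)\<close>.\<close>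
    define s where "s = sqrt (\<mu> * \<tau> * lam k)"
    have s2: "s\<^sup>2 = \<mu> * \<tau> * lam k" using \<tau> \<mu> lam_nonneg[of k] by (simp add: s_def)
    have "s \<le> 1 + s\<^sup>2" using zero_le_power2[of "s - 1"] zero_le_power2[of s] by (simp add: power2_eq_square algebra_simps) (smt (verit) s_def real_sqrt_ge_zero \<mu> \<tau> lam_nonneg mult_nonneg_nonneg)
    then have "sqrt (\<tau> / \<mu>) * s \<le> sqrt (\<tau> / \<mu>) * ?m" using \<tau> \<mu> by (intro mult_left_mono) (auto simp: s2)
    moreover have "sqrt (\<tau> / \<mu>) * s = \<tau> * sqrt (lam k)"
    proof -
      have "(\<tau> / \<mu>) * (\<mu> * \<tau> * lam k) = \<tau>\<^sup>2 * lam k" using \<mu> by (simp add: power2_eq_square)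
      then have "sqrt (\<tau> / \<mu>) * s = sqrt (\<tau>\<^sup>2 * lam k)" by (simp add: s_def real_sqrt_mult[symmetric])
      then show ?thesis using \<tau> by (simp add: real_sqrt_mult)
    qed
    ultimately show ?thesis by simp
  qed
  show ?thesis
  proof (cases "?b = 0")
    case True
    have "0 \<le> 3 * ?g + sqrt (\<tau> / \<mu>) * ?D"
      using D \<tau> \<mu> by (intro add_nonneg_nonneg mult_nonneg_nonneg) auto
    with True show ?thesis by simp
  next
    case False
    then have "0 < ?b" by simp
    with ineq have "?m * ?b \<le> 3 * ?g + \<tau> * sqrt (lam k) * ?D" by (simp only: mult_le_cancel_left_pos)
    also have "\<dots> \<le> ?m * (3 * ?g) + sqrt (\<tau> / \<mu>) * ?m * ?D"
    proof (intro add_mono mult_right_mono s D)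
      show "3 * ?g \<le> ?m * (3 * ?g)" using mult_right_mono[OF m, of "3 * ?g"] by simp
    qed
    also have "\<dots> = ?m * (3 * ?g + sqrt (\<tau> / \<mu>) * ?D)"
    proof -
      have "m * g + s * m * d = m * (g + s * d)" for m g s d :: real by (simp add: algebra_simps)
      then show ?thesis .
    qed
    finally show ?thesis using m by (simp only: mult_le_cancel_left_pos)
  qed
qed

text \<open>An instance of \<open>h2_le_of_conv_ineq\<close>. The nine pairs of components turn
  \<open>sqrt (\<tau> / \<mu>)\<close> into \<open>\<theta> = 9 * sqrt (\<tau> / \<mu>)\<close>,
  whose square is the \<open>81 * \<tau> / \<mu>\<close> in the smallness condition. The constant
  144 is 8 from that lemma, times 9 for the squared factor 3, times 2 from
  \<open>h2_add_le\<close>.\<close>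

theorem euler_step:
  assumes w: "w \<in> sobolev_div 1" and \<tau>: "0 < \<tau>" and \<mu>: "0 < \<mu>"
    and eq: "\<And>\<phi>. \<phi> \<in> sobolev_div 1 \<Longrightarrow> w \<bullet> \<phi> - \<tau> * convection w v \<phi> = - \<mu> * \<tau> * dirichlet w \<phi> + v \<bullet> \<phi> + \<xi> \<bullet> \<phi>"
    and small: "64 * (wt_sum * (ennreal (81 * \<tau> / \<mu>) * h2_norm v)) \<le> 1"
  shows "h2_norm w \<le> 144 * (h2_norm v + h2_norm \<xi>)"
proof -
  let ?b = "\<lambda>k. ennreal (norm (cf w k))" and ?V = "\<lambda>k. ennreal (norm (cf v k))" and ?X = "\<lambda>k. ennreal (norm (cf \<xi> k))"
  let ?G = "\<lambda>k. 3 * (?V k + ?X k)"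
  have pco: "ennreal (norm (pco w v i j k)) \<le> conv ?V ?b k" for i j k
  proof -
    have "ennreal (norm (pco w v i j k)) \<le> csum (\<lambda>l. ennreal (norm (cf w l $ i)) * ennreal (norm (cf v (k - l) $ j)))"
      unfolding pco_def vfco_def vec_lambda_beta
      by (intro fco_mult_le sq_integrable_component sq_integrable_rep)
    also have "\<dots> \<le> conv ?b ?V k"
      unfolding conv_def
      by (intro nn_integral_mono mult_mono ennreal_leI Finite_Cartesian_Product.norm_nth_le) auto
    finally show ?thesis by (simp only: conv_commute)
  qed
  have "h2 ?b \<le> 8 * h2 ?G"
  proof (rule h2_le_of_conv_ineq[where \<theta> = "9 * sqrt (\<tau> / \<mu>)" and B = "norm w" and V = ?V])
    fix k
    let ?D = "\<Sum>i\<in>UNIV. \<Sum>j\<in>UNIV. norm (pco w v i j k)"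
    have D: "ennreal ?D \<le> 9 * conv ?V ?b k"
    proof -
      have "ennreal ?D = (\<Sum>i\<in>UNIV. \<Sum>j\<in>UNIV. ennreal (norm (pco w v i j k)))"
        by (simp add: sum_nonneg sum_ennreal)
      also have "\<dots> \<le> (\<Sum>i\<in>(UNIV::3 set). \<Sum>j\<in>(UNIV::3 set). conv ?V ?b k)"
        by (intro sum_mono pco)
      also have "\<dots> = 9 * conv ?V ?b k" by (simp flip: mult.assoc)
      finally show ?thesis .
    qed
    have D0: "0 \<le> ?D" by (intro sum_nonneg) auto
    have "?b k \<le> ennreal (3 * (norm (cf v k) + norm (cf \<xi> k)) + sqrt (\<tau> / \<mu>) * ?D)"
      by (intro ennreal_leI euler_step_pointwise[OF w \<tau> \<mu> eq])
    also have "\<dots> = ?G k + ennreal (sqrt (\<tau> / \<mu>)) * ennreal ?D"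
      using D0 \<tau> \<mu> by (simp add: ennreal_mult)
    also have "\<dots> \<le> ?G k + ennreal (sqrt (\<tau> / \<mu>)) * (9 * conv ?V ?b k)"
      by (intro add_left_mono mult_left_mono D) auto
    also have "\<dots> = ?G k + ennreal (9 * sqrt (\<tau> / \<mu>)) * conv ?V ?b k"
      using \<tau> \<mu> by (simp add: ennreal_mult ac_simps)
    finally show "?b k \<le> ?G k + ennreal (9 * sqrt (\<tau> / \<mu>)) * conv ?V ?b k" .
    show "?b k \<le> ennreal (norm w)"
      using norm_cf_bound[of w k] by (intro ennreal_leI) (simp add: power2_le_iff_abs_le)
  next
    show "0 \<le> 9 * sqrt (\<tau> / \<mu>)" using \<tau> \<mu> by simp
    have "(ennreal (9 * sqrt (\<tau> / \<mu>)))\<^sup>2 = ennreal (81 * \<tau> / \<mu>)"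
      using \<tau> \<mu> by (subst ennreal_power) (auto simp: power_mult_distrib)
    then show "64 * (wt_sum * ((ennreal (9 * sqrt (\<tau> / \<mu>)))\<^sup>2 * h2 ?V)) \<le> 1"
      using small by simp
  qed
  also have "h2 ?G = 9 * h2 (\<lambda>k. ?V k + ?X k)"
    by (subst h2_cmult) simp
  also have "8 * \<dots> \<le> 8 * (9 * (2 * h2 ?V + 2 * h2 ?X))"
    by (intro mult_left_mono h2_add_le) auto
  also have "\<dots> = 8 * (9 * 2) * (h2_norm v + h2_norm \<xi>)"
    by (simp only: distrib_left mult.assoc)
  also have "\<dots> = 144 * (h2_norm v + h2_norm \<xi>)"
    by simp
  finally show ?thesis .
qed

section \<open>Scalar projections and measurability\<close>

abbreviation cfield :: "int^3 \<Rightarrow> 3 \<Rightarrow> complex \<Rightarrow> L2_torus" where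
  "cfield k i z \<equiv> abs_L2_torus (tfield (axis i 1) k z)"

lemma inner_cfield: "u \<bullet> cfield k i z = Re (z * cf u k $ i)"
proof -
  have "(\<Sum>j\<in>UNIV. complex_of_real (axis i 1 $ j) * cf u k $ j) = (\<Sum>j\<in>UNIV. if j = i then cf u k $ j else 0)"
    by (intro sum.cong refl) (simp add: axis_def)
  then show ?thesis unfolding inner_abs_tfield by simp
qed

lemma norm_cf_inner: "(norm (cf u k))\<^sup>2 = (\<Sum>i\<in>UNIV. (u \<bullet> cfield k i 1)\<^sup>2 + (u \<bullet> cfield k i \<i>)\<^sup>2)"
  by (simp add: norm_vec_def L2_set_def sum_nonneg inner_cfield cmod_power2)

text \<open>A countable sum of squares of continuous linear functionals. This makes
  \<open>h2_norm\<close> Borel measurable on L^2 and lets the noise be treated one scalar projection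
  at a time.\<close>

lemma h2_norm_inner:
  "h2_norm u = csum (\<lambda>k. \<Sum>p\<in>UNIV \<times> {1, \<i>}. ennreal ((wt k * (u \<bullet> cfield k (fst p) (snd p)))\<^sup>2))"
proof -
  have "(wt k)\<^sup>2 * (norm (cf u k))\<^sup>2 = (\<Sum>p\<in>UNIV \<times> {1, \<i>}. (wt k * (u \<bullet> cfield k (fst p) (snd p)))\<^sup>2)" for k
    by (simp add: sum.cartesian_product' norm_cf_inner sum_distrib_left power_mult_distrib distrib_left)
  then show ?thesis by (simp add: h2_def h2_ennreal sum_ennreal)
qed

lemma borel_measurable_csum:
  fixes f :: "int^3 \<Rightarrow> 'a \<Rightarrow> ennreal"
  assumes "\<And>k. f k \<in> borel_measurable M"
  shows "(\<lambda>x. csum (\<lambda>k. f k x)) \<in> borel_measurable M"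
  by (rule borel_measurable_LIMSEQ_order[where u = "\<lambda>N x. \<Sum>k\<in>fbox N. f k x"])
    (use assms nn_integral_fbox in auto)

lemma borel_measurable_h2_norm: "h2_norm \<in> borel_measurable borel"
proof -
  have "(\<lambda>u. u \<bullet> cfield k i z) \<in> borel_measurable borel" for k i z
    by (intro borel_measurable_continuous_onI continuous_intros)
  then show ?thesis
    unfolding h2_norm_inner[abs_def] by (intro borel_measurable_csum) measurable
qed

lemma norm_le_sobolev_norm: "ennreal ((norm u)\<^sup>2) \<le> (sobolev_norm k 2 u)\<^sup>2"
proof (cases "\<forall>\<alpha>. deg \<alpha> \<le> k \<longrightarrow> (\<exists>g. is_weak_deriv \<alpha> (rep_L2_torus u) g)")
  case True
  have 0: "deg 0 = 0" by (simp add: deg_def)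
  have wd: "is_weak_deriv 0 (rep_L2_torus u) (weak_deriv 0 u)"
    using True 0 by (intro is_weak_deriv_weak_deriv) auto
  have "ennreal ((norm u)\<^sup>2) = (\<integral>\<^sup>+x. ennreal ((norm (rep_L2_torus u x))\<^sup>2) \<partial>torus)"
    using sq_integrable_rep[of u]
    by (simp add: sq_integrable_def nn_integral_eq_integral power2_norm_eq_inner inner_L2_torus_rep)
  also have "\<dots> = csum (\<lambda>k. ennreal ((norm (dsym 0 k))\<^sup>2 * (norm (cf u k))\<^sup>2))"
    by (simp add: vfco_parseval[OF sq_integrable_rep, symmetric] dsym_def)
  also have "\<dots> \<le> (\<integral>\<^sup>+x. ennreal ((norm (weak_deriv 0 u x))\<^sup>2) \<partial>torus)"
    by (rule weak_deriv_bessel[OF wd])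
  also have "\<dots> \<le> (\<Sum>\<alpha> | deg \<alpha> \<le> k. \<integral>\<^sup>+x. ennreal ((norm (weak_deriv \<alpha> u x))\<^sup>2) \<partial>torus)"
    by (rule member_le_sum) (auto simp: 0 finite_deg_le)
  also have "\<dots> = (sobolev_norm k 2 u)\<^sup>2"
    using True by (simp add: sobolev_norm_2_power2)
  finally show ?thesis .
next
  case False
  then have "sobolev_norm k 2 u = \<infinity>" by (auto simp: sobolev_norm_def)
  then show ?thesis by (simp add: power2_eq_square ennreal_mult_top)
qed

lemma space_borel_sobolev_div: "space (borel_sobolev_div k) = sobolev_div k"
  unfolding borel_sobolev_div_def by (rule space_measure_of) auto



text \<open>The Sobolev norm dominates the L^2 norm, so the trace of an L^2-open set is open for the
  Sobolev norm and belongs to the generator.\<close>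

lemma measurable_borel_sobolev_div: "(\<lambda>u. u) \<in> borel_measurable (borel_sobolev_div k)"
proof (rule borel_measurableI)
  fix S :: "L2_torus set" assume S: "open S"
  have "\<exists>\<epsilon>>0. \<forall>v\<in>sobolev_div k. sobolev_norm k 2 (v - u) < ennreal \<epsilon> \<longrightarrow> v \<in> S \<inter> sobolev_div k" if u: "u \<in> S \<inter> sobolev_div k" for u
  proof -
    obtain \<epsilon> where \<epsilon>: "\<epsilon> > 0" "\<And>v. dist v u < \<epsilon> \<Longrightarrow> v \<in> S"
      using S u by (auto simp: open_dist)
    have "v \<in> S" if lt: "sobolev_norm k 2 (v - u) < ennreal \<epsilon>" for v
    proof -
      obtain r where r: "sobolev_norm k 2 (v - u) = ennreal r" "0 \<le> r" "r < \<epsilon>"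
        using \<epsilon>(1) lt by (cases "sobolev_norm k 2 (v - u)") (auto simp: ennreal_less_iff)
      have "(norm (v - u))\<^sup>2 \<le> r\<^sup>2"
        using norm_le_sobolev_norm[of "v - u" k] r by (simp add: ennreal_power)
      then have "norm (v - u) \<le> r" using r(2) by (rule power2_le_imp_le)
      then show ?thesis using \<epsilon>(2) r(3) by (simp add: dist_norm)
    qed
    with \<epsilon>(1) show ?thesis by blast
  qed
  then have "S \<inter> sobolev_div k \<in> {U. U \<subseteq> sobolev_div k \<and>
     (\<forall>u\<in>U. \<exists>\<epsilon>>0. \<forall>v\<in>sobolev_div k. sobolev_norm k 2 (v - u) < ennreal \<epsilon> \<longrightarrow> v \<in> U)}" by blast
  then have "S \<inter> sobolev_div k \<in> sets (borel_sobolev_div k)"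
    unfolding borel_sobolev_div_def by (intro in_measure_of) auto
  then show "(\<lambda>u. u) -` S \<inter> space (borel_sobolev_div k) \<in> sets (borel_sobolev_div k)"
    by (simp add: space_borel_sobolev_div)
qed

section \<open>Increments of the cylindrical Wiener process\<close>

lemma stochastic_basisD:
  assumes "stochastic_basis P F"
  shows "prob_space P"
    and "\<And>t. 0 \<le> t \<Longrightarrow> space (F t) = space P \<and> sets (F t) \<subseteq> sets P"
    and "\<And>s t. 0 \<le> s \<Longrightarrow> s \<le> t \<Longrightarrow> sets (F s) \<subseteq> sets (F t)"
proof -
  note b = assms[unfolded stochastic_basis_def]
  show "prob_space P" by (rule b[THEN conjunct1])
  note c = b[THEN conjunct2, THEN conjunct2]
  have 1: "\<forall>t\<ge>0. space (F t) = space P \<and> sets (F t) \<subseteq> sets P" by (rule c[THEN conjunct1])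
  have 2: "\<forall>s t. 0 \<le> s \<and> s \<le> t \<longrightarrow> sets (F s) \<subseteq> sets (F t)" by (rule c[THEN conjunct2, THEN conjunct1])
  show "space (F t) = space P \<and> sets (F t) \<subseteq> sets P" if "0 \<le> t" for t
    by (rule 1[rule_format, OF that])
  show "sets (F s) \<subseteq> sets (F t)" if "0 \<le> s" "s \<le> t" for s t
    by (rule 2[rule_format]) (rule conjI[OF that])
qed

lemma stochastic_basis_subalgebra:
  assumes "stochastic_basis P F" "0 \<le> t"
  shows "subalgebra P (F t)"
  using stochastic_basisD(2)[OF assms] by (auto simp: subalgebra_def)

lemma stochastic_basis_mono:
  assumes "stochastic_basis P F" "0 \<le> s" "s \<le> t" "f \<in> borel_measurable (F s)"
  shows "f \<in> borel_measurable (F t)"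
proof -
  have "subalgebra (F t) (F s)"
  proof -
    have "0 \<le> t" using assms(2,3) by linarith
    then show ?thesis
      using stochastic_basisD(2)[OF assms(1), of s] stochastic_basisD(2)[OF assms(1), of t]
        stochastic_basisD(3)[OF assms(1-3)] assms(2) by (auto simp: subalgebra_def)
  qed
  then show ?thesis using assms(4) by (rule measurable_from_subalg)
qed

locale filtered_wiener =
  fixes P :: "'w measure" and F :: "real \<Rightarrow> 'w measure" and \<beta> :: "nat \<Rightarrow> real \<Rightarrow> 'w \<Rightarrow> real"
  assumes basis: "stochastic_basis P F" and cyl: "cylindrical_wiener P F \<beta>"

sublocale filtered_wiener \<subseteq> prob_space P
  by (rule stochastic_basisD(1)[OF basis])

context filtered_wiener
begin

lemma wiener: "wiener_process P F (\<beta> j)"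
  using cyl by (simp add: cylindrical_wiener_def)

lemma measurable_F: "0 \<le> t \<Longrightarrow> f \<in> borel_measurable (F t) \<Longrightarrow> f \<in> borel_measurable P"
  using measurable_from_subalg[OF stochastic_basis_subalgebra[OF basis]] by blast

lemma beta_F: "0 \<le> t \<Longrightarrow> \<beta> j t \<in> borel_measurable (F t)"
  using wiener by (simp add: wiener_process_def)

lemma beta_F': "0 \<le> s \<Longrightarrow> s \<le> t \<Longrightarrow> \<beta> j s \<in> borel_measurable (F t)"
  using stochastic_basis_mono[OF basis] beta_F by blast

lemma beta_measurable: "0 \<le> t \<Longrightarrow> \<beta> j t \<in> borel_measurable P"
  using measurable_F beta_F by blast

abbreviation incr :: "nat \<Rightarrow> real \<Rightarrow> real \<Rightarrow> 'w \<Rightarrow> real" where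
  "incr j s t \<omega> \<equiv> \<beta> j t \<omega> - \<beta> j s \<omega>"

lemma incr_measurable: "0 \<le> s \<Longrightarrow> 0 \<le> t \<Longrightarrow> incr j s t \<in> borel_measurable P"
  using beta_measurable by (intro borel_measurable_diff) auto

lemma incr_moments:
  assumes "0 \<le> s" "s < t"
  shows "integrable P (incr j s t)" "expectation (incr j s t) = 0"
    "integrable P (\<lambda>\<omega>. (incr j s t \<omega>)\<^sup>2)" "expectation (\<lambda>\<omega>. (incr j s t \<omega>)\<^sup>2) = t - s"
proof -
  let ?\<sigma> = "sqrt (t - s)"
  have \<sigma>: "0 < ?\<sigma>" using assms by simp
  have D: "distributed P lborel (incr j s t) (normal_density 0 ?\<sigma>)"
    using wiener assms by (simp add: wiener_process_def)
  show "integrable P (incr j s t)"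
    using distributed_integrable[OF D, of "\<lambda>x. x"] integrable_normal_moment[OF \<sigma>, of 0 1] by simp
  show "expectation (incr j s t) = 0"
    using distributed_integral[OF D, of "\<lambda>x. x"] integral_normal_moment_odd[OF \<sigma>, of 0 0] by simp
  show "integrable P (\<lambda>\<omega>. (incr j s t \<omega>)\<^sup>2)"
    using distributed_integrable[OF D, of "\<lambda>x. x\<^sup>2"] integrable_normal_moment[OF \<sigma>, of 0 2] by simp
  show "expectation (\<lambda>\<omega>. (incr j s t \<omega>)\<^sup>2) = t - s"
    using distributed_integral[OF D, of "\<lambda>x. x\<^sup>2"] integral_normal_moment_even[OF \<sigma>, of 0 1] assms
    by (simp add: fact_numeral)
qed

text \<open>The independence of an increment from the whole sigma-algebra \<open>F s\<close> passes
  to the smaller sigma-algebras generated by \<open>Y\<close> and by a Borel function of the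
  increment.\<close>

lemma indep_incr:
  fixes Y :: "'w \<Rightarrow> real" and g :: "real \<Rightarrow> real"
  assumes st: "0 \<le> s" "s < t" and Y: "Y \<in> borel_measurable (F s)" and g: "g \<in> borel_measurable borel"
  shows "indep_var borel Y borel (\<lambda>\<omega>. g (incr j s t \<omega>))"
proof -
  have \<Delta>: "incr j s t \<in> borel_measurable P" using st by (intro incr_measurable) auto
  have Y': "Y \<in> borel_measurable P" using measurable_F[OF st(1) Y] .
  have g\<Delta>: "(\<lambda>\<omega>. g (incr j s t \<omega>)) \<in> borel_measurable P" using measurable_compose[OF \<Delta> g] .
  let ?V = "{incr j s t -` A \<inter> space P | A. A \<in> sets borel}"
  have ind: "indep_set (sets (F s)) ?V"
    using wiener[of j] st by (simp add: wiener_process_def)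
  have sp: "space (F s) = space P" using stochastic_basis_subalgebra[OF basis st(1)] by (simp add: subalgebra_def)
  have V: "?V = sets (vimage_algebra (space P) (incr j s t) borel)"
    by (rule sets_vimage_algebra2[symmetric]) simp
  have 1: "sigma_sets (space P) {Y -` A \<inter> space P | A. A \<in> sets borel} \<subseteq> sets (F s)"
  proof -
    have "Y -` A \<inter> space P \<in> sets (F s)" if "A \<in> sets borel" for A
      using measurable_sets[OF Y that] by (simp only: sp)
    then have "{Y -` A \<inter> space P | A. A \<in> sets borel} \<subseteq> sets (F s)" by blast
    from sets.sigma_sets_subset[OF this] show ?thesis by (simp only: sp)
  qed
  have "{(\<lambda>\<omega>. g (incr j s t \<omega>)) -` A \<inter> space P | A. A \<in> sets borel} \<subseteq> ?V"
  proof clarify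
    fix A :: "real set" assume A: "A \<in> sets borel"
    have "g -` A \<in> sets borel" using measurable_sets[OF g A] by simp
    then show "\<exists>A'. (\<lambda>\<omega>. g (incr j s t \<omega>)) -` A \<inter> space P = incr j s t -` A' \<inter> space P \<and> A' \<in> sets borel"
      by (intro exI[of _ "g -` A"]) auto
  qed
  then have 2: "sigma_sets (space P) {(\<lambda>\<omega>. g (incr j s t \<omega>)) -` A \<inter> space P | A. A \<in> sets borel} \<subseteq> ?V"
    unfolding V by (rule sets.sigma_sets_subset[of _ "vimage_algebra (space P) (incr j s t) borel", simplified])
  have "indep_set (sigma_sets (space P) {Y -` A \<inter> space P | A. A \<in> sets borel})
     (sigma_sets (space P) {(\<lambda>\<omega>. g (incr j s t \<omega>)) -` A \<inter> space P | A. A \<in> sets borel})"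
    using ind unfolding indep_set_def
    by (rule indep_sets_mono_sets) (use 1 2 in \<open>auto split: bool.split\<close>)
  with Y' g\<Delta> show ?thesis unfolding indep_var_eq by blast
qed

lemma expectation_mult_incr:
  fixes Y :: "'w \<Rightarrow> real" and g :: "real \<Rightarrow> real"
  assumes st: "0 \<le> s" "s < t" and Y: "Y \<in> borel_measurable (F s)" "integrable P Y"
    and g: "g \<in> borel_measurable borel" "integrable P (\<lambda>\<omega>. g (incr j s t \<omega>))"
  shows "integrable P (\<lambda>\<omega>. Y \<omega> * g (incr j s t \<omega>))"
    "expectation (\<lambda>\<omega>. Y \<omega> * g (incr j s t \<omega>)) = expectation Y * expectation (\<lambda>\<omega>. g (incr j s t \<omega>))"
  using indep_var_integrable[OF indep_incr[OF st Y(1) g(1)] Y(2) g(2)]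
    indep_var_lebesgue_integral[OF indep_incr[OF st Y(1) g(1)] Y(2) g(2)] by auto

text \<open>The trajectory as a point of the product space in which independence of the coordinates
  is stated; finitely many increments are measurable functions of it.\<close>

definition path :: "nat \<Rightarrow> 'w \<Rightarrow> real \<Rightarrow> real" where
  "path j \<omega> = (\<lambda>t\<in>{0..}. \<beta> j t \<omega>)"

lemma indep_paths:
  fixes f g :: "(real \<Rightarrow> real) \<Rightarrow> real"
  assumes "i \<noteq> j"
    and f: "f \<in> borel_measurable (PiM {0..} (\<lambda>_. borel))" and g: "g \<in> borel_measurable (PiM {0..} (\<lambda>_. borel))"
  shows "indep_var borel (\<lambda>\<omega>. f (path i \<omega>)) borel (\<lambda>\<omega>. g (path j \<omega>))"
proof -
  let ?M = "\<lambda>_::nat. PiM {0::real..} (\<lambda>_. borel :: real measure)"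
  have "indep_vars ?M path UNIV"
    using cyl by (simp add: cylindrical_wiener_def path_def[abs_def])
  from indep_vars_compose2[OF this, of "\<lambda>k. if k = i then f else g" "\<lambda>_. borel"]
  have v: "indep_vars (\<lambda>_. borel) (\<lambda>k \<omega>. (if k = i then f else g) (path k \<omega>)) UNIV"
    using f g by auto
  let ?X = "\<lambda>k \<omega>. (if k = i then f else g) (path k \<omega>)"
  let ?\<sigma> = "\<lambda>k. sigma_sets (space P) {?X k -` A \<inter> space P | A. A \<in> sets borel}"
  have rv: "random_variable borel (?X k)" for k using v unfolding indep_vars_def by blast
  have ind: "indep_sets ?\<sigma> UNIV" using v unfolding indep_vars_def by blast
  have "indep_set (?\<sigma> i) (?\<sigma> j)"
    unfolding indep_sets2_eq
  proof (intro conjI ballI)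
    show "?\<sigma> i \<subseteq> events" "?\<sigma> j \<subseteq> events" using ind unfolding indep_sets_def by blast+
    fix a b assume ab: "a \<in> ?\<sigma> i" "b \<in> ?\<sigma> j"
    have "prob (\<Inter>k\<in>{i, j}. if k = i then a else b) = (\<Prod>k\<in>{i, j}. prob (if k = i then a else b))"
      by (rule indep_setsD[OF ind]) (use ab in auto)
    then show "prob (a \<inter> b) = prob a * prob b" using assms(1) by (simp add: Int_commute)
  qed
  then show ?thesis
    using rv[of i] rv[of j] assms(1) unfolding indep_var_eq by simp
qed

text \<open>Products over two intervals are needed because the discrete covariation will be
  squared.\<close>

lemma indep_incr_products:
  assumes "i \<noteq> j" and t: "0 \<le> s" "0 \<le> t" "0 \<le> s'" "0 \<le> t'"
  shows "indep_var borel (\<lambda>\<omega>. incr i s t \<omega> * incr i s' t' \<omega>) borel (\<lambda>\<omega>. incr j s t \<omega> * incr j s' t' \<omega>)"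
    and "indep_var borel (incr i s t) borel (incr j s t)"
proof -
  have m: "(\<lambda>p. p r) \<in> borel_measurable (PiM {0::real..} (\<lambda>_. borel :: real measure))" if "0 \<le> r" for r
    using that by (intro measurable_component_singleton) simp
  have path: "path j \<omega> r = \<beta> j r \<omega>" if "0 \<le> r" for j \<omega> r using that by (simp add: path_def)
  have "(\<lambda>p. (p t - p s) * (p t' - p s')) \<in> borel_measurable (PiM {0::real..} (\<lambda>_. borel :: real measure))"
    using t by (intro borel_measurable_times borel_measurable_diff m)
  from indep_paths[OF assms(1) this this]
  show "indep_var borel (\<lambda>\<omega>. incr i s t \<omega> * incr i s' t' \<omega>) borel (\<lambda>\<omega>. incr j s t \<omega> * incr j s' t' \<omega>)"
    by (simp add: path t)
  have "(\<lambda>p. p t - p s) \<in> borel_measurable (PiM {0::real..} (\<lambda>_. borel :: real measure))"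
    using t by (intro borel_measurable_diff m)
  from indep_paths[OF assms(1) this this]
  show "indep_var borel (incr i s t) borel (incr j s t)" by (simp add: path t)
qed

lemma incr_product_same:
  assumes "0 \<le> s" "s < t" "0 \<le> s'" "s' < t'"
  shows "integrable P (\<lambda>\<omega>. incr j s t \<omega> * incr j s' t' \<omega>)"
proof (rule Bochner_Integration.integrable_bound)
  show "integrable P (\<lambda>\<omega>. (incr j s t \<omega>)\<^sup>2 + (incr j s' t' \<omega>)\<^sup>2)"
    using assms by (intro Bochner_Integration.integrable_add incr_moments)
  show "(\<lambda>\<omega>. incr j s t \<omega> * incr j s' t' \<omega>) \<in> borel_measurable P"
    using assms by (intro borel_measurable_times incr_measurable) auto
  have "\<bar>a * b\<bar> \<le> a\<^sup>2 + b\<^sup>2" for a b :: real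
    using sum_squares_bound[of "\<bar>a\<bar>" "\<bar>b\<bar>"] mult_nonneg_nonneg[OF abs_ge_zero[of a] abs_ge_zero[of b]]
    unfolding abs_mult power2_abs by linarith
  then show "AE \<omega> in P. norm (incr j s t \<omega> * incr j s' t' \<omega>) \<le> norm ((incr j s t \<omega>)\<^sup>2 + (incr j s' t' \<omega>)\<^sup>2)"
    by simp
qed

lemma expectation_incr_disjoint:
  assumes "0 \<le> s" "s < t" "t \<le> s'" "s' < t'"
  shows "expectation (\<lambda>\<omega>. incr j s t \<omega> * incr j s' t' \<omega>) = 0"
proof -
  have "incr j s t \<in> borel_measurable (F s')"
    using assms by (intro borel_measurable_diff beta_F') auto
  then show ?thesis
    using expectation_mult_incr(2)[of s' t' "incr j s t" "\<lambda>x. x" j] incr_moments[of s t j] incr_moments[of s' t' j] assms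
    by auto
qed

text \<open>The discrete product rule: the first two summands are discrete stochastic integrals, the
  third is the increment of the covariation.\<close>

lemma product_telescope:
  fixes p q :: "nat \<Rightarrow> real"
  shows "(p N - p 0) * (q N - q 0) = (\<Sum>a<N. (p a - p 0) * (q (Suc a) - q a) + (q a - q 0) * (p (Suc a) - p a)
    + (p (Suc a) - p a) * (q (Suc a) - q a))"
  by (induction N) (simp_all add: algebra_simps)

text \<open>Each \<open>\<beta>\<^sub>j\<close> is only assumed to be a Wiener process for the filtration, and the family to be
  independent; the joint independence of the increments from the past is recovered from the vanishing
  of the covariation of \<open>\<beta>\<^sub>i\<close> and \<open>\<beta>\<^sub>j\<close> along fine partitions.\<close>

lemma covariation_bound:
  assumes ij: "i \<noteq> j" and st: "0 \<le> s" "s < t" and N: "0 < N"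
    and r: "\<And>a. r a = s + real a * ((t - s) / real N)"
    and Q: "\<And>\<omega>. Q \<omega> = (\<Sum>a<N. incr i (r a) (r (Suc a)) \<omega> * incr j (r a) (r (Suc a)) \<omega>)"
  shows "integrable P (\<lambda>\<omega>. (Q \<omega>)\<^sup>2)" "expectation (\<lambda>\<omega>. (Q \<omega>)\<^sup>2) = (t - s)\<^sup>2 / real N"
proof -
  define h where "h = (t - s) / real N"
  have h: "h > 0" using st N by (simp add: h_def)
  have r0: "0 \<le> r a" for a using st h by (simp add: r h_def[symmetric])
  have rS: "r (Suc a) = r a + h" for a by (simp add: r h_def algebra_simps add_divide_distrib diff_divide_distrib)
  have rlt: "r a < r (Suc a)" for a using h by (simp add: rS)
  have rmono: "r a \<le> r b" if "a \<le> b" for a b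
    using that h by (simp add: r h_def[symmetric] mult_right_mono)
  let ?d = "\<lambda>k a. incr k (r a) (r (Suc a))"
  \<comment> \<open>Grouped by coordinate, so that independence of \<open>\<beta> i\<close> and
    \<open>\<beta> j\<close> factors each expectation. Off the diagonal both factors vanish, and the
    N diagonal terms are the square of the mesh.\<close>
  have Q2: "(Q \<omega>)\<^sup>2 = (\<Sum>a<N. \<Sum>b<N. (?d i a \<omega> * ?d i b \<omega>) * (?d j a \<omega> * ?d j b \<omega>))" for \<omega>
    unfolding Q power2_eq_square sum_product by (intro sum.cong refl) (simp only: ac_simps)
  have ind: "indep_var borel (\<lambda>\<omega>. ?d i a \<omega> * ?d i b \<omega>) borel (\<lambda>\<omega>. ?d j a \<omega> * ?d j b \<omega>)" for a b
    using ij r0 by (intro indep_incr_products) auto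
  have int1: "integrable P (\<lambda>\<omega>. ?d k a \<omega> * ?d k b \<omega>)" for k a b
    using r0 rlt by (intro incr_product_same) auto
  have int: "integrable P (\<lambda>\<omega>. (?d i a \<omega> * ?d i b \<omega>) * (?d j a \<omega> * ?d j b \<omega>))" for a b
    by (rule indep_var_integrable[OF ind int1 int1])
  have e: "expectation (\<lambda>\<omega>. ?d k a \<omega> * ?d k b \<omega>) = (if a = b then h else 0)" for k a b
  proof -
    consider "a = b" | "a < b" | "b < a" by linarith
    then show ?thesis
    proof cases
      case 1
      then show ?thesis using incr_moments(4)[OF r0[of a] rlt[of a], of k] rS[of a] by (simp add: power2_eq_square)
    next
      case 2
      then show ?thesis using expectation_incr_disjoint[OF r0[of a] rlt[of a] rmono[of "Suc a" b] rlt[of b], of k] by simp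
    next
      case 3
      then show ?thesis using expectation_incr_disjoint[OF r0[of b] rlt[of b] rmono[of "Suc b" a] rlt[of a], of k] by (simp add: mult.commute)
    qed
  qed
  show "integrable P (\<lambda>\<omega>. (Q \<omega>)\<^sup>2)"
    unfolding Q2 by (intro Bochner_Integration.integrable_sum int)
  have "expectation (\<lambda>\<omega>. (Q \<omega>)\<^sup>2) = (\<Sum>a<N. \<Sum>b<N. expectation (\<lambda>\<omega>. (?d i a \<omega> * ?d i b \<omega>) * (?d j a \<omega> * ?d j b \<omega>)))"
    unfolding Q2 by (subst Bochner_Integration.integral_sum, intro Bochner_Integration.integrable_sum int,
        intro sum.cong refl, subst Bochner_Integration.integral_sum) (auto intro: int)
  also have "\<dots> = (\<Sum>a<N. \<Sum>b<N. (if a = b then h else 0) * (if a = b then h else 0))"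
    using indep_var_lebesgue_integral[OF ind int1 int1] by (simp only: e)
  also have "\<dots> = (\<Sum>a<N. \<Sum>b<N. if b = a then h * h else 0)"
    by (intro sum.cong refl) auto
  also have "\<dots> = real N * (h * h)" by simp
  also have "\<dots> = (t - s)\<^sup>2 / real N" using N by (simp add: h_def power2_eq_square)
  finally show "expectation (\<lambda>\<omega>. (Q \<omega>)\<^sup>2) = (t - s)\<^sup>2 / real N" .
qed

lemma integrable_bounded_mult:
  fixes Y X :: "'w \<Rightarrow> real"
  assumes "integrable P X" "Y \<in> borel_measurable P" "\<And>\<omega>. \<bar>Y \<omega>\<bar> \<le> c"
  shows "integrable P (\<lambda>\<omega>. Y \<omega> * X \<omega>)"
proof (rule Bochner_Integration.integrable_bound)
  show "integrable P (\<lambda>\<omega>. c * \<bar>X \<omega>\<bar>)" using assms(1) by simp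
  show "(\<lambda>\<omega>. Y \<omega> * X \<omega>) \<in> borel_measurable P" using assms by (intro borel_measurable_times) auto
  have "0 \<le> c" using assms(3)[of undefined] by linarith
  then show "AE \<omega> in P. norm (Y \<omega> * X \<omega>) \<le> norm (c * \<bar>X \<omega>\<bar>)"
    using assms(3) by (auto simp: abs_mult intro!: mult_right_mono)
qed

text \<open>On a partition of [s,t] into N pieces the product of increments splits by
  \<open>product_telescope\<close>. The stochastic integrals have mean zero even after
  multiplication with \<open>Y\<close>, as their integrands are known before each increment; the
  covariation has second moment of order 1/N, and N is arbitrary.\<close>

lemma expectation_cross:
  assumes ij: "i \<noteq> j" and st: "0 \<le> s" "s < t"
    and Y: "Y \<in> borel_measurable (F s)" "\<And>\<omega>. \<bar>Y \<omega>\<bar> \<le> c"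
  shows "integrable P (\<lambda>\<omega>. Y \<omega> * (incr i s t \<omega> * incr j s t \<omega>))"
    "expectation (\<lambda>\<omega>. Y \<omega> * (incr i s t \<omega> * incr j s t \<omega>)) = 0"
proof -
  have YP: "Y \<in> borel_measurable P" using measurable_F[OF st(1) Y(1)] .
  have c: "0 \<le> c" using Y(2)[of undefined] by linarith
  have "integrable P (\<lambda>\<omega>. incr i s t \<omega> * incr j s t \<omega>)"
    using ij st by (intro indep_var_integrable indep_incr_products incr_moments) auto
  then show int: "integrable P (\<lambda>\<omega>. Y \<omega> * (incr i s t \<omega> * incr j s t \<omega>))"
    by (rule integrable_bounded_mult[OF _ YP Y(2)])
  let ?E = "expectation (\<lambda>\<omega>. Y \<omega> * (incr i s t \<omega> * incr j s t \<omega>))"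
  have bound: "?E\<^sup>2 \<le> c\<^sup>2 * (t - s)\<^sup>2 / real N" if N: "0 < N" for N
  proof -
    define r where "r a = s + real a * ((t - s) / real N)" for a
    define Q where "Q \<omega> = (\<Sum>a<N. incr i (r a) (r (Suc a)) \<omega> * incr j (r a) (r (Suc a)) \<omega>)" for \<omega>
    have h: "(t - s) / real N > 0" using st N by simp
    have rs: "s \<le> r a" for a
      using mult_nonneg_nonneg[OF of_nat_0_le_iff[of a] less_imp_le[OF h]] by (simp add: r_def)
    then have r0: "0 \<le> r a" for a using st order_trans by blast
    have rlt: "r a < r (Suc a)" for a using h by (simp add: r_def algebra_simps add_divide_distrib diff_divide_distrib) 
    have rN: "r 0 = s" "r N = t" using N by (simp_all add: r_def)
    note Qb = covariation_bound[OF ij st N r_def Q_def]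
    have part: "integrable P (\<lambda>\<omega>. (Y \<omega> * incr k s (r a) \<omega>) * incr l (r a) (r (Suc a)) \<omega>)"
      "expectation (\<lambda>\<omega>. (Y \<omega> * incr k s (r a) \<omega>) * incr l (r a) (r (Suc a)) \<omega>) = 0" for k l a
    proof -
      have m: "(\<lambda>\<omega>. Y \<omega> * incr k s (r a) \<omega>) \<in> borel_measurable (F (r a))"
        using stochastic_basis_mono[OF basis st(1) rs Y(1)] st r0 rs
        by (intro borel_measurable_times borel_measurable_diff beta_F') auto
      have "integrable P (incr k s (r a))"
      proof (cases "s < r a")
        case True then show ?thesis using st by (intro incr_moments)
      next
        case False
        then have "r a = s" using rs[of a] by simp
        then show ?thesis by simp
      qed
      then have i: "integrable P (\<lambda>\<omega>. Y \<omega> * incr k s (r a) \<omega>)"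
        by (rule integrable_bounded_mult[OF _ YP Y(2)])
      from expectation_mult_incr[OF r0[of a] rlt[of a] m i, where g = "\<lambda>x. x" and j = l]
        incr_moments(1,2)[OF r0[of a] rlt[of a], of l]
      show "integrable P (\<lambda>\<omega>. (Y \<omega> * incr k s (r a) \<omega>) * incr l (r a) (r (Suc a)) \<omega>)"
        "expectation (\<lambda>\<omega>. (Y \<omega> * incr k s (r a) \<omega>) * incr l (r a) (r (Suc a)) \<omega>) = 0" by auto
    qed
    have Qm: "Q \<in> borel_measurable P"
      unfolding Q_def[abs_def] using r0 by (intro borel_measurable_sum borel_measurable_times incr_measurable)
    have intYQ2: "integrable P (\<lambda>\<omega>. (Y \<omega> * Q \<omega>)\<^sup>2)"
    proof -
      have "(Y \<omega>)\<^sup>2 \<le> c\<^sup>2" for \<omega> using Y(2)[of \<omega>] c by (simp add: abs_le_square_iff[symmetric])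
      then show ?thesis unfolding power_mult_distrib
        using YP by (intro integrable_bounded_mult[OF Qb(1), of _ "c\<^sup>2"]) auto
    qed
    have intYQ: "integrable P (\<lambda>\<omega>. Y \<omega> * Q \<omega>)"
      by (rule square_integrable_imp_integrable[OF _ intYQ2]) (use YP Qm in measurable)
    have decomp: "Y \<omega> * (incr i s t \<omega> * incr j s t \<omega>) =
      (\<Sum>a<N. (Y \<omega> * incr i s (r a) \<omega>) * incr j (r a) (r (Suc a)) \<omega> + (Y \<omega> * incr j s (r a) \<omega>) * incr i (r a) (r (Suc a)) \<omega>)
      + Y \<omega> * Q \<omega>" for \<omega>
      using product_telescope[of "\<lambda>a. \<beta> i (r a) \<omega>" N "\<lambda>a. \<beta> j (r a) \<omega>"]
      by (simp add: rN Q_def sum.distrib distrib_left sum_distrib_left mult.assoc)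
    have "?E = (\<Sum>a<N. expectation (\<lambda>\<omega>. (Y \<omega> * incr i s (r a) \<omega>) * incr j (r a) (r (Suc a)) \<omega>)
        + expectation (\<lambda>\<omega>. (Y \<omega> * incr j s (r a) \<omega>) * incr i (r a) (r (Suc a)) \<omega>)) + expectation (\<lambda>\<omega>. Y \<omega> * Q \<omega>)"
      unfolding decomp using part(1) intYQ
      by (simp only: Bochner_Integration.integral_add Bochner_Integration.integral_sum
          Bochner_Integration.integrable_add Bochner_Integration.integrable_sum)
    then have "?E = expectation (\<lambda>\<omega>. Y \<omega> * Q \<omega>)" by (simp only: part(2)) simp
    \<comment> \<open>The variance is nonnegative.\<close>
    then have "?E\<^sup>2 \<le> expectation (\<lambda>\<omega>. (Y \<omega> * Q \<omega>)\<^sup>2)"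
      using variance_eq[OF intYQ intYQ2] variance_positive[of "\<lambda>\<omega>. Y \<omega> * Q \<omega>"] by simp
    also have "\<dots> \<le> expectation (\<lambda>\<omega>. c\<^sup>2 * (Q \<omega>)\<^sup>2)"
    proof (intro integral_mono intYQ2 integrable_mult_right Qb(1))
      fix \<omega>
      have "(Y \<omega>)\<^sup>2 \<le> c\<^sup>2" using Y(2)[of \<omega>] c by (simp add: abs_le_square_iff[symmetric])
      then show "(Y \<omega> * Q \<omega>)\<^sup>2 \<le> c\<^sup>2 * (Q \<omega>)\<^sup>2" by (simp add: power_mult_distrib mult_right_mono)
    qed
    also have "\<dots> = c\<^sup>2 * (t - s)\<^sup>2 / real N" by (simp add: Qb(2))
    finally show ?thesis .
  qed
  have "(\<lambda>N. c\<^sup>2 * (t - s)\<^sup>2 / real N) \<longlonglongrightarrow> 0" by (rule lim_const_over_n)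
  then have "?E\<^sup>2 \<le> 0"
    by (rule tendsto_lowerbound) (auto intro!: eventually_sequentiallyI[of 1] bound)
  then show "?E = 0" by simp
qed

text \<open>The Ito isometry for one time step and finitely many coordinates: the cross terms vanish
  by \<open>expectation_cross\<close>, the diagonal ones factor by independence from the
  past.\<close>

lemma expectation_square_sum:
  assumes st: "0 \<le> s" "s < t"
    and Y: "\<And>k. Y k \<in> borel_measurable (F s)" "\<And>k \<omega>. \<bar>Y k \<omega>\<bar> \<le> c"
  shows "integrable P (\<lambda>\<omega>. (\<Sum>k<n. incr k s t \<omega> * Y k \<omega>)\<^sup>2)"
    "expectation (\<lambda>\<omega>. (\<Sum>k<n. incr k s t \<omega> * Y k \<omega>)\<^sup>2) = (t - s) * (\<Sum>k<n. expectation (\<lambda>\<omega>. (Y k \<omega>)\<^sup>2))"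
proof -
  have c: "0 \<le> c" using Y(2)[of undefined undefined] by linarith
  have b: "\<bar>Y k \<omega> * Y l \<omega>\<bar> \<le> c * c" for k l \<omega>
    unfolding abs_mult by (intro mult_mono Y c) auto
  have m: "(\<lambda>\<omega>. Y k \<omega> * Y l \<omega>) \<in> borel_measurable (F s)" for k l
    by (intro borel_measurable_times Y)
  have sq: "(\<Sum>k<n. incr k s t \<omega> * Y k \<omega>)\<^sup>2 = (\<Sum>k<n. \<Sum>l<n. (Y k \<omega> * Y l \<omega>) * (incr k s t \<omega> * incr l s t \<omega>))" for \<omega>
    unfolding power2_eq_square sum_product by (intro sum.cong refl) (simp only: ac_simps)
  have *: "integrable P (\<lambda>\<omega>. (Y k \<omega> * Y l \<omega>) * (incr k s t \<omega> * incr l s t \<omega>)) \<and>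
     expectation (\<lambda>\<omega>. (Y k \<omega> * Y l \<omega>) * (incr k s t \<omega> * incr l s t \<omega>)) = (if l = k then (t - s) * expectation (\<lambda>\<omega>. (Y k \<omega>)\<^sup>2) else 0)" for k l
  proof (cases "l = k")
    case True
    have "integrable P (\<lambda>\<omega>. Y k \<omega> * Y k \<omega>)"
      by (intro integrable_const_bound[of _ "c * c"] AE_I2 measurable_F[OF st(1) m]) (simp only: real_norm_def b)
    from expectation_mult_incr[OF st m this, where g = "\<lambda>x. x * x" and j = k] incr_moments(3,4)[OF st, of k] True
    show ?thesis by (simp add: power2_eq_square)
  next
    case False
    then show ?thesis using expectation_cross[OF _ st m b, of k l k l] by simp
  qed
  show "integrable P (\<lambda>\<omega>. (\<Sum>k<n. incr k s t \<omega> * Y k \<omega>)\<^sup>2)"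
    unfolding sq using * by (intro Bochner_Integration.integrable_sum) blast
  have "expectation (\<lambda>\<omega>. (\<Sum>k<n. incr k s t \<omega> * Y k \<omega>)\<^sup>2)
      = (\<Sum>k<n. \<Sum>l<n. expectation (\<lambda>\<omega>. (Y k \<omega> * Y l \<omega>) * (incr k s t \<omega> * incr l s t \<omega>)))"
    unfolding sq using * by (simp only: Bochner_Integration.integral_sum Bochner_Integration.integrable_sum)
  also have "\<dots> = (\<Sum>k<n. \<Sum>l<n. if l = k then (t - s) * expectation (\<lambda>\<omega>. (Y k \<omega>)\<^sup>2) else 0)"
    using * by (simp only:)
  also have "\<dots> = (t - s) * (\<Sum>k<n. expectation (\<lambda>\<omega>. (Y k \<omega>)\<^sup>2))"
    by (simp add: sum_distrib_left)
  finally show "expectation (\<lambda>\<omega>. (\<Sum>k<n. incr k s t \<omega> * Y k \<omega>)\<^sup>2) = (t - s) * (\<Sum>k<n. expectation (\<lambda>\<omega>. (Y k \<omega>)\<^sup>2))" .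
qed

text \<open>For partial sums this is the isometry \<open>expectation_square_sum\<close>; the noise
  is their mean-square limit. Splitting off the error costs the factor 2. The event \<open>B\<close>
  lies in \<open>F s\<close>, so restricting to it preserves independence from the increments and
  makes the coefficients bounded.\<close>

lemma noise_second_moment:
  fixes \<Psi> :: "'w \<Rightarrow> 'u::real_normed_vector \<Rightarrow>\<^sub>L L2_torus"
  assumes st: "0 \<le> s" "s < t" and \<xi>: "is_noise_increment P e \<beta> s t \<Psi> \<xi>" and B: "B \<in> sets (F s)"
    and m: "\<And>k. (\<lambda>\<omega>. blinfun_apply (\<Psi> \<omega>) (e k) \<bullet> q) \<in> borel_measurable (F s)"
    and bd: "\<And>k \<omega>. \<omega> \<in> B \<Longrightarrow> \<bar>blinfun_apply (\<Psi> \<omega>) (e k) \<bullet> q\<bar> \<le> c"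
  shows "(\<integral>\<^sup>+\<omega>. indicator B \<omega> * ennreal ((\<xi> \<omega> \<bullet> q)\<^sup>2) \<partial>P)
    \<le> 2 * ennreal (t - s) * (\<integral>\<^sup>+\<omega>. indicator B \<omega> * (\<Sum>k. ennreal ((blinfun_apply (\<Psi> \<omega>) (e k) \<bullet> q)\<^sup>2)) \<partial>P)"
proof -
  \<comment> \<open>The cut-off makes the coefficients bounded everywhere while they stay measurable
    for \<open>F s\<close>.\<close>
  define Y where "Y k \<omega> = indicator B \<omega> * (blinfun_apply (\<Psi> \<omega>) (e k) \<bullet> q)" for k \<omega>
  define S where "S n \<omega> = (\<Sum>k<n. (\<beta> k t \<omega> - \<beta> k s \<omega>) *\<^sub>R blinfun_apply (\<Psi> \<omega>) (e k))" for n \<omega>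
  define d where "d n = (\<integral>\<^sup>+\<omega>. (L2_norm (\<xi> \<omega> - S n \<omega>))\<^sup>2 \<partial>P)" for n
  let ?R = "\<integral>\<^sup>+\<omega>. indicator B \<omega> * (\<Sum>k. ennreal ((blinfun_apply (\<Psi> \<omega>) (e k) \<bullet> q)\<^sup>2)) \<partial>P"
  have d: "d \<longlonglongrightarrow> 0" and \<xi>m: "\<xi> \<in> borel_measurable P"
    using \<xi> by (simp_all add: is_noise_increment_def d_def[abs_def] S_def[abs_def])
  have Ym: "Y k \<in> borel_measurable (F s)" for k
    unfolding Y_def[abs_def] using m B by measurable
  have YmP [measurable]: "Y k \<in> borel_measurable P" for k using measurable_F[OF st(1) Ym] .
  have Yb: "\<bar>Y k \<omega>\<bar> \<le> \<bar>c\<bar>" for k \<omega>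
    using bd[of \<omega> k] by (auto simp: Y_def indicator_def)
  have BP [measurable]: "B \<in> sets P"
    using B stochastic_basis_subalgebra[OF basis st(1)] by (auto simp: subalgebra_def)
  have [measurable]: "(\<lambda>\<omega>. \<xi> \<omega> \<bullet> q) \<in> borel_measurable P"
  proof -
    have "(\<lambda>u. u \<bullet> q) \<in> borel_measurable borel" by (intro borel_measurable_continuous_onI continuous_intros)
    from measurable_compose[OF \<xi>m this] show ?thesis .
  qed
  have [measurable]: "incr k s t \<in> borel_measurable P" for k using st by (intro incr_measurable) auto
  have Sq: "indicator B \<omega> * (S n \<omega> \<bullet> q) = (\<Sum>k<n. incr k s t \<omega> * Y k \<omega>)" for n \<omega>
    by (simp add: S_def Y_def inner_sum_left sum_distrib_left ac_simps)
  have step: "(\<integral>\<^sup>+\<omega>. indicator B \<omega> * ennreal ((\<xi> \<omega> \<bullet> q)\<^sup>2) \<partial>P) \<le> 2 * ennreal (t - s) * ?R + 2 * ennreal ((norm q)\<^sup>2) * d n" for n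
  proof -
    define X where "X \<omega> = (\<Sum>k<n. incr k s t \<omega> * Y k \<omega>)" for \<omega>
    define Z where "Z \<omega> = indicator B \<omega> * (\<xi> \<omega> \<bullet> q) - X \<omega>" for \<omega>
    have [measurable]: "X \<in> borel_measurable P" unfolding X_def[abs_def] by measurable
    have [measurable]: "Z \<in> borel_measurable P" unfolding Z_def[abs_def] by measurable
    have "(\<integral>\<^sup>+\<omega>. indicator B \<omega> * ennreal ((\<xi> \<omega> \<bullet> q)\<^sup>2) \<partial>P) \<le> (\<integral>\<^sup>+\<omega>. 2 * ennreal ((X \<omega>)\<^sup>2) + 2 * ennreal ((Z \<omega>)\<^sup>2) \<partial>P)"
    proof (rule nn_integral_mono)
      fix \<omega>
      have "(X \<omega> + Z \<omega>)\<^sup>2 \<le> 2 * (X \<omega>)\<^sup>2 + 2 * (Z \<omega>)\<^sup>2"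
        using zero_le_power2[of "X \<omega> - Z \<omega>"] by (simp add: power2_eq_square algebra_simps)
      then have "ennreal ((X \<omega> + Z \<omega>)\<^sup>2) \<le> ennreal (2 * (X \<omega>)\<^sup>2 + 2 * (Z \<omega>)\<^sup>2)" by (rule ennreal_leI)
      moreover have "ennreal ((X \<omega> + Z \<omega>)\<^sup>2) = indicator B \<omega> * ennreal ((\<xi> \<omega> \<bullet> q)\<^sup>2)"
        by (simp add: Z_def indicator_def)
      ultimately show "indicator B \<omega> * ennreal ((\<xi> \<omega> \<bullet> q)\<^sup>2) \<le> 2 * ennreal ((X \<omega>)\<^sup>2) + 2 * ennreal ((Z \<omega>)\<^sup>2)"
        by (simp add: ennreal_mult)
    qed
    also have "\<dots> = 2 * (\<integral>\<^sup>+\<omega>. ennreal ((X \<omega>)\<^sup>2) \<partial>P) + 2 * (\<integral>\<^sup>+\<omega>. ennreal ((Z \<omega>)\<^sup>2) \<partial>P)"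
      by (simp add: nn_integral_add nn_integral_cmult)
    also have "\<dots> \<le> 2 * (ennreal (t - s) * ?R) + 2 * (ennreal ((norm q)\<^sup>2) * d n)"
    proof (intro add_mono mult_left_mono)
      have Yint: "integrable P (\<lambda>\<omega>. (Y k \<omega>)\<^sup>2)" for k
        using Yb by (intro integrable_const_bound[of _ "\<bar>c\<bar>\<^sup>2"]) (auto simp: abs_le_square_iff[symmetric])
      have "(\<integral>\<^sup>+\<omega>. ennreal ((X \<omega>)\<^sup>2) \<partial>P) = ennreal (expectation (\<lambda>\<omega>. (X \<omega>)\<^sup>2))"
        unfolding X_def by (rule nn_integral_eq_integral[OF expectation_square_sum(1)[OF st Ym Yb]]) simp
      also have "\<dots> = ennreal (t - s) * (\<Sum>k<n. ennreal (expectation (\<lambda>\<omega>. (Y k \<omega>)\<^sup>2)))"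
        using st unfolding X_def expectation_square_sum(2)[OF st Ym Yb]
        by (simp add: ennreal_mult sum_nonneg sum_ennreal)
      finally have XE: "(\<integral>\<^sup>+\<omega>. ennreal ((X \<omega>)\<^sup>2) \<partial>P) = ennreal (t - s) * (\<Sum>k<n. ennreal (expectation (\<lambda>\<omega>. (Y k \<omega>)\<^sup>2)))" .
      have "(\<Sum>k<n. ennreal (expectation (\<lambda>\<omega>. (Y k \<omega>)\<^sup>2))) = (\<Sum>k<n. \<integral>\<^sup>+\<omega>. ennreal ((Y k \<omega>)\<^sup>2) \<partial>P)"
        by (intro sum.cong refl nn_integral_eq_integral[symmetric] Yint) simp
      also have "\<dots> = (\<integral>\<^sup>+\<omega>. (\<Sum>k<n. ennreal ((Y k \<omega>)\<^sup>2)) \<partial>P)"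
        by (intro nn_integral_sum[symmetric]) measurable
      also have "\<dots> \<le> ?R"
      proof (rule nn_integral_mono)
        fix \<omega>
        have "(\<Sum>k<n. ennreal ((Y k \<omega>)\<^sup>2)) \<le> (\<Sum>k. ennreal ((Y k \<omega>)\<^sup>2))"
          by (intro sum_le_suminf) auto
        also have "\<dots> = indicator B \<omega> * (\<Sum>k. ennreal ((blinfun_apply (\<Psi> \<omega>) (e k) \<bullet> q)\<^sup>2))"
          by (simp add: Y_def indicator_def del: suminf_ennreal)
        finally show "(\<Sum>k<n. ennreal ((Y k \<omega>)\<^sup>2)) \<le> indicator B \<omega> * (\<Sum>k. ennreal ((blinfun_apply (\<Psi> \<omega>) (e k) \<bullet> q)\<^sup>2))" .
      qed
      finally show "(\<integral>\<^sup>+\<omega>. ennreal ((X \<omega>)\<^sup>2) \<partial>P) \<le> ennreal (t - s) * ?R"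
        unfolding XE by (rule mult_left_mono) simp
      have ZS: "(Z \<omega>)\<^sup>2 \<le> (norm q)\<^sup>2 * (norm (\<xi> \<omega> - S n \<omega>))\<^sup>2" for \<omega>
      proof -
        have "Z \<omega> = indicator B \<omega> * ((\<xi> \<omega> - S n \<omega>) \<bullet> q)"
          by (simp add: Z_def X_def Sq[symmetric] inner_diff_left right_diff_distrib)
        then have "\<bar>Z \<omega>\<bar> \<le> \<bar>(\<xi> \<omega> - S n \<omega>) \<bullet> q\<bar>" by (simp add: indicator_def)
        also have "\<dots> \<le> norm (\<xi> \<omega> - S n \<omega>) * norm q" by (rule Cauchy_Schwarz_ineq2)
        finally have "\<bar>Z \<omega>\<bar>\<^sup>2 \<le> (norm (\<xi> \<omega> - S n \<omega>) * norm q)\<^sup>2" by (rule power_mono) simp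
        then show ?thesis by (simp add: power_mult_distrib mult.commute)
      qed
      show "(\<integral>\<^sup>+\<omega>. ennreal ((Z \<omega>)\<^sup>2) \<partial>P) \<le> ennreal ((norm q)\<^sup>2) * d n"
      proof (cases "q = 0")
        case True
        then have "(Z \<omega>)\<^sup>2 = 0" for \<omega> using ZS[of \<omega>] by simp
        then show ?thesis by simp
      next
        case False
        then have q: "0 < (norm q)\<^sup>2" by simp
        \<comment> \<open>The constant is pulled out of an integral of the rescaled
          \<open>Z\<close>, whose measurability is known; that of the norm of
          \<open>\<xi> \<omega> - S n \<omega>\<close> has not been established.\<close>
        have "(\<integral>\<^sup>+\<omega>. ennreal ((Z \<omega>)\<^sup>2) \<partial>P) = (\<integral>\<^sup>+\<omega>. ennreal ((norm q)\<^sup>2) * ennreal ((Z \<omega>)\<^sup>2 / (norm q)\<^sup>2) \<partial>P)"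
          using q by (intro nn_integral_cong) (simp flip: ennreal_mult)
        also have "\<dots> = ennreal ((norm q)\<^sup>2) * (\<integral>\<^sup>+\<omega>. ennreal ((Z \<omega>)\<^sup>2 / (norm q)\<^sup>2) \<partial>P)"
          by (rule nn_integral_cmult) measurable
        also have "\<dots> \<le> ennreal ((norm q)\<^sup>2) * d n"
          unfolding d_def
        proof (intro mult_left_mono nn_integral_mono)
          fix \<omega>
          have "(Z \<omega>)\<^sup>2 / (norm q)\<^sup>2 \<le> (norm (\<xi> \<omega> - S n \<omega>))\<^sup>2"
            using ZS[of \<omega>] q by (simp add: pos_divide_le_eq mult.commute)
          then show "ennreal ((Z \<omega>)\<^sup>2 / (norm q)\<^sup>2) \<le> (L2_norm (\<xi> \<omega> - S n \<omega>))\<^sup>2"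
            by (simp add: ennreal_power ennreal_leI)
        qed simp
        finally show ?thesis .
      qed
    qed auto
    finally show ?thesis by (simp only: mult.assoc)
  qed
  have "(\<lambda>n. 2 * ennreal (t - s) * ?R + 2 * ennreal ((norm q)\<^sup>2) * d n) \<longlonglongrightarrow> 2 * ennreal (t - s) * ?R + 2 * ennreal ((norm q)\<^sup>2) * 0"
    using d by (intro tendsto_add tendsto_const ennreal_tendsto_cmult) (auto simp: ennreal_mult_less_top)
  then have "(\<integral>\<^sup>+\<omega>. indicator B \<omega> * ennreal ((\<xi> \<omega> \<bullet> q)\<^sup>2) \<partial>P) \<le> 2 * ennreal (t - s) * ?R + 2 * ennreal ((norm q)\<^sup>2) * 0"
    by (rule LIMSEQ_le_const) (use step in auto)
  then show ?thesis by simp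
qed

end

section \<open>Tightness\<close>

context filtered_wiener
begin

text \<open>\<open>noise_second_moment\<close> is summed over the weighted functionals of
  \<open>h2_norm_inner\<close>; Tonelli exchanges the sums over frequencies and over coordinates of
  the noise with the expectation.\<close>

lemma noise_h2_norm:
  fixes \<Psi> :: "'w \<Rightarrow> 'u::real_normed_vector \<Rightarrow>\<^sub>L L2_torus"
  assumes st: "0 \<le> s" "s < t" and \<xi>: "is_noise_increment P e \<beta> s t \<Psi> \<xi>" and B: "B \<in> sets (F s)"
    and m: "\<And>k q. (\<lambda>\<omega>. blinfun_apply (\<Psi> \<omega>) (e k) \<bullet> q) \<in> borel_measurable (F s)"
    and bd: "\<And>k \<omega>. \<omega> \<in> B \<Longrightarrow> norm (blinfun_apply (\<Psi> \<omega>) (e k)) \<le> c"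
  shows "(\<integral>\<^sup>+\<omega>. indicator B \<omega> * h2_norm (\<xi> \<omega>) \<partial>P)
    \<le> 2 * ennreal (t - s) * (\<integral>\<^sup>+\<omega>. indicator B \<omega> * (\<Sum>k. h2_norm (blinfun_apply (\<Psi> \<omega>) (e k))) \<partial>P)"
proof -
  define q where "q k p = wt k *\<^sub>R cfield k (fst p) (snd p)" for k and p :: "3 \<times> complex"
  let ?A = "(UNIV :: 3 set) \<times> {1, \<i>}"
  have h2: "h2_norm v = csum (\<lambda>k. \<Sum>p\<in>?A. ennreal ((v \<bullet> q k p)\<^sup>2))" for v
    by (simp only: h2_norm_inner q_def inner_scaleR_right)
  have BP [measurable]: "B \<in> sets P"
    using B stochastic_basis_subalgebra[OF basis st(1)] by (auto simp: subalgebra_def)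
  have \<xi>m: "\<xi> \<in> borel_measurable P" using \<xi> by (simp add: is_noise_increment_def)
  have [measurable]: "(\<lambda>\<omega>. \<xi> \<omega> \<bullet> q k p) \<in> borel_measurable P" for k p
  proof -
    have "(\<lambda>u. u \<bullet> q k p) \<in> borel_measurable borel" by (intro borel_measurable_continuous_onI continuous_intros)
    from measurable_compose[OF \<xi>m this] show ?thesis .
  qed
  have [measurable]: "(\<lambda>\<omega>. blinfun_apply (\<Psi> \<omega>) (e j) \<bullet> q k p) \<in> borel_measurable P" for j k p
    using measurable_F[OF st(1) m] .
  let ?r = "\<lambda>k p \<omega>. indicator B \<omega> * (\<Sum>j. ennreal ((blinfun_apply (\<Psi> \<omega>) (e j) \<bullet> q k p)\<^sup>2)) :: ennreal"
  have bdq: "\<bar>blinfun_apply (\<Psi> \<omega>) (e j) \<bullet> q k p\<bar> \<le> c * norm (q k p)" if "\<omega> \<in> B" for j k p \<omega>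
    by (rule order_trans[OF Cauchy_Schwarz_ineq2]) (intro mult_right_mono bd that norm_ge_zero)
  have rm: "?r k p \<in> borel_measurable P" for k p by measurable
  have "(\<integral>\<^sup>+\<omega>. indicator B \<omega> * h2_norm (\<xi> \<omega>) \<partial>P)
      = (\<integral>\<^sup>+\<omega>. csum (\<lambda>k. \<Sum>p\<in>?A. indicator B \<omega> * ennreal ((\<xi> \<omega> \<bullet> q k p)\<^sup>2)) \<partial>P)"
    unfolding h2 by (simp add: nn_integral_cmult sum_distrib_left[symmetric] del: sum_ennreal)
  also have "\<dots> = csum (\<lambda>k. \<integral>\<^sup>+\<omega>. (\<Sum>p\<in>?A. indicator B \<omega> * ennreal ((\<xi> \<omega> \<bullet> q k p)\<^sup>2)) \<partial>P)"
    by (rule nn_integral_count_space_nn_integral) measurable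
  also have "\<dots> = csum (\<lambda>k. \<Sum>p\<in>?A. \<integral>\<^sup>+\<omega>. indicator B \<omega> * ennreal ((\<xi> \<omega> \<bullet> q k p)\<^sup>2) \<partial>P)"
    by (intro nn_integral_cong nn_integral_sum) measurable
  also have "\<dots> \<le> csum (\<lambda>k. \<Sum>p\<in>?A. 2 * ennreal (t - s) * (\<integral>\<^sup>+\<omega>. ?r k p \<omega> \<partial>P))"
    by (intro nn_integral_mono sum_mono noise_second_moment[OF st \<xi> B m bdq])
  also have "\<dots> = 2 * ennreal (t - s) * csum (\<lambda>k. \<integral>\<^sup>+\<omega>. (\<Sum>p\<in>?A. ?r k p \<omega>) \<partial>P)"
  proof -
    have swap: "(\<integral>\<^sup>+\<omega>. (\<Sum>p\<in>?A. ?r k p \<omega>) \<partial>P) = (\<Sum>p\<in>?A. \<integral>\<^sup>+\<omega>. ?r k p \<omega> \<partial>P)" for k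
      by (rule nn_integral_sum) (rule rm)
    show ?thesis
      unfolding swap sum_distrib_left[of "2 * ennreal (t - s)", symmetric] by (rule nn_integral_cmult) simp
  qed
  also have "csum (\<lambda>k. \<integral>\<^sup>+\<omega>. (\<Sum>p\<in>?A. ?r k p \<omega>) \<partial>P) = (\<integral>\<^sup>+\<omega>. csum (\<lambda>k. \<Sum>p\<in>?A. ?r k p \<omega>) \<partial>P)"
    by (rule nn_integral_count_space_nn_integral[symmetric]) (rule countableI_type borel_measurable_sum rm)+
  also have "\<dots> = (\<integral>\<^sup>+\<omega>. indicator B \<omega> * (\<Sum>j. h2_norm (blinfun_apply (\<Psi> \<omega>) (e j))) \<partial>P)"
  proof (rule nn_integral_cong)
    fix \<omega>
    let ?a = "\<lambda>j k p. ennreal ((blinfun_apply (\<Psi> \<omega>) (e j) \<bullet> q k p)\<^sup>2)"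
    have "csum (\<lambda>k. \<Sum>p\<in>?A. ?r k p \<omega>) = indicator B \<omega> * csum (\<lambda>k. \<Sum>p\<in>?A. \<Sum>j. ?a j k p)"
      unfolding sum_distrib_left[symmetric] by (rule nn_integral_cmult) simp
    also have "(\<lambda>k. \<Sum>p\<in>?A. \<Sum>j. ?a j k p) = (\<lambda>k. \<Sum>j. \<Sum>p\<in>?A. ?a j k p)"
      by (intro ext suminf_sum[symmetric] summableI)
    also have "csum (\<lambda>k. \<Sum>j. \<Sum>p\<in>?A. ?a j k p) = (\<Sum>j. csum (\<lambda>k. \<Sum>p\<in>?A. ?a j k p))"
      by (rule nn_integral_suminf) simp
    finally show "csum (\<lambda>k. \<Sum>p\<in>?A. ?r k p \<omega>) = indicator B \<omega> * (\<Sum>j. h2_norm (blinfun_apply (\<Psi> \<omega>) (e j)))"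
      unfolding h2 .
  qed
  finally show ?thesis .
qed

end

section \<open>Noise coefficients on bounded sets, and the stopping time\<close>

lemma HS_norm_power2: "(HS_norm e N A)\<^sup>2 = (\<Sum>k. (N (A (e k)))\<^sup>2)"
  by (simp add: HS_norm_def ell2_norm_def ennroot_2_power2)

text \<open>Where \<open>h2_norm\<close> is at most \<open>K\<close>, the W^{2,2} and W^{1,4} norms
  are bounded too, so the growth condition gives a uniform Hilbert-Schmidt bound \<open>D\<close> in
  W^{2,2}. A single coefficient is bounded by the whole series.\<close>

lemma noise_coefficient_bound:
  fixes \<Phi> :: "L2_torus \<Rightarrow> 'u::real_normed_vector \<Rightarrow>\<^sub>L L2_torus"
  assumes C: "C > 0" and K: "0 \<le> K" and \<Phi>_W22: "\<And>v. v \<in> sobolev 2 2 \<Longrightarrow>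
          HS_norm e (sobolev_norm 2 2) (blinfun_apply (\<Phi> v))
            \<le> ennreal C * (1 + (sobolev_norm 1 4 v)\<^sup>2 + sobolev_norm 2 2 v)"
  obtains Q where "0 \<le> Q"
    "\<And>v j. h2_norm v \<le> ennreal K \<Longrightarrow> norm (blinfun_apply (\<Phi> v) (e j)) \<le> Q"
    "\<And>v. h2_norm v \<le> ennreal K \<Longrightarrow> (\<Sum>j. h2_norm (blinfun_apply (\<Phi> v) (e j))) \<le> ennreal Q"
proof -
  obtain K4 where K4: "K4 > 0" "\<And>u. (sobolev_norm 1 4 u)\<^sup>2 \<le> ennreal K4 * h2_norm u"
    using sobolev_1_4_le_h2_norm by blast
  define c where "c = real (4096 * num_idx)"
  define D where "D = C * (1 + K4 * K + sqrt (c * K))"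
  have c: "0 \<le> c" by (simp add: c_def)
  have D: "0 \<le> D" using C K K4(1) c by (simp add: D_def)
  have bound: "(\<Sum>j. (sobolev_norm 2 2 (blinfun_apply (\<Phi> v) (e j)))\<^sup>2) \<le> ennreal (D\<^sup>2)" if v: "h2_norm v \<le> ennreal K" for v
  proof -
    have "(sobolev_norm 2 2 v)\<^sup>2 \<le> of_nat (4096 * num_idx) * h2_norm v"
      by (rule sobolev_norm_le_h2_norm) simp
    also have "\<dots> \<le> ennreal c * ennreal K"
      using v unfolding c_def ennreal_of_nat_eq_real_of_nat by (intro mult_left_mono) auto
    also have "\<dots> = (ennreal (sqrt (c * K)))\<^sup>2"
      using c K by (simp add: ennreal_power flip: ennreal_mult)
    finally have s22: "sobolev_norm 2 2 v \<le> ennreal (sqrt (c * K))"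
      using c K by (intro ennreal_power2_le_imp_le) auto
    then have "v \<in> sobolev 2 2" unfolding sobolev_def using order.strict_trans1[OF _ ennreal_less_top] by auto
    then have "HS_norm e (sobolev_norm 2 2) (blinfun_apply (\<Phi> v))
            \<le> ennreal C * (1 + (sobolev_norm 1 4 v)\<^sup>2 + sobolev_norm 2 2 v)" by (rule \<Phi>_W22)
    also have "\<dots> \<le> ennreal C * (1 + ennreal K4 * ennreal K + ennreal (sqrt (c * K)))"
      using order_trans[OF K4(2)[of v] mult_left_mono[OF v]] s22
      by (intro mult_left_mono add_mono order_refl) auto
    also have "\<dots> = ennreal D"
      using C K K4(1) c by (simp add: D_def ennreal_mult ennreal_plus)
    finally have "(HS_norm e (sobolev_norm 2 2) (blinfun_apply (\<Phi> v)))\<^sup>2 \<le> (ennreal D)\<^sup>2"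
      by (rule power_mono) simp
    then show ?thesis using D by (simp add: HS_norm_power2 ennreal_power)
  qed
  have single: "(sobolev_norm 2 2 (blinfun_apply (\<Phi> v) (e j)))\<^sup>2 \<le> (\<Sum>j. (sobolev_norm 2 2 (blinfun_apply (\<Phi> v) (e j)))\<^sup>2)" for v j
    using sum_le_suminf[OF summableI, of "{j}" "\<lambda>j. (sobolev_norm 2 2 (blinfun_apply (\<Phi> v) (e j)))\<^sup>2"] by simp
  show ?thesis
  proof (rule that[of "D + 4 * D\<^sup>2"])
    show "0 \<le> D + 4 * D\<^sup>2" using D by simp
    fix v assume v: "h2_norm v \<le> ennreal K"
    show "norm (blinfun_apply (\<Phi> v) (e j)) \<le> D + 4 * D\<^sup>2" for j
    proof -
      have "ennreal ((norm (blinfun_apply (\<Phi> v) (e j)))\<^sup>2) \<le> ennreal (D\<^sup>2)"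
        by (rule order_trans[OF norm_le_sobolev_norm order_trans[OF single bound[OF v]]])
      then have "(norm (blinfun_apply (\<Phi> v) (e j)))\<^sup>2 \<le> D\<^sup>2" by simp
      then have "norm (blinfun_apply (\<Phi> v) (e j)) \<le> D" using D by (rule power2_le_imp_le)
      then show ?thesis using zero_le_power2[of D] by linarith
    qed
    have "(\<Sum>j. h2_norm (blinfun_apply (\<Phi> v) (e j))) \<le> (\<Sum>j. 4 * (sobolev_norm 2 2 (blinfun_apply (\<Phi> v) (e j)))\<^sup>2)"
      by (intro suminf_le summableI h2_norm_le_sobolev_norm)
    also have "\<dots> = 4 * (\<Sum>j. (sobolev_norm 2 2 (blinfun_apply (\<Phi> v) (e j)))\<^sup>2)" by simp
    also have "\<dots> \<le> 4 * ennreal (D\<^sup>2)" by (intro mult_left_mono bound v) auto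
    also have "\<dots> = ennreal (4 * D\<^sup>2)" by (simp add: ennreal_mult)
    also have "\<dots> \<le> ennreal (D + 4 * D\<^sup>2)" using D by (intro ennreal_leI) simp
    finally show "(\<Sum>j. h2_norm (blinfun_apply (\<Phi> v) (e j))) \<le> ennreal (D + 4 * D\<^sup>2)" .
  qed
qed

lemma stopping_time_d_le_imp:
  assumes le: "stopping_time_d \<tau> M R u \<omega> \<le> real l * \<tau>" and "l < M" and \<tau>: "0 < \<tau>"
  shows "\<exists>n\<le>l. ennreal R \<le> sobolev_norm 2 2 (u n \<omega>)"
proof -
  define S where "S = {real m * \<tau> | m. m \<le> M \<and> Max ((\<lambda>n. sobolev_norm 2 2 (u n \<omega>)) ` {0..m}) \<ge> ennreal R}"
  have st: "stopping_time_d \<tau> M R u \<omega> = (if S = {} then real M * \<tau> else Min S)"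
    unfolding stopping_time_d_def S_def Let_def ..
  \<comment> \<open>For an empty set the time takes its default value
    \<open>real M * \<tau>\<close>, which exceeds \<open>real l * \<tau>\<close>.\<close>
  have "S \<noteq> {}"
  proof
    assume "S = {}"
    then have "real M * \<tau> \<le> real l * \<tau>" using le st by simp
    then show False using \<open>l < M\<close> \<tau> by simp
  qed
  moreover have "finite S"
    by (rule finite_subset[of _ "(\<lambda>m. real m * \<tau>) ` {..M}"]) (auto simp: S_def)
  ultimately have "Min S \<in> S" by (intro Min_in)
  then obtain m where m: "Min S = real m * \<tau>" "Max ((\<lambda>n. sobolev_norm 2 2 (u n \<omega>)) ` {0..m}) \<ge> ennreal R"
    by (auto simp: S_def)
  have "real m * \<tau> \<le> real l * \<tau>" using le st \<open>S \<noteq> {}\<close> m(1) by simp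
  then have "m \<le> l" using \<tau> by simp
  have "Max ((\<lambda>n. sobolev_norm 2 2 (u n \<omega>)) ` {0..m}) \<in> (\<lambda>n. sobolev_norm 2 2 (u n \<omega>)) ` {0..m}"
    by (intro Max_in) auto
  then have "\<exists>n\<in>{0..m}. Max ((\<lambda>n. sobolev_norm 2 2 (u n \<omega>)) ` {0..m}) = sobolev_norm 2 2 (u n \<omega>)"
    by (simp only: image_iff)
  then obtain n where n: "n \<in> {0..m}" "Max ((\<lambda>n. sobolev_norm 2 2 (u n \<omega>)) ` {0..m}) = sobolev_norm 2 2 (u n \<omega>)" ..
  have "n \<le> l" using n(1) \<open>m \<le> l\<close> by simp
  moreover have "ennreal R \<le> sobolev_norm 2 2 (u n \<omega>)" using m(2) unfolding n(2) .
  ultimately show ?thesis by blast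
qed

context filtered_wiener
begin

lemma measurable_scheme:
  assumes "u\<^sub>0 \<in> measurable (F 0) (borel_sobolev_div 2)" "euler_solution P F e \<beta> \<mu> \<Phi> u\<^sub>0 \<tau> M u" "m \<le> M"
  shows "u m \<in> borel_measurable (F (real m * \<tau>))"
proof (cases "m = 0")
  case True
  then show ?thesis
    using measurable_compose[OF assms(1) measurable_borel_sobolev_div] assms(2) by (simp add: euler_solution_def)
next
  case False
  then have "u m \<in> measurable (F (real m * \<tau>)) (borel_sobolev_div 1)"
    using assms(2,3) by (simp add: euler_solution_def)
  from measurable_compose[OF this measurable_borel_sobolev_div] show ?thesis .
qed

text \<open>Outside two events the deterministic step \<open>euler_step\<close> applies: that
  \<open>h2_norm (u m)\<close> exceeds \<open>K\<close>, and that the noise has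
  \<open>h2_norm\<close> at least 1 while \<open>u m\<close> is bounded. Markov's inequality bounds
  the probability of the second by \<open>2 * \<tau> * Q\<close>.\<close>

lemma tight_step:
  fixes \<Phi> :: "L2_torus \<Rightarrow> 'u::real_normed_vector \<Rightarrow>\<^sub>L L2_torus"
  assumes sol: "euler_solution P F e \<beta> \<mu> \<Phi> u\<^sub>0 \<tau> M u" and m: "Suc m \<le> M" and \<tau>: "0 < \<tau>" and \<mu>: "0 < \<mu>"
    and u0: "u\<^sub>0 \<in> measurable (F 0) (borel_sobolev_div 2)"
    and \<Phi>_cont: "\<And>k. continuous_on UNIV (\<lambda>v. blinfun_apply (\<Phi> v) (e k))"
    and K: "0 \<le> K" and Q: "0 \<le> Q" "\<And>v j. h2_norm v \<le> ennreal K \<Longrightarrow> norm (blinfun_apply (\<Phi> v) (e j)) \<le> Q"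
      "\<And>v. h2_norm v \<le> ennreal K \<Longrightarrow> (\<Sum>j. h2_norm (blinfun_apply (\<Phi> v) (e j))) \<le> ennreal Q"
    and small: "64 * (wt_sum * (ennreal (81 * \<tau> / \<mu>) * ennreal K)) \<le> 1"
  shows "prob {\<omega> \<in> space P. h2_norm (u (Suc m) \<omega>) > ennreal (144 * (K + 1))}
    \<le> prob {\<omega> \<in> space P. h2_norm (u m \<omega>) > ennreal K} + 2 * \<tau> * Q"
proof -
  define s t where "s = real m * \<tau>" and "t = real (Suc m) * \<tau>"
  have st: "0 \<le> s" "s < t" "t - s = \<tau>" using \<tau> by (simp_all add: s_def t_def algebra_simps)
  have sub: "space (F s) = space P" "space (F t) = space P"
    using stochastic_basis_subalgebra[OF basis] st by (simp_all add: subalgebra_def)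
  have um: "u m \<in> borel_measurable (F s)" unfolding s_def using measurable_scheme[OF u0 sol] m by simp
  have umP: "u m \<in> borel_measurable P" using measurable_F[OF st(1) um] .
  obtain \<xi> where \<xi>: "is_noise_increment P e \<beta> s t (\<lambda>\<omega>. \<Phi> (u m \<omega>)) \<xi>"
    and eq: "AE \<omega> in P. \<forall>\<phi>\<in>sobolev_div 1. u (Suc m) \<omega> \<bullet> \<phi> - \<tau> * convection (u (Suc m) \<omega>) (u m \<omega>) \<phi>
             = - \<mu> * \<tau> * dirichlet (u (Suc m) \<omega>) \<phi> + u m \<omega> \<bullet> \<phi> + \<xi> \<omega> \<bullet> \<phi>"
    and div: "u (Suc m) \<in> measurable (F t) (borel_sobolev_div 1)"
  proof -
    have "Suc m \<in> {1..M}" using m by simp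
    then have *: "u (Suc m) \<in> measurable (F (real (Suc m) * \<tau>)) (borel_sobolev_div 1) \<and>
        (\<exists>\<xi>. is_noise_increment P e \<beta> (real (Suc m - 1) * \<tau>) (real (Suc m) * \<tau>) (\<lambda>\<omega>. \<Phi> (u (Suc m - 1) \<omega>)) \<xi> \<and>
          (AE \<omega> in P. \<forall>\<phi>\<in>sobolev_div 1.
             u (Suc m) \<omega> \<bullet> \<phi> - \<tau> * convection (u (Suc m) \<omega>) (u (Suc m - 1) \<omega>) \<phi>
             = - \<mu> * \<tau> * dirichlet (u (Suc m) \<omega>) \<phi> + u (Suc m - 1) \<omega> \<bullet> \<phi> + \<xi> \<omega> \<bullet> \<phi>))"
      using sol unfolding euler_solution_def by blast
    then obtain \<xi> where "is_noise_increment P e \<beta> s t (\<lambda>\<omega>. \<Phi> (u m \<omega>)) \<xi>"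
      "AE \<omega> in P. \<forall>\<phi>\<in>sobolev_div 1. u (Suc m) \<omega> \<bullet> \<phi> - \<tau> * convection (u (Suc m) \<omega>) (u m \<omega>) \<phi>
             = - \<mu> * \<tau> * dirichlet (u (Suc m) \<omega>) \<phi> + u m \<omega> \<bullet> \<phi> + \<xi> \<omega> \<bullet> \<phi>"
      unfolding s_def t_def diff_Suc_1 by blast
    moreover have "u (Suc m) \<in> measurable (F t) (borel_sobolev_div 1)" using * unfolding t_def by blast
    ultimately show ?thesis by (rule that)
  qed
  have uSP: "u (Suc m) \<in> borel_measurable P"
    using measurable_F[OF _ measurable_compose[OF div measurable_borel_sobolev_div]] st by simp
  have \<xi>P: "\<xi> \<in> borel_measurable P" using \<xi> by (simp add: is_noise_increment_def)
  note h2m = measurable_compose[OF _ borel_measurable_h2_norm]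
  have [measurable]: "(\<lambda>\<omega>. h2_norm (u m \<omega>)) \<in> borel_measurable P" "(\<lambda>\<omega>. h2_norm (\<xi> \<omega>)) \<in> borel_measurable P"
    "(\<lambda>\<omega>. h2_norm (u (Suc m) \<omega>)) \<in> borel_measurable P"
    by (rule h2m[OF umP] h2m[OF \<xi>P] h2m[OF uSP])+
  define B where "B = {\<omega> \<in> space P. h2_norm (u m \<omega>) \<le> ennreal K}"
  have B: "B \<in> sets (F s)"
    unfolding B_def sub(1)[symmetric] using h2m[OF um] by measurable
  have BP [measurable]: "B \<in> sets P" unfolding B_def by measurable
  \<comment> \<open>The noise is only counted on \<open>B\<close>, an event of \<open>F s\<close>,
    where the bounds \<open>Q\<close> on its coefficients are available.\<close>
  define N where "N \<omega> = indicator B \<omega> * h2_norm (\<xi> \<omega>)" for \<omega>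
  have [measurable]: "N \<in> borel_measurable P" unfolding N_def[abs_def] by measurable
  have "(\<integral>\<^sup>+\<omega>. N \<omega> \<partial>P) \<le> 2 * ennreal (t - s) * (\<integral>\<^sup>+\<omega>. indicator B \<omega> * (\<Sum>k. h2_norm (blinfun_apply (\<Phi> (u m \<omega>)) (e k))) \<partial>P)"
    unfolding N_def
  proof (rule noise_h2_norm[OF st(1,2) \<xi> B])
    show "norm (blinfun_apply (\<Phi> (u m \<omega>)) (e k)) \<le> Q" if "\<omega> \<in> B" for k \<omega>
      using that Q(2) by (simp add: B_def)
    fix k q
    have "(\<lambda>v. blinfun_apply (\<Phi> v) (e k) \<bullet> q) \<in> borel_measurable borel"
      by (intro borel_measurable_continuous_onI continuous_intros \<Phi>_cont)
    from measurable_compose[OF um this] show "(\<lambda>\<omega>. blinfun_apply (\<Phi> (u m \<omega>)) (e k) \<bullet> q) \<in> borel_measurable (F s)" .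
  qed
  also have "\<dots> \<le> 2 * ennreal (t - s) * (\<integral>\<^sup>+\<omega>. ennreal Q \<partial>P)"
    using Q(3) by (intro mult_left_mono nn_integral_mono) (auto simp: B_def indicator_def)
  also have "\<dots> = ennreal (2 * \<tau> * Q)"
    using \<tau> Q(1) by (simp add: st(3) emeasure_space_1 ennreal_mult)
  finally have N_int: "(\<integral>\<^sup>+\<omega>. N \<omega> \<partial>P) \<le> ennreal (2 * \<tau> * Q)" .
  have "emeasure P {\<omega> \<in> space P. 1 \<le> N \<omega>} \<le> (\<integral>\<^sup>+\<omega>. N \<omega> \<partial>P)"
  proof -
    have "emeasure P {\<omega> \<in> space P. 1 \<le> N \<omega>} = (\<integral>\<^sup>+\<omega>. indicator {\<omega> \<in> space P. 1 \<le> N \<omega>} \<omega> \<partial>P)"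
      by (rule nn_integral_indicator[symmetric]) measurable
    also have "\<dots> \<le> (\<integral>\<^sup>+\<omega>. N \<omega> \<partial>P)"
      by (intro nn_integral_mono) (auto simp: indicator_def)
    finally show ?thesis .
  qed
  with N_int have "emeasure P {\<omega> \<in> space P. 1 \<le> N \<omega>} \<le> ennreal (2 * \<tau> * Q)" by (rule order_trans[rotated])
  then have pN: "prob {\<omega> \<in> space P. 1 \<le> N \<omega>} \<le> 2 * \<tau> * Q"
    using \<tau> Q(1) by (simp add: emeasure_eq_measure)
  \<comment> \<open>The equation itself holds only almost surely, so the inclusion of events does as
    well.\<close>
  have "AE \<omega> in P. \<omega> \<in> {\<omega> \<in> space P. h2_norm (u (Suc m) \<omega>) > ennreal (144 * (K + 1))} \<longrightarrow>
      \<omega> \<in> {\<omega> \<in> space P. h2_norm (u m \<omega>) > ennreal K} \<union> {\<omega> \<in> space P. 1 \<le> N \<omega>}"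
    using eq AE_space
  proof eventually_elim
    case (elim \<omega>)
    have False if *: "h2_norm (u (Suc m) \<omega>) > ennreal (144 * (K + 1))" "\<not> h2_norm (u m \<omega>) > ennreal K" "\<not> 1 \<le> N \<omega>"
    proof -
      have hv: "h2_norm (u m \<omega>) \<le> ennreal K" using *(2) by simp
      then have "\<omega> \<in> B" using elim(2) by (simp add: B_def)
      then have h\<xi>: "h2_norm (\<xi> \<omega>) \<le> 1" using *(3) by (simp add: N_def)
      have "h2_norm (u (Suc m) \<omega>) \<le> 144 * (h2_norm (u m \<omega>) + h2_norm (\<xi> \<omega>))"
      proof (rule euler_step[OF _ \<tau> \<mu>])
        show "u (Suc m) \<omega> \<in> sobolev_div 1"
          using measurable_space[OF div, of \<omega>] elim(2) by (simp add: sub space_borel_sobolev_div)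
        show "u (Suc m) \<omega> \<bullet> \<phi> - \<tau> * convection (u (Suc m) \<omega>) (u m \<omega>) \<phi>
             = - \<mu> * \<tau> * dirichlet (u (Suc m) \<omega>) \<phi> + u m \<omega> \<bullet> \<phi> + \<xi> \<omega> \<bullet> \<phi>" if "\<phi> \<in> sobolev_div 1" for \<phi>
          using elim(1) that by blast
        have "64 * (wt_sum * (ennreal (81 * \<tau> / \<mu>) * h2_norm (u m \<omega>))) \<le> 64 * (wt_sum * (ennreal (81 * \<tau> / \<mu>) * ennreal K))"
          by (intro mult_left_mono hv) auto
        with small show "64 * (wt_sum * (ennreal (81 * \<tau> / \<mu>) * h2_norm (u m \<omega>))) \<le> 1" by (rule order_trans[rotated])
      qed
      also have "\<dots> \<le> 144 * (ennreal K + 1)" by (intro mult_left_mono add_mono hv h\<xi>) auto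
      also have "\<dots> = ennreal (144 * (K + 1))" using K by (simp add: ennreal_mult ennreal_plus)
      finally show False using *(1) by simp
    qed
    then show ?case using elim(2) by blast
  qed
  then have "prob {\<omega> \<in> space P. h2_norm (u (Suc m) \<omega>) > ennreal (144 * (K + 1))}
    \<le> prob ({\<omega> \<in> space P. h2_norm (u m \<omega>) > ennreal K} \<union> {\<omega> \<in> space P. 1 \<le> N \<omega>})"
    by (rule finite_measure_mono_AE) measurable
  also have "\<dots> \<le> prob {\<omega> \<in> space P. h2_norm (u m \<omega>) > ennreal K} + prob {\<omega> \<in> space P. 1 \<le> N \<omega>}"
    by (rule measure_Un_le) measurable
  finally show ?thesis using pN by linarith
qed

text \<open>Induction on the step number. Each step replaces the level \<open>K\<close> by
  \<open>144 * (K + 1)\<close> and adds \<open>2 * \<tau> * Q\<close> to the probability; both are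
  independent of \<open>M\<close> once the level is fixed, and \<open>\<tau>\<close> tends to
  0.\<close>

lemma tightness:
  fixes \<Phi> :: "L2_torus \<Rightarrow> 'u::real_normed_vector \<Rightarrow>\<^sub>L L2_torus"
  assumes T: "0 < T" and \<mu>: "0 < \<mu>" and C: "0 < C"
    and sol: "\<And>M. M \<ge> 1 \<Longrightarrow> euler_solution P F e \<beta> \<mu> \<Phi> u\<^sub>0 (T / real M) M (u M)"
    and u0: "u\<^sub>0 \<in> measurable (F 0) (borel_sobolev_div 2)"
    and \<Phi>_cont: "\<And>k. continuous_on UNIV (\<lambda>v. blinfun_apply (\<Phi> v) (e k))"
    and \<Phi>_W22: "\<And>v. v \<in> sobolev 2 2 \<Longrightarrow> HS_norm e (sobolev_norm 2 2) (blinfun_apply (\<Phi> v))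
            \<le> ennreal C * (1 + (sobolev_norm 1 4 v)\<^sup>2 + sobolev_norm 2 2 v)"
    and \<epsilon>: "0 < \<epsilon>"
  shows "\<exists>K\<ge>0. eventually (\<lambda>M. prob {\<omega> \<in> space P. h2_norm (u M m \<omega>) > ennreal K} \<le> \<epsilon>) sequentially"
  using \<epsilon>
proof (induction m arbitrary: \<epsilon>)
  case 0
  \<comment> \<open>The initial datum is finite in W^{2,2} at every point, so these events decrease
    to the empty set and continuity from above applies.\<close>
  define A where "A n = {\<omega> \<in> space P. h2_norm (u\<^sub>0 \<omega>) > ennreal (real n)}" for n
  have u0P: "u\<^sub>0 \<in> borel_measurable P"
    using measurable_F[OF _ measurable_compose[OF u0 measurable_borel_sobolev_div]] by simp
  have "(\<lambda>\<omega>. h2_norm (u\<^sub>0 \<omega>)) \<in> borel_measurable P" by (rule measurable_compose[OF u0P borel_measurable_h2_norm])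
  then have A: "A n \<in> sets P" for n unfolding A_def by measurable
  have "decseq A"
    unfolding decseq_def A_def
  proof (intro allI impI subsetI CollectI conjI)
    fix m n :: nat and \<omega> assume "m \<le> n" and \<omega>: "\<omega> \<in> {\<omega> \<in> space P. h2_norm (u\<^sub>0 \<omega>) > ennreal (real n)}"
    then have "ennreal (real m) \<le> ennreal (real n)" by (intro ennreal_leI) simp
    also have "\<dots> < h2_norm (u\<^sub>0 \<omega>)" using \<omega> by simp
    finally show "ennreal (real m) < h2_norm (u\<^sub>0 \<omega>)" .
  qed auto
  with A have "(\<lambda>n. prob (A n)) \<longlonglongrightarrow> prob (\<Inter>n. A n)"
    by (intro finite_Lim_measure_decseq) auto
  moreover have "(\<Inter>n. A n) = {}"
  proof -
    have "\<exists>n. \<omega> \<notin> A n" for \<omega>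
    proof (cases "\<omega> \<in> space P")
      case True
      have "space (F 0) = space P" using stochastic_basis_subalgebra[OF basis] by (simp add: subalgebra_def)
      with True have "u\<^sub>0 \<omega> \<in> sobolev_div 2"
        using measurable_space[OF u0, of \<omega>] by (simp add: space_borel_sobolev_div)
      then have "sobolev_norm 2 2 (u\<^sub>0 \<omega>) < \<infinity>" by (simp add: sobolev_div_def sobolev_def)
      then have "4 * (sobolev_norm 2 2 (u\<^sub>0 \<omega>))\<^sup>2 < \<infinity>"
        by (simp add: power2_eq_square ennreal_mult_less_top)
      with h2_norm_le_sobolev_norm have "h2_norm (u\<^sub>0 \<omega>) < \<infinity>" by (rule order.strict_trans1)
      then obtain r where r: "h2_norm (u\<^sub>0 \<omega>) = ennreal r" "0 \<le> r" by (auto simp: less_top_ennreal)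
      obtain n where "r \<le> real n" using real_arch_simple by blast
      then have "\<omega> \<notin> A n" using r by (simp add: A_def ennreal_leI not_less)
      then show ?thesis ..
    qed (auto simp: A_def)
    then show ?thesis by blast
  qed
  ultimately have "(\<lambda>n. prob (A n)) \<longlonglongrightarrow> 0" by simp
  then have "eventually (\<lambda>n. prob (A n) < \<epsilon>) sequentially" using 0 by (rule order_tendstoD)
  then obtain n where n: "prob (A n) < \<epsilon>" by (auto simp: eventually_sequentially)
  have "eventually (\<lambda>M. prob {\<omega> \<in> space P. h2_norm (u M 0 \<omega>) > ennreal (real n)} \<le> \<epsilon>) sequentially"
    using eventually_ge_at_top[of 1]
  proof eventually_elim
    case (elim M)
    then have "u M 0 = u\<^sub>0" using sol by (simp add: euler_solution_def)
    then show ?case using n by (simp add: A_def)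
  qed
  then show ?case by (intro exI[of _ "real n"]) simp
next
  case (Suc m)
  obtain K where K: "0 \<le> K" "eventually (\<lambda>M. prob {\<omega> \<in> space P. h2_norm (u M m \<omega>) > ennreal K} \<le> \<epsilon> / 2) sequentially"
    using Suc.IH[of "\<epsilon> / 2"] Suc.prems by auto
  obtain Q where Q: "0 \<le> Q" "\<And>v j. h2_norm v \<le> ennreal K \<Longrightarrow> norm (blinfun_apply (\<Phi> v) (e j)) \<le> Q"
      "\<And>v. h2_norm v \<le> ennreal K \<Longrightarrow> (\<Sum>j. h2_norm (blinfun_apply (\<Phi> v) (e j))) \<le> ennreal Q"
    using noise_coefficient_bound[OF C K(1) \<Phi>_W22] by metis
  define a where "a = enn2real wt_sum"
  have a: "wt_sum = ennreal a" "0 \<le> a" using wt_sum_finite by (simp_all add: a_def)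
  have lim: "(\<lambda>M. c * (T / real M)) \<longlonglongrightarrow> c * 0" for c
    by (intro tendsto_mult tendsto_const lim_const_over_n)
  \<comment> \<open>For large \<open>M\<close> the smallness condition of \<open>tight_step\<close>
    holds at the level \<open>K\<close>, which was fixed before \<open>M\<close>.\<close>
  have "eventually (\<lambda>M. (64 * a * (81 / \<mu>) * K) * (T / real M) < 1) sequentially"
    using lim[of "64 * a * (81 / \<mu>) * K"] by (intro order_tendstoD(2)[where a = "1::real"]) auto
  moreover have "eventually (\<lambda>M. (2 * Q) * (T / real M) < \<epsilon> / 2) sequentially"
    using lim[of "2 * Q"] Suc.prems by (intro order_tendstoD(2)[where a = "\<epsilon> / 2"]) auto
  ultimately have "eventually (\<lambda>M. prob {\<omega> \<in> space P. h2_norm (u M (Suc m) \<omega>) > ennreal (144 * (K + 1))} \<le> \<epsilon>) sequentially"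
    using K(2) eventually_ge_at_top[of "Suc m"]
  proof eventually_elim
    case (elim M)
    have M: "1 \<le> M" using elim(4) by simp
    define \<tau> where "\<tau> = T / real M"
    have \<tau>: "0 < \<tau>" using T M by (simp add: \<tau>_def)
    have "64 * (wt_sum * (ennreal x * ennreal K)) = ennreal (64 * (a * (x * K)))" if "0 \<le> x" for x
      using a K(1) that by (simp add: ennreal_mult)
    then have "64 * (wt_sum * (ennreal (81 * \<tau> / \<mu>) * ennreal K)) = ennreal (64 * (a * ((81 * \<tau> / \<mu>) * K)))"
      using \<tau> \<mu> by (simp only: divide_nonneg_pos mult_nonneg_nonneg zero_le_numeral less_imp_le)
    also have "\<dots> \<le> ennreal 1"
      using elim(1) by (intro ennreal_leI) (simp add: \<tau>_def ac_simps)
    finally have small: "64 * (wt_sum * (ennreal (81 * \<tau> / \<mu>) * ennreal K)) \<le> 1" by simp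
    have "prob {\<omega> \<in> space P. h2_norm (u M (Suc m) \<omega>) > ennreal (144 * (K + 1))}
      \<le> prob {\<omega> \<in> space P. h2_norm (u M m \<omega>) > ennreal K} + 2 * \<tau> * Q"
      by (rule tight_step[OF sol[OF M, folded \<tau>_def] elim(4) \<tau> \<mu> u0 \<Phi>_cont K(1) Q(1) _ _ small]) (erule Q)+
    also have "2 * \<tau> * Q = 2 * Q * (T / real M)" by (simp add: \<tau>_def)
    finally show ?case using elim(2,3) by linarith
  qed
  then show ?case using K(1) by (intro exI[of _ "144 * (K + 1)"]) simp
qed

end

theorem lemma4p4:
  fixes P :: "'w measure" and F :: "real \<Rightarrow> 'w measure"
    and e :: "nat \<Rightarrow> 'u::{real_inner, complete_space}" and \<beta> :: "nat \<Rightarrow> real \<Rightarrow> 'w \<Rightarrow> real"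
    and T \<mu> C :: real
    and \<Phi> :: "L2_torus \<Rightarrow> 'u \<Rightarrow>\<^sub>L L2_torus"
    and D\<Phi> :: "nat \<Rightarrow> L2_torus \<Rightarrow> L2_torus \<Rightarrow>\<^sub>L L2_torus"
    and D2\<Phi> :: "nat \<Rightarrow> L2_torus \<Rightarrow> L2_torus \<Rightarrow>\<^sub>L L2_torus \<Rightarrow>\<^sub>L L2_torus"
    and u\<^sub>0 :: "'w \<Rightarrow> L2_torus" and u :: "nat \<Rightarrow> nat \<Rightarrow> 'w \<Rightarrow> L2_torus"
  assumes basis: "stochastic_basis P F"
    and e: "complete_orthonormal e"
    and \<beta>: "cylindrical_wiener P F \<beta>"
    and T: "T > 0" and \<mu>: "\<mu> > 0" and C: "C > 0"
    and \<Phi>_HS: "\<And>v. HS_norm e L2_norm (blinfun_apply (\<Phi> v)) < \<infinity>"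
    and \<Phi>_HS_W: "\<And>k v. k \<in> {1, 2} \<Longrightarrow> v \<in> sobolev k 2 \<Longrightarrow>
          HS_norm e (sobolev_norm k 2) (blinfun_apply (\<Phi> v)) < \<infinity>"
    and \<Phi>_lipschitz: "\<And>v w. HS_norm e L2_norm (blinfun_apply (\<Phi> v - \<Phi> w)) \<le> ennreal (C * norm (v - w))"
    and D\<Phi>: "\<And>k v. ((\<lambda>w. blinfun_apply (\<Phi> w) (e k)) has_derivative blinfun_apply (D\<Phi> k v)) (at v)"
    and D\<Phi>_bound: "\<And>v. ell2_norm (\<lambda>k. ennreal (norm (D\<Phi> k v))) \<le> ennreal C"
    and D2\<Phi>: "\<And>k v. (D\<Phi> k has_derivative blinfun_apply (D2\<Phi> k v)) (at v)"
    and D2\<Phi>_bound: "\<And>v. ell2_norm (\<lambda>k. ennreal (norm (D2\<Phi> k v))) \<le> ennreal C"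
    and \<Phi>_W12: "\<And>v. v \<in> sobolev 1 2 \<Longrightarrow>
          HS_norm e (sobolev_norm 1 2) (blinfun_apply (\<Phi> v)) \<le> ennreal C * (1 + sobolev_norm 1 2 v)"
    and \<Phi>_W22: "\<And>v. v \<in> sobolev 2 2 \<Longrightarrow>
          HS_norm e (sobolev_norm 2 2) (blinfun_apply (\<Phi> v))
            \<le> ennreal C * (1 + (sobolev_norm 1 4 v)\<^sup>2 + sobolev_norm 2 2 v)"
    and u0_meas: "u\<^sub>0 \<in> measurable (F 0) (borel_sobolev_div 2)"
    and u0_L2: "(\<integral>\<^sup>+\<omega>. (sobolev_norm 2 2 (u\<^sub>0 \<omega>))\<^sup>2 \<partial>P) < \<infinity>"
    and u: "\<And>M. M \<ge> 1 \<Longrightarrow> euler_solution P F e \<beta> \<mu> \<Phi> u\<^sub>0 (T / real M) M (u M)"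
  shows "\<exists>c>0. \<forall>R :: real \<Rightarrow> real.
      (\<forall>M\<ge>1. R (T / real M) > 0) \<longrightarrow>
      filterlim (\<lambda>M. R (T / real M)) at_top sequentially \<longrightarrow>
      (\<lambda>M. (T / real M) * exp (c * (R (T / real M))\<^sup>2)) \<longlonglongrightarrow> 0 \<longrightarrow>
      (\<forall>l :: nat. (\<lambda>M. measure P {\<omega> \<in> space P.
          stopping_time_d (T / real M) M (R (T / real M)) (u M) \<omega> \<le> real l * (T / real M)}) \<longlonglongrightarrow> 0)"
proof -
  interpret filtered_wiener P F \<beta> using basis \<beta> by unfold_locales
  have \<Phi>_cont: "continuous_on UNIV (\<lambda>v. blinfun_apply (\<Phi> v) (e k))" for k
    by (intro continuous_at_imp_continuous_on ballI has_derivative_continuous[OF D\<Phi>])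
  have tight: "\<exists>K\<ge>0. eventually (\<lambda>M. prob {\<omega> \<in> space P. h2_norm (u M m \<omega>) > ennreal K} \<le> \<delta>) sequentially"
    if "0 < \<delta>" for m \<delta>
    by (rule tightness[OF T \<mu> C _ u0_meas _ _ that]) (erule u | rule \<Phi>_cont | erule \<Phi>_W22)+
  define c where "c = real (4096 * num_idx)"
  have c: "0 \<le> c" by (simp add: c_def)
  have main: "(\<lambda>M. prob {\<omega> \<in> space P. stopping_time_d (T / real M) M (R (T / real M)) (u M) \<omega> \<le> real l * (T / real M)}) \<longlonglongrightarrow> 0"
    if R: "filterlim (\<lambda>M. R (T / real M)) at_top sequentially" for R :: "real \<Rightarrow> real" and l :: nat
  proof (rule order_tendstoI)
    fix \<epsilon> :: real assume \<epsilon>: "0 < \<epsilon>"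
    \<comment> \<open>There are \<open>l + 1\<close> events to sum; the factor 2 leaves room for a
      strict inequality.\<close>
    define \<delta> where "\<delta> = \<epsilon> / (2 * real (Suc l))"
    have \<delta>: "0 < \<delta>" using \<epsilon> by (simp add: \<delta>_def)
    define good where "good n K \<longleftrightarrow> 0 \<le> K \<and> eventually (\<lambda>M. prob {\<omega> \<in> space P. h2_norm (u M n \<omega>) > ennreal K} \<le> \<delta>) sequentially" for n K
    have "\<exists>K. good n K" for n unfolding good_def using tight[OF \<delta>, of n] by simp
    then obtain K where "good n (K n)" for n by metis
    then have K: "0 \<le> K n"
      "eventually (\<lambda>M. prob {\<omega> \<in> space P. h2_norm (u M n \<omega>) > ennreal (K n)} \<le> \<delta>) sequentially" for n
      unfolding good_def by blast+
    have "eventually (\<lambda>M. \<forall>n\<in>{..l}. prob {\<omega> \<in> space P. h2_norm (u M n \<omega>) > ennreal (K n)} \<le> \<delta>) sequentially"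
      using K(2) by (intro eventually_ball_finite) auto
    \<comment> \<open>By \<open>sobolev_norm_le_h2_norm\<close> a field with \<open>h2_norm\<close>
      at most \<open>K n\<close> has W^{2,2} norm at most \<open>sqrt (c * K n)\<close>, hence below
      \<open>R\<close>.\<close>
    moreover have "eventually (\<lambda>M. \<forall>n\<in>{..l}. sqrt (c * K n) < R (T / real M)) sequentially"
      using R by (intro eventually_ball_finite ballI) (auto simp: filterlim_at_top_dense)
    ultimately show "eventually (\<lambda>M. prob {\<omega> \<in> space P. stopping_time_d (T / real M) M (R (T / real M)) (u M) \<omega> \<le> real l * (T / real M)} < \<epsilon>) sequentially"
      using eventually_gt_at_top[of l]
    proof eventually_elim
      case (elim M)
      define \<tau> where "\<tau> = T / real M"
      have M: "1 \<le> M" using elim(3) by simp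
      have \<tau>: "0 < \<tau>" using T M by (simp add: \<tau>_def)
      let ?A = "\<lambda>n. {\<omega> \<in> space P. h2_norm (u M n \<omega>) > ennreal (K n)}"
      have A: "?A n \<in> sets P" if "n \<le> l" for n
      proof -
        have "u M n \<in> borel_measurable P"
          using measurable_F[OF _ measurable_scheme[OF u0_meas u[OF M], of n]] that elim(3) T by simp
        from measurable_compose[OF this borel_measurable_h2_norm] show ?thesis by measurable
      qed
      have "{\<omega> \<in> space P. stopping_time_d \<tau> M (R \<tau>) (u M) \<omega> \<le> real l * \<tau>} \<subseteq> (\<Union>n\<in>{..l}. ?A n)"
      proof clarify
        fix \<omega> assume \<omega>: "\<omega> \<in> space P" "stopping_time_d \<tau> M (R \<tau>) (u M) \<omega> \<le> real l * \<tau>"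
        from stopping_time_d_le_imp[OF \<omega>(2) elim(3) \<tau>]
        obtain n where n: "n \<le> l" "ennreal (R \<tau>) \<le> sobolev_norm 2 2 (u M n \<omega>)" by blast
        have "h2_norm (u M n \<omega>) > ennreal (K n)"
        proof (rule ccontr)
          assume "\<not> h2_norm (u M n \<omega>) > ennreal (K n)"
          then have le: "h2_norm (u M n \<omega>) \<le> ennreal (K n)" by simp
          have "(ennreal (R \<tau>))\<^sup>2 \<le> (sobolev_norm 2 2 (u M n \<omega>))\<^sup>2"
            using n(2) by (rule power_mono) simp
          also have "\<dots> \<le> of_nat (4096 * num_idx) * h2_norm (u M n \<omega>)"
            by (rule sobolev_norm_le_h2_norm) simp
          also have "\<dots> \<le> ennreal c * ennreal (K n)"
            using le unfolding c_def ennreal_of_nat_eq_real_of_nat by (intro mult_left_mono) auto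
          also have "\<dots> = (ennreal (sqrt (c * K n)))\<^sup>2"
            using c K(1)[of n] by (simp add: ennreal_power flip: ennreal_mult)
          finally have "ennreal (R \<tau>) \<le> ennreal (sqrt (c * K n))"
            using c K(1)[of n] by (intro ennreal_power2_le_imp_le) auto
          then have "R \<tau> \<le> sqrt (c * K n)" using c K(1)[of n] by (simp add: ennreal_le_iff)
          then show False using elim(2) n(1) by (auto simp: \<tau>_def dest!: bspec[of _ _ n])
        qed
        with \<omega>(1) n(1) show "\<omega> \<in> (\<Union>n\<in>{..l}. ?A n)" by blast
      qed
      \<comment> \<open>The left event has not been shown to be measurable; if it is not, its \<open>measure\<close> is 0.\<close>
      then have "prob {\<omega> \<in> space P. stopping_time_d \<tau> M (R \<tau>) (u M) \<omega> \<le> real l * \<tau>} \<le> prob (\<Union>n\<in>{..l}. ?A n)"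
        using A by (intro finite_measure_mono sets.finite_UN) auto
      also have "\<dots> \<le> (\<Sum>n\<in>{..l}. prob (?A n))"
        using A by (intro finite_measure_subadditive_finite) auto
      also have "\<dots> \<le> (\<Sum>n\<in>{..l}. \<delta>)" using elim(1) by (intro sum_mono) auto
      also have "\<dots> = real (Suc l) * \<delta>" by (simp only: sum_constant card_atMost)
      also have "\<dots> = \<epsilon> / 2" unfolding \<delta>_def by (simp del: of_nat_Suc)
      also have "\<dots> < \<epsilon>" using \<epsilon> by simp
      finally show ?case by (simp only: \<tau>_def)
    qed
  next
    fix \<epsilon> :: real assume "\<epsilon> < 0"
    then show "eventually (\<lambda>M. \<epsilon> < prob {\<omega> \<in> space P. stopping_time_d (T / real M) M (R (T / real M)) (u M) \<omega> \<le> real l * (T / real M)}) sequentially"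
      by (intro always_eventually allI order.strict_trans2[OF _ measure_nonneg])
  qed
  \<comment> \<open>By \<open>main\<close> the limit follows from the divergence of
    \<open>R\<close>, so the positive number 1 serves as the constant.\<close>
  show ?thesis by (rule exI[of _ 1]) (use main in auto)
qed

end
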